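(* Let $k$ be a field, let $R$ be a noetherian Hopf $k$-algebra and suppose that the skew polynomial extension $T=R[x;\sigma,\delta]$ (with $\sigma$ a $k$-algebra automorphism and $\delta$ a $k$-linear $\sigma$-derivation of $R$) admits a Hopf algebra structure extending that of $R$ (i.e. with $R$ a Hopf subalgebra). Suppose that $R\otimes_k R$ is a domain. Then after a change of the variable $x$, we have $$\Delta(x)=\beta^{-1}\otimes x+x\otimes 1+w,$$ where $\beta$ is a grouplike element of $R$ and $w=\sum w_1\otimes w_2\in R\otimes_k R$. In particular, after a change of the variable $x$, there are $a,b\in R$ and $v,w\in R\otimes_k R$ such that $\Delta(x)=a\otimes x+x\otimes b+v(x\otimes x)+w$; that is, $T$ is a Hopf Ore extension of $R$.
   Context: A $\sigma$-derivation $\delta$ of $R$ is a $k$-linear map with $\delta(ab)=\sigma(a)\delta(b)+\delta(a)b$. The skew polynomial extension $R[x;\sigma,\delta]$ is the $k$-algebra generated by $R$ and $x$ with relations $xr=\sigma(r)x+\delta(r)$ for $r\in R$; it is a free left $R$-module with basis $\{x^i: i\ge 0\}$. A "change of the variable $x$" means replacing $x$ by an element $x'\in T$ such that $T=R[x';\sigma',\delta']$ for some automorphism $\sigma'$ and $\sigma'$-derivation $\delta'$ of $R$; the new variable is again denoted $x$. A grouplike element is a $\beta\in R$ with $\Delta(\beta)=\beta\otimes\beta$, $\epsilon(\beta)=1$. Domain means a (not necessarily commutative) nonzero ring without zero divisors. A Hopf Ore extension of a Hopf $k$-algebra $R$ is a $k$-algebra $T$ such that: (i) $T$ is a Hopf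 $k$-algebra with Hopf subalgebra $R$; (ii) there exist an algebra automorphism $\sigma$ and a $\sigma$-derivation $\delta$ of $R$ such that $T=R[x;\sigma,\delta]$; (iii) there are $a,b\in R$ and $v,w\in R\otimes_k R$ such that $\Delta(x)=a\otimes x+x\otimes b+v(x\otimes x)+w$. *)

theory Defs
  imports "HOL-Algebra.Algebra"
begin

section \<open>Associative algebras over a field\<close>

text \<open>The locale \<^locale>\<open>algebra\<close> of the library is about commutative algebras only, and the
  locales \<^locale>\<open>domain\<close> and \<^locale>\<open>noetherian_ring\<close> are about commutative rings and
  two-sided ideals, respectively.\<close>

locale assoc_algebra = field K + module K A + A?: ring A
  for K (structure) and A (structure) +
  assumes smult_mult_left:
      "\<lbrakk>c \<in> carrier K; x \<in> carrier A; y \<in> carrier A\<rbrakk>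
        \<Longrightarrow> (c \<odot>\<^bsub>A\<^esub> x) \<otimes>\<^bsub>A\<^esub> y = c \<odot>\<^bsub>A\<^esub> (x \<otimes>\<^bsub>A\<^esub> y)"
    and smult_mult_right:
      "\<lbrakk>c \<in> carrier K; x \<in> carrier A; y \<in> carrier A\<rbrakk>
        \<Longrightarrow> x \<otimes>\<^bsub>A\<^esub> (c \<odot>\<^bsub>A\<^esub> y) = c \<odot>\<^bsub>A\<^esub> (x \<otimes>\<^bsub>A\<^esub> y)"

definition linear_map ::
    "('k, 'n) ring_scheme \<Rightarrow> ('k, 'a, 'm) module_scheme \<Rightarrow> ('k, 'b, 'l) module_scheme \<Rightarrow> ('a \<Rightarrow> 'b) set"
  where "linear_map K A B =
    {f. f \<in> carrier A \<rightarrow> carrier B \<and>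
        (\<forall>x\<in>carrier A. \<forall>y\<in>carrier A. f (x \<oplus>\<^bsub>A\<^esub> y) = f x \<oplus>\<^bsub>B\<^esub> f y) \<and>
        (\<forall>c\<in>carrier K. \<forall>x\<in>carrier A. f (c \<odot>\<^bsub>A\<^esub> x) = c \<odot>\<^bsub>B\<^esub> f x)}"

definition alg_hom ::
    "('k, 'n) ring_scheme \<Rightarrow> ('k, 'a, 'm) module_scheme \<Rightarrow> ('k, 'b, 'l) module_scheme \<Rightarrow> ('a \<Rightarrow> 'b) set"
  where "alg_hom K A B = ring_hom A B \<inter> linear_map K A B"

definition alg_auto ::
    "('k, 'n) ring_scheme \<Rightarrow> ('k, 'a, 'm) module_scheme \<Rightarrow> ('a \<Rightarrow> 'a) set"
  where "alg_auto K A = {f \<in> alg_hom K A A. bij_betw f (carrier A) (carrier A)}"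

definition ground_algebra :: "('k, 'n) ring_scheme \<Rightarrow> ('k, 'k) module"
  where "ground_algebra K =
    \<lparr>carrier = carrier K, monoid.mult = monoid.mult K, one = one K, ring.zero = ring.zero K, ring.add = ring.add K, smult = monoid.mult K\<rparr>"

locale nc_domain = ring R for R (structure) +
  assumes one_not_zero: "\<one> \<noteq> \<zero>"
    and no_zero_divisors:
      "\<lbrakk>a \<in> carrier R; b \<in> carrier R; a \<otimes> b = \<zero>\<rbrakk> \<Longrightarrow> a = \<zero> \<or> b = \<zero>"

definition left_ideal :: "'a set \<Rightarrow> ('a, 'm) ring_scheme \<Rightarrow> bool"
  where "left_ideal I R \<longleftrightarrow>
    additive_subgroup I R \<and> (\<forall>r\<in>carrier R. \<forall>a\<in>I. r \<otimes>\<^bsub>R\<^esub> a \<in> I)"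

definition right_ideal :: "'a set \<Rightarrow> ('a, 'm) ring_scheme \<Rightarrow> bool"
  where "right_ideal I R \<longleftrightarrow>
    additive_subgroup I R \<and> (\<forall>r\<in>carrier R. \<forall>a\<in>I. a \<otimes>\<^bsub>R\<^esub> r \<in> I)"

text \<open>Noetherian means left and right noetherian.\<close>

locale nc_noetherian_ring = ring R for R (structure) +
  assumes left_ideal_fin_gen:
      "left_ideal I R \<Longrightarrow>
        \<exists>F \<subseteq> carrier R. finite F \<and> I = \<Inter>{J. left_ideal J R \<and> F \<subseteq> J}"
    and right_ideal_fin_gen:
      "right_ideal I R \<Longrightarrow>
        \<exists>F \<subseteq> carrier R. finite F \<and> I = \<Inter>{J. right_ideal J R \<and> F \<subseteq> J}"


section \<open>Tensor products over the ground field\<close>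

text \<open>\<open>A \<otimes> B\<close> is the free abelian group on \<open>carrier A \<times> carrier B\<close> modulo the subgroup generated
  by the biadditivity relations and \<open>(c a, b) - (a, c b)\<close> for scalars \<open>c\<close>; its elements are the
  cosets of this subgroup.\<close>

definition tensor_relations ::
    "('k, 'n) ring_scheme \<Rightarrow> ('k, 'a, 'm) module_scheme \<Rightarrow> ('k, 'b, 'l) module_scheme
      \<Rightarrow> ('a \<times> 'b \<Rightarrow>\<^sub>0 int) set"
  where "tensor_relations K A B =
    {frag_of (a \<oplus>\<^bsub>A\<^esub> a', b) - frag_of (a, b) - frag_of (a', b) | a a' b.
        a \<in> carrier A \<and> a' \<in> carrier A \<and> b \<in> carrier B} \<union>
    {frag_of (a, b \<oplus>\<^bsub>B\<^esub> b') - frag_of (a, b) - frag_of (a, b') | a b b'.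
        a \<in> carrier A \<and> b \<in> carrier B \<and> b' \<in> carrier B} \<union>
    {frag_of (c \<odot>\<^bsub>A\<^esub> a, b) - frag_of (a, c \<odot>\<^bsub>B\<^esub> b) | a b c.
        a \<in> carrier A \<and> b \<in> carrier B \<and> c \<in> carrier K}"

definition tensor_null ::
    "('k, 'n) ring_scheme \<Rightarrow> ('k, 'a, 'm) module_scheme \<Rightarrow> ('k, 'b, 'l) module_scheme
      \<Rightarrow> ('a \<times> 'b \<Rightarrow>\<^sub>0 int) set"
  where "tensor_null K A B =
    generate (free_Abelian_group (carrier A \<times> carrier B)) (tensor_relations K A B)"

definition tensor_group ::
    "('k, 'n) ring_scheme \<Rightarrow> ('k, 'a, 'm) module_scheme \<Rightarrow> ('k, 'b, 'l) module_scheme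
      \<Rightarrow> ('a \<times> 'b \<Rightarrow>\<^sub>0 int) set monoid"
  where "tensor_group K A B =
    free_Abelian_group (carrier A \<times> carrier B) Mod tensor_null K A B"

definition tensor ::
    "('k, 'n) ring_scheme \<Rightarrow> ('k, 'a, 'm) module_scheme \<Rightarrow> ('k, 'b, 'l) module_scheme
      \<Rightarrow> 'a \<Rightarrow> 'b \<Rightarrow> ('a \<times> 'b \<Rightarrow>\<^sub>0 int) set"
  where "tensor K A B a b =
    tensor_null K A B #>\<^bsub>free_Abelian_group (carrier A \<times> carrier B)\<^esub> frag_of (a, b)"

text \<open>The homomorphism from a tensor product to the (multiplicatively written) abelian group \<open>G\<close>
  induced by a balanced biadditive map \<open>f\<close>, sending the class of \<open>\<Sum> n (a, b)\<close> to the combination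
  of the \<open>f a b\<close> with the integer coefficients \<open>n\<close>. When \<open>f\<close> is balanced, the value does not depend on
  the representative \<open>u\<close>.\<close>

definition tensor_lift ::
    "('c, 'm) monoid_scheme \<Rightarrow> ('a \<Rightarrow> 'b \<Rightarrow> 'c) \<Rightarrow> ('a \<times> 'b \<Rightarrow>\<^sub>0 int) set \<Rightarrow> 'c"
  where "tensor_lift G f t =
    (THE z. \<exists>u\<in>t. z =
      finprod G (\<lambda>p. f (fst p) (snd p) [^]\<^bsub>G\<^esub> Poly_Mapping.lookup u p) (Poly_Mapping.keys u))"

definition tensor_algebra ::
    "('k, 'n) ring_scheme \<Rightarrow> ('k, 'a, 'm) module_scheme \<Rightarrow> ('k, 'b, 'l) module_scheme
      \<Rightarrow> ('k, ('a \<times> 'b \<Rightarrow>\<^sub>0 int) set) module"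
  where "tensor_algebra K A B =
    \<lparr>carrier = carrier (tensor_group K A B),
     monoid.mult = (\<lambda>s t. tensor_lift (tensor_group K A B)
       (\<lambda>a b. tensor_lift (tensor_group K A B)
         (\<lambda>a' b'. tensor K A B (a \<otimes>\<^bsub>A\<^esub> a') (b \<otimes>\<^bsub>B\<^esub> b')) t) s),
     one = tensor K A B \<one>\<^bsub>A\<^esub> \<one>\<^bsub>B\<^esub>,
     ring.zero = \<one>\<^bsub>tensor_group K A B\<^esub>,
     ring.add = monoid.mult (tensor_group K A B),
     smult = (\<lambda>c. tensor_lift (tensor_group K A B) (\<lambda>a b. tensor K A B (c \<odot>\<^bsub>A\<^esub> a) b))\<rparr>"

text \<open>\<open>tensor_map K C D f g\<close> is \<open>f \<otimes> g : A \<otimes> B \<rightarrow> C \<otimes> D\<close>.\<close>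

definition tensor_map ::
    "('k, 'n) ring_scheme \<Rightarrow> ('k, 'c, 'm) module_scheme \<Rightarrow> ('k, 'd, 'l) module_scheme
      \<Rightarrow> ('a \<Rightarrow> 'c) \<Rightarrow> ('b \<Rightarrow> 'd) \<Rightarrow> ('a \<times> 'b \<Rightarrow>\<^sub>0 int) set \<Rightarrow> ('c \<times> 'd \<Rightarrow>\<^sub>0 int) set"
  where "tensor_map K C D f g =
    tensor_lift (tensor_group K C D) (\<lambda>a b. tensor K C D (f a) (g b))"

text \<open>The associator \<open>(A \<otimes> B) \<otimes> C \<rightarrow> A \<otimes> (B \<otimes> C)\<close>.\<close>

definition tensor_assoc ::
    "('k, 'n) ring_scheme \<Rightarrow> ('k, 'a, 'm) module_scheme \<Rightarrow> ('k, 'b, 'l) module_scheme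
      \<Rightarrow> ('k, 'c, 'o) module_scheme
      \<Rightarrow> (('a \<times> 'b \<Rightarrow>\<^sub>0 int) set \<times> 'c \<Rightarrow>\<^sub>0 int) set \<Rightarrow> ('a \<times> ('b \<times> 'c \<Rightarrow>\<^sub>0 int) set \<Rightarrow>\<^sub>0 int) set"
  where "tensor_assoc K A B C =
    tensor_lift (tensor_group K A (tensor_algebra K B C))
      (\<lambda>t c. tensor_lift (tensor_group K A (tensor_algebra K B C))
        (\<lambda>a b. tensor K A (tensor_algebra K B C) a (tensor K B C b c)) t)"


section \<open>Hopf algebras\<close>

record ('k, 'a) hopf = "('k, 'a) module" +
  comult :: "'a \<Rightarrow> ('a \<times> 'a \<Rightarrow>\<^sub>0 int) set"
  counit :: "'a \<Rightarrow> 'k"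
  antipode :: "'a \<Rightarrow> 'a"

locale hopf_algebra = assoc_algebra K H for K (structure) and H :: "('k, 'a, 'm) hopf_scheme" (structure) +
  assumes comult_hom: "comult H \<in> alg_hom K H (tensor_algebra K H H)"
    and counit_hom: "counit H \<in> alg_hom K H (ground_algebra K)"
    and antipode_linear: "antipode H \<in> linear_map K H H"
    and coassoc: "h \<in> carrier H \<Longrightarrow>
      tensor_assoc K H H H
        (tensor_map K (tensor_algebra K H H) H (comult H) (\<lambda>y. y) (comult H h)) =
      tensor_map K H (tensor_algebra K H H) (\<lambda>y. y) (comult H) (comult H h)"
    and counit_left: "h \<in> carrier H \<Longrightarrow>
      tensor_lift (add_monoid H) (\<lambda>y z. counit H y \<odot>\<^bsub>H\<^esub> z) (comult H h) = h"
    and counit_right: "h \<in> carrier H \<Longrightarrow>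
      tensor_lift (add_monoid H) (\<lambda>y z. counit H z \<odot>\<^bsub>H\<^esub> y) (comult H h) = h"
    and antipode_left: "h \<in> carrier H \<Longrightarrow>
      tensor_lift (add_monoid H) (\<lambda>y z. antipode H y \<otimes>\<^bsub>H\<^esub> z) (comult H h) = counit H h \<odot>\<^bsub>H\<^esub> \<one>\<^bsub>H\<^esub>"
    and antipode_right: "h \<in> carrier H \<Longrightarrow>
      tensor_lift (add_monoid H) (\<lambda>y z. y \<otimes>\<^bsub>H\<^esub> antipode H z) (comult H h) = counit H h \<odot>\<^bsub>H\<^esub> \<one>\<^bsub>H\<^esub>"

definition grouplike :: "('k, 'n) ring_scheme \<Rightarrow> ('k, 'a, 'm) hopf_scheme \<Rightarrow> 'a \<Rightarrow> bool"
  where "grouplike K H b \<longleftrightarrow>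
    b \<in> carrier H \<and> comult H b = tensor K H H b b \<and> counit H b = \<one>\<^bsub>K\<^esub>"

text \<open>Subalgebras are subsets of the ambient algebra, but the elements of \<open>R \<otimes> R\<close> are not elements
  of \<open>T \<otimes> T\<close>; \<open>tensor_incl K T\<close> is the map \<open>R \<otimes> R \<rightarrow> T \<otimes> T\<close> induced by the inclusion.\<close>

definition tensor_incl ::
    "('k, 'n) ring_scheme \<Rightarrow> ('k, 'a, 'm) module_scheme \<Rightarrow> ('a \<times> 'a \<Rightarrow>\<^sub>0 int) set \<Rightarrow> ('a \<times> 'a \<Rightarrow>\<^sub>0 int) set"
  where "tensor_incl K T = tensor_map K T T (\<lambda>y. y) (\<lambda>y. y)"

definition hopf_subalgebra ::
    "('k, 'n) ring_scheme \<Rightarrow> ('k, 'a, 'm) hopf_scheme \<Rightarrow> ('k, 'a, 'l) hopf_scheme \<Rightarrow> bool"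
  where "hopf_subalgebra K R T \<longleftrightarrow>
    hopf_algebra K R \<and> hopf_algebra K T \<and> (\<lambda>r. r) \<in> alg_hom K R T \<and>
    (\<forall>r\<in>carrier R.
      comult T r = tensor_incl K T (comult R r) \<and>
      counit T r = counit R r \<and>
      antipode T r = antipode R r)"


section \<open>Skew polynomial extensions and Hopf Ore extensions\<close>

definition skew_derivation ::
    "('k, 'n) ring_scheme \<Rightarrow> ('k, 'a, 'm) module_scheme \<Rightarrow> ('a \<Rightarrow> 'a) \<Rightarrow> ('a \<Rightarrow> 'a) \<Rightarrow> bool"
  where "skew_derivation K R \<sigma> \<delta> \<longleftrightarrow>
    \<delta> \<in> linear_map K R R \<and>
    (\<forall>a\<in>carrier R. \<forall>b\<in>carrier R. \<delta> (a \<otimes>\<^bsub>R\<^esub> b) = \<sigma> a \<otimes>\<^bsub>R\<^esub> \<delta> b \<oplus>\<^bsub>R\<^esub> \<delta> a \<otimes>\<^bsub>R\<^esub> b)"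

text \<open>\<open>skew_polynomial_ext K R T x \<sigma> \<delta>\<close> says that the algebra \<open>T\<close> is \<open>R[x; \<sigma>, \<delta>]\<close>: it contains \<open>R\<close>
  as a subalgebra and \<open>x\<close> as an element, satisfies the commutation relation, and is a free left
  \<open>R\<close>-module with basis the powers of \<open>x\<close>.\<close>

definition skew_polynomial_ext ::
    "('k, 'n) ring_scheme \<Rightarrow> ('k, 'a, 'm) module_scheme \<Rightarrow> ('k, 'a, 'l) module_scheme
      \<Rightarrow> 'a \<Rightarrow> ('a \<Rightarrow> 'a) \<Rightarrow> ('a \<Rightarrow> 'a) \<Rightarrow> bool"
  where "skew_polynomial_ext K R T x \<sigma> \<delta> \<longleftrightarrow>
    assoc_algebra K R \<and> assoc_algebra K T \<and> (\<lambda>r. r) \<in> alg_hom K R T \<and>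
    \<sigma> \<in> alg_auto K R \<and> skew_derivation K R \<sigma> \<delta> \<and>
    x \<in> carrier T \<and>
    (\<forall>r\<in>carrier R. x \<otimes>\<^bsub>T\<^esub> r = \<sigma> r \<otimes>\<^bsub>T\<^esub> x \<oplus>\<^bsub>T\<^esub> \<delta> r) \<and>
    (\<forall>t\<in>carrier T. \<exists>!c :: nat \<Rightarrow> 'a.
      (\<forall>i. c i \<in> carrier R) \<and> finite {i. c i \<noteq> \<zero>\<^bsub>R\<^esub>} \<and>
      t = finsum T (\<lambda>i. c i \<otimes>\<^bsub>T\<^esub> x [^]\<^bsub>T\<^esub> i) {i. c i \<noteq> \<zero>\<^bsub>R\<^esub>})"

definition hopf_ore_extension ::
    "('k, 'n) ring_scheme \<Rightarrow> ('k, 'a, 'm) hopf_scheme \<Rightarrow> ('k, 'a, 'l) hopf_scheme \<Rightarrow> bool"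
  where "hopf_ore_extension K R T \<longleftrightarrow>
    hopf_subalgebra K R T \<and>
    (\<exists>x \<sigma> \<delta>. skew_polynomial_ext K R T x \<sigma> \<delta> \<and>
      (\<exists>a\<in>carrier R. \<exists>b\<in>carrier R.
       \<exists>v\<in>carrier (tensor_algebra K R R). \<exists>w\<in>carrier (tensor_algebra K R R).
        comult T x =
          tensor K T T a x \<oplus>\<^bsub>tensor_algebra K T T\<^esub>
          tensor K T T x b \<oplus>\<^bsub>tensor_algebra K T T\<^esub>
          tensor_incl K T v \<otimes>\<^bsub>tensor_algebra K T T\<^esub> tensor K T T x x \<oplus>\<^bsub>tensor_algebra K T T\<^esub>
          tensor_incl K T w))"

end

(*
Let pi_j : T -> R be the coefficient maps of T = R[x; sigma, delta] and eps the counit. The ring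
T (x) T is an Ore extension of T (x) R in 1 (x) x and of R (x) T in x (x) 1, and T (x) R is a domain.
By the antipode, 1 (x) x = sum S(x_1) x_2 (x) x_3 lies in the sum of the (T (x) R) Delta(x)^j, whose
degrees in 1 (x) x are multiples of that of Delta(x); so Delta(x) = P + Q (1 (x) x) with P, Q in T (x) R.
Applying id (x) id (x) eps pi_1 to coassociativity shows that y = (id (x) eps pi_1) Delta(x) satisfies
Delta(y) = Q (1 (x) y) and eps(y) = 1; multiplying with the antipode, y is left invertible, hence a unit
of R, and replacing x by y^-1 x gives Q = 1. If m is the degree of P in x (x) 1, then applying eps pi_m
in the middle factor shows that the leading coefficient of P is 1 (x) q with q in R, and applying
eps pi_(m^2) in the first factor shows that (eps pi_(m^2) (x) id) Delta(x) is mapped by Delta to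
q^m (x) q, which is not zero. Hence m = 1 and q is grouplike, and q^-1 x is the required variable.
*)
theory Submission
  imports Defs
begin

text \<open>T \<otimes> T itself is never shown to be a domain: nonvanishing of products is needed
  only in T \<otimes> R, R \<otimes> R and R. The second is a domain by hypothesis, R sits inside
  it, and T \<otimes> R inherits the property because it is an Ore extension of R \<otimes> R with
  an injective twist. The two tensor factors have to be treated in the given order: the argument for
  x \<otimes> 1 needs \<Delta>(x) to be monic of degree 1 in 1 \<otimes> x, since only then does (id
  \<otimes> eps pi_m) \<Delta> kill x^j for j < m and send x^m to 1. The last contradiction for m >
  1 is a comparison of degrees: the functional at m^2 is nonzero on \<Delta>(x)^j only if j >= m, so
  it kills \<Delta>(x) itself, although the image of x was seen to be nonzero. Coassociativity
  enters only through its contractions with a functional or with the antipode, so no calculus in the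
  threefold tensor product is developed. R \<otimes> R is found inside T \<otimes> T by means of the
  retraction \<open>\<pi> 0\<close> of T onto R, which replaces any appeal to flatness.\<close>

section \<open>Tensor products\<close>

text \<open>The target is a multiplicative group because \<open>tensor_lift\<close> takes one; maps
  into a module use its \<open>add_monoid\<close>. The group axioms of the target are part of the
  notion, so that this predicate alone licenses the evaluation of a lift.\<close>

definition balanced ::
    "('k, 'n) ring_scheme \<Rightarrow> ('k, 'a, 'm) module_scheme \<Rightarrow> ('k, 'b, 'l) module_scheme
      \<Rightarrow> ('c, 'o) monoid_scheme \<Rightarrow> ('a \<Rightarrow> 'b \<Rightarrow> 'c) \<Rightarrow> bool"
  where "balanced K A B G f \<longleftrightarrow> comm_group G \<and>
    (\<forall>a\<in>carrier A. \<forall>b\<in>carrier B. f a b \<in> carrier G) \<and>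
    (\<forall>a\<in>carrier A. \<forall>a'\<in>carrier A. \<forall>b\<in>carrier B. f (a \<oplus>\<^bsub>A\<^esub> a') b = f a b \<otimes>\<^bsub>G\<^esub> f a' b) \<and>
    (\<forall>a\<in>carrier A. \<forall>b\<in>carrier B. \<forall>b'\<in>carrier B. f a (b \<oplus>\<^bsub>B\<^esub> b') = f a b \<otimes>\<^bsub>G\<^esub> f a b') \<and>
    (\<forall>c\<in>carrier K. \<forall>a\<in>carrier A. \<forall>b\<in>carrier B. f (c \<odot>\<^bsub>A\<^esub> a) b = f a (c \<odot>\<^bsub>B\<^esub> b))"

lemma balancedI:
  assumes "comm_group G"
    and "\<And>a b. a \<in> carrier A \<Longrightarrow> b \<in> carrier B \<Longrightarrow> f a b \<in> carrier G"
    and "\<And>a a' b. a \<in> carrier A \<Longrightarrow> a' \<in> carrier A \<Longrightarrow> b \<in> carrier B \<Longrightarrow>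
        f (a \<oplus>\<^bsub>A\<^esub> a') b = f a b \<otimes>\<^bsub>G\<^esub> f a' b"
    and "\<And>a b b'. a \<in> carrier A \<Longrightarrow> b \<in> carrier B \<Longrightarrow> b' \<in> carrier B \<Longrightarrow>
        f a (b \<oplus>\<^bsub>B\<^esub> b') = f a b \<otimes>\<^bsub>G\<^esub> f a b'"
    and "\<And>c a b. c \<in> carrier K \<Longrightarrow> a \<in> carrier A \<Longrightarrow> b \<in> carrier B \<Longrightarrow>
        f (c \<odot>\<^bsub>A\<^esub> a) b = f a (c \<odot>\<^bsub>B\<^esub> b)"
  shows "balanced K A B G f"
  using assms unfolding balanced_def by blast

lemma finprod_hom_sum:
  assumes "comm_group G" "h \<in> hom (free_Abelian_group pairs) G" "finite I"
    and "\<And>i. i \<in> I \<Longrightarrow> Poly_Mapping.keys (g i) \<subseteq> pairs"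
  shows "h (sum g I) = finprod G (\<lambda>i. h (g i)) I"
  using assms(3,4)
proof (induction I rule: finite_induct)
  case empty
  interpret G: comm_group G by fact
  interpret h: group_hom "free_Abelian_group pairs" G h
    by (intro group_hom.intro group_hom_axioms.intro assms(2) group_free_Abelian_group) unfold_locales
  show ?case using h.hom_one by simp
next
  case (insert i I)
  interpret G: comm_group G by fact
  have c: "(\<Sum>j\<in>I. g j) \<in> carrier (free_Abelian_group pairs)"
    by (rule sum_closed_free_Abelian_group) (use insert in auto)
  have ci: "g j \<in> carrier (free_Abelian_group pairs)" if "j \<in> insert i I" for j
    using insert that by auto
  have "h (g i + (\<Sum>j\<in>I. g j)) = h (g i) \<otimes>\<^bsub>G\<^esub> h (\<Sum>j\<in>I. g j)"
    using hom_mult[OF assms(2) ci[of i] c] by simp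
  moreover have "(\<lambda>j. h (g j)) \<in> insert i I \<rightarrow> carrier G"
    using ci assms(2) unfolding hom_def by blast
  ultimately show ?case
    using insert by (subst G.finprod_insert) auto
qed

section \<open>The tensor product of two modules and its universal property\<close>

locale tensor_product = A: module K A + B: module K B
  for K :: "('k, 'n) ring_scheme" and A :: "('k, 'a, 'm) module_scheme"
    and B :: "('k, 'b, 'l) module_scheme"
begin

abbreviation "pairs \<equiv> carrier A \<times> carrier B"
abbreviation "F \<equiv> free_Abelian_group pairs"
abbreviation "N \<equiv> tensor_null K A B"
abbreviation "E \<equiv> tensor_algebra K A B"
abbreviation "G \<equiv> tensor_group K A B"
abbreviation tensor' (infixl \<open>\<otimes>\<^sub>t\<close> 75) where "a \<otimes>\<^sub>t b \<equiv> tensor K A B a b"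

abbreviation plus_E (infixl \<open>\<oplus>\<^sub>E\<close> 65) where "u \<oplus>\<^sub>E v \<equiv> u \<oplus>\<^bsub>E\<^esub> v"
abbreviation times_E (infixl \<open>\<otimes>\<^sub>E\<close> 70) where "u \<otimes>\<^sub>E v \<equiv> u \<otimes>\<^bsub>E\<^esub> v"

sublocale F: comm_group F by (rule abelian_free_Abelian_group)

lemma frag_closed: "a \<in> carrier A \<Longrightarrow> b \<in> carrier B \<Longrightarrow> frag_of (a, b) \<in> carrier F"
  by (simp only: frag_of_in_free_Abelian_group) simp

lemma frag_add_closed:
  "u \<in> carrier F \<Longrightarrow> v \<in> carrier F \<Longrightarrow> u + v \<in> carrier F"
  using F.m_closed by simp

lemma frag_diff_closed:
  "u \<in> carrier F \<Longrightarrow> v \<in> carrier F \<Longrightarrow> u - v \<in> carrier F"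
  using keys_diff[of u v] by auto

lemma relations_closed: "tensor_relations K A B \<subseteq> carrier F"
proof
  fix u assume "u \<in> tensor_relations K A B"
  then show "u \<in> carrier F"
    unfolding tensor_relations_def
    by (elim UnE CollectE exE conjE; hypsubst)
      (intro frag_diff_closed frag_closed A.M.a_closed B.M.a_closed A.smult_closed B.smult_closed;
        assumption)+
qed

lemma null_subgroup: "subgroup N F"
  unfolding tensor_null_def by (rule F.generate_is_subgroup[OF relations_closed])

sublocale N: normal N F
  by (rule F.subgroup_imp_normal[OF null_subgroup])

lemma group_G: "comm_group G"
  unfolding tensor_group_def by (rule F.abelian_FactGroup[OF null_subgroup])

sublocale G: comm_group G by (rule group_G)

lemma carrier_E: "carrier E = carrier G"
  and zero_E: "\<zero>\<^bsub>E\<^esub> = \<one>\<^bsub>G\<^esub>"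
  and add_E: "x \<oplus>\<^sub>E y = x \<otimes>\<^bsub>G\<^esub> y"
  by (simp_all add: tensor_algebra_def)

lemma abelian_group_E: "abelian_group E"
proof (rule abelian_groupI)
  fix x assume "x \<in> carrier E"
  then show "\<exists>y\<in>carrier E. y \<oplus>\<^sub>E x = \<zero>\<^bsub>E\<^esub>"
    using G.l_inv by (intro bexI[of _ "inv\<^bsub>G\<^esub> x"]) (auto simp: carrier_E zero_E add_E)
qed (auto simp: carrier_E zero_E add_E G.m_ac)

sublocale E: abelian_group E by (rule abelian_group_E)

definition cls where "cls u = N #>\<^bsub>F\<^esub> u"

lemma cls_hom: "cls \<in> hom F G"
  unfolding tensor_group_def cls_def using N.r_coset_hom_Mod by simp

lemma carrier_G_cls: "s \<in> carrier G \<longleftrightarrow> (\<exists>u\<in>carrier F. s = cls u)"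
  unfolding tensor_group_def cls_def by (auto simp: carrier_FactGroup simp del: carrier_free_Abelian_group_iff)

lemma tensor_cls: "a \<otimes>\<^sub>t b = cls (frag_of (a, b))"
  by (simp add: tensor_def cls_def)

lemma cls_null: "cls u = \<one>\<^bsub>G\<^esub>" if "u \<in> N"
  unfolding cls_def tensor_group_def
  using F.coset_join2[OF _ null_subgroup that] N.mem_carrier[OF that] by simp

lemma cls_add:
  "u \<in> carrier F \<Longrightarrow> v \<in> carrier F \<Longrightarrow> cls (u + v) = cls u \<otimes>\<^bsub>G\<^esub> cls v"
  using hom_mult[OF cls_hom, of u v] by (simp del: carrier_free_Abelian_group_iff)

lemma cls_closed: "u \<in> carrier F \<Longrightarrow> cls u \<in> carrier G"
  using cls_hom unfolding hom_def by blast

lemma cls_eqI: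
  assumes "u \<in> carrier F" "v \<in> carrier F" "u - v \<in> N"
  shows "cls u = cls v"
proof -
  have "cls u = cls ((u - v) + v)" by simp
  also have "\<dots> = cls (u - v) \<otimes>\<^bsub>G\<^esub> cls v"
    by (rule cls_add) (use assms N.mem_carrier in blast)+
  also have "\<dots> = cls v" using cls_null[OF assms(3)] cls_closed[OF assms(2)] by simp
  finally show ?thesis .
qed

lemma relation_null: "u \<in> tensor_relations K A B \<Longrightarrow> u \<in> N"
  unfolding tensor_null_def by (rule generate.incl)

lemma tensor_closed: "a \<in> carrier A \<Longrightarrow> b \<in> carrier B \<Longrightarrow> a \<otimes>\<^sub>t b \<in> carrier E"
  unfolding tensor_cls carrier_E by (intro cls_closed frag_closed)

lemma tensor_add_left:
  assumes "a \<in> carrier A" "a' \<in> carrier A" "b \<in> carrier B"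
  shows "(a \<oplus>\<^bsub>A\<^esub> a') \<otimes>\<^sub>t b = a \<otimes>\<^sub>t b \<oplus>\<^sub>E a' \<otimes>\<^sub>t b"
proof -
  have "frag_of (a \<oplus>\<^bsub>A\<^esub> a', b) - (frag_of (a, b) + frag_of (a', b)) \<in> N"
    by (rule relation_null) (use assms in \<open>auto simp: tensor_relations_def diff_diff_add\<close>)
  then have "cls (frag_of (a \<oplus>\<^bsub>A\<^esub> a', b)) = cls (frag_of (a, b) + frag_of (a', b))"
    by (intro cls_eqI frag_closed frag_add_closed) (use assms in auto)
  then show ?thesis unfolding tensor_cls add_E by (subst cls_add[symmetric]) (use assms frag_closed in auto)
qed

lemma tensor_add_right:
  assumes "a \<in> carrier A" "b \<in> carrier B" "b' \<in> carrier B"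
  shows "a \<otimes>\<^sub>t (b \<oplus>\<^bsub>B\<^esub> b') = a \<otimes>\<^sub>t b \<oplus>\<^sub>E a \<otimes>\<^sub>t b'"
proof -
  have "frag_of (a, b \<oplus>\<^bsub>B\<^esub> b') - (frag_of (a, b) + frag_of (a, b')) \<in> N"
    by (rule relation_null) (use assms in \<open>auto simp: tensor_relations_def diff_diff_add\<close>)
  then have "cls (frag_of (a, b \<oplus>\<^bsub>B\<^esub> b')) = cls (frag_of (a, b) + frag_of (a, b'))"
    by (intro cls_eqI frag_closed frag_add_closed) (use assms in auto)
  then show ?thesis unfolding tensor_cls add_E by (subst cls_add[symmetric]) (use assms frag_closed in auto)
qed

lemma tensor_smult:
  assumes "c \<in> carrier K" "a \<in> carrier A" "b \<in> carrier B"
  shows "(c \<odot>\<^bsub>A\<^esub> a) \<otimes>\<^sub>t b = a \<otimes>\<^sub>t (c \<odot>\<^bsub>B\<^esub> b)"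
proof -
  have "frag_of (c \<odot>\<^bsub>A\<^esub> a, b) - frag_of (a, c \<odot>\<^bsub>B\<^esub> b) \<in> N"
    by (rule relation_null) (use assms in \<open>auto simp: tensor_relations_def\<close>)
  then show ?thesis unfolding tensor_cls
    by (intro cls_eqI frag_closed) (use assms in auto)
qed

lemma tensor_zero_left: "b \<in> carrier B \<Longrightarrow> \<zero>\<^bsub>A\<^esub> \<otimes>\<^sub>t b = \<zero>\<^bsub>E\<^esub>"
  using tensor_add_left[of "\<zero>\<^bsub>A\<^esub>" "\<zero>\<^bsub>A\<^esub>" b] tensor_closed[of "\<zero>\<^bsub>A\<^esub>" b]
    E.add.l_cancel_one[of "\<zero>\<^bsub>A\<^esub> \<otimes>\<^sub>t b" "\<zero>\<^bsub>A\<^esub> \<otimes>\<^sub>t b"] by simp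

lemma tensor_zero_right: "a \<in> carrier A \<Longrightarrow> a \<otimes>\<^sub>t \<zero>\<^bsub>B\<^esub> = \<zero>\<^bsub>E\<^esub>"
  using tensor_add_right[of a "\<zero>\<^bsub>B\<^esub>" "\<zero>\<^bsub>B\<^esub>"] tensor_closed[of a "\<zero>\<^bsub>B\<^esub>"]
    E.add.l_cancel_one[of "a \<otimes>\<^sub>t \<zero>\<^bsub>B\<^esub>" "a \<otimes>\<^sub>t \<zero>\<^bsub>B\<^esub>"] by simp

lemma tensor_minus_left:
  assumes "a \<in> carrier A" "b \<in> carrier B"
  shows "(\<ominus>\<^bsub>A\<^esub> a) \<otimes>\<^sub>t b = \<ominus>\<^bsub>E\<^esub> (a \<otimes>\<^sub>t b)"
proof -
  have "(\<ominus>\<^bsub>A\<^esub> a) \<otimes>\<^sub>t b \<oplus>\<^sub>E a \<otimes>\<^sub>t b = \<zero>\<^bsub>E\<^esub>"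
    using assms by (simp add: tensor_add_left[symmetric] A.M.l_neg tensor_zero_left)
  then show ?thesis
    using assms tensor_closed by (metis A.M.a_inv_closed E.minus_equality)
qed

text \<open>Negatives are absorbed by \<open>- (a \<otimes> b) = (- a) \<otimes> b\<close>, so sums of pure tensors suffice.\<close>

lemma tensor_induct [consumes 1, case_names pure add]:
  assumes s: "s \<in> carrier E"
    and pure: "\<And>a b. a \<in> carrier A \<Longrightarrow> b \<in> carrier B \<Longrightarrow> P (a \<otimes>\<^sub>t b)"
    and add: "\<And>s t. s \<in> carrier E \<Longrightarrow> t \<in> carrier E \<Longrightarrow> P s \<Longrightarrow> P t \<Longrightarrow> P (s \<oplus>\<^sub>E t)"
  shows "P s"
proof -
  obtain u where u: "u \<in> carrier F" "s = cls u" using s carrier_G_cls carrier_E by auto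
  have one: "cls 0 = \<zero>\<^bsub>E\<^esub>"
    using hom_one[OF cls_hom] zero_E by (simp add: F.is_group)
  have mz: "\<ominus>\<^bsub>E\<^esub> \<zero>\<^bsub>E\<^esub> = \<zero>\<^bsub>E\<^esub>"
    by (rule E.minus_equality) (rule E.zero_closed E.l_zero[OF E.zero_closed])+
  \<comment> \<open>The induction rule of the free abelian group passes through differences, so the
    claim is carried along together with the claim for the negative.\<close>
  have "P (cls u) \<and> P (\<ominus>\<^bsub>E\<^esub> cls u)"
  proof (rule free_Abelian_group_induct[where S=pairs and x=u])
    show "Poly_Mapping.keys u \<subseteq> pairs" using u by simp
    have "P \<zero>\<^bsub>E\<^esub>" using pure[of "\<zero>\<^bsub>A\<^esub>" "\<zero>\<^bsub>B\<^esub>"] by (simp add: tensor_zero_left)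
    then show "P (cls 0) \<and> P (\<ominus>\<^bsub>E\<^esub> cls 0)"
      unfolding one mz by simp
  next
    fix p assume "p \<in> pairs"
    then obtain a b where p: "p = (a, b)" "a \<in> carrier A" "b \<in> carrier B" by auto
    then show "P (cls (frag_of p)) \<and> P (\<ominus>\<^bsub>E\<^esub> cls (frag_of p))"
      using pure[of a b] pure[of "\<ominus>\<^bsub>A\<^esub> a" b] by (simp add: tensor_cls[symmetric] tensor_minus_left)
  next
    fix v w assume vw: "Poly_Mapping.keys v \<subseteq> pairs" "Poly_Mapping.keys w \<subseteq> pairs"
      "P (cls v) \<and> P (\<ominus>\<^bsub>E\<^esub> cls v)" "P (cls w) \<and> P (\<ominus>\<^bsub>E\<^esub> cls w)"
    have c: "cls v \<in> carrier E" "cls w \<in> carrier E" using vw cls_closed by (auto simp: carrier_E)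
    have d: "v - w \<in> carrier F" using vw keys_diff[of v w] by auto
    have "cls v = cls (v - w) \<oplus>\<^sub>E cls w"
      using cls_add[OF d, of w] vw by (simp add: add_E)
    then have e: "cls (v - w) = cls v \<oplus>\<^sub>E (\<ominus>\<^bsub>E\<^esub> cls w)"
      using c cls_closed[OF d] by (simp add: carrier_E[symmetric] E.a_assoc E.r_neg)
    have "\<ominus>\<^bsub>E\<^esub> cls (v - w) = \<ominus>\<^bsub>E\<^esub> cls v \<oplus>\<^sub>E cls w"
      using c unfolding e by (simp add: E.minus_add)
    then show "P (cls (v - w)) \<and> P (\<ominus>\<^bsub>E\<^esub> cls (v - w))"
      using e vw c by (metis E.a_inv_closed add)
  qed
  then show ?thesis using u by simp
qed

text \<open>The product in \<open>tensor_lift\<close> is the value at the representative of the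
  homomorphism h that extends f to the free abelian group. As h sends all tensor relations to the
  unit, every representative of the coset gives the same value and the description operator is
  justified.\<close>

lemma lift_eq:
  assumes "balanced K A B H f"
  shows "\<exists>h \<in> hom F H. (\<forall>a\<in>carrier A. \<forall>b\<in>carrier B. h (frag_of (a, b)) = f a b) \<and>
    (\<forall>u \<in> carrier F. tensor_lift H f (cls u) = h u)"
proof -
  interpret H: comm_group H using assms unfolding balanced_def by blast
  have img: "(\<lambda>p. f (fst p) (snd p)) ` pairs \<subseteq> carrier H"
    using assms unfolding balanced_def by auto
  obtain h where h: "h \<in> hom F H" "\<And>p. p \<in> pairs \<Longrightarrow> h (frag_of p) = f (fst p) (snd p)"
    using H.free_Abelian_group_universal[OF img] by blast
  interpret h: group_hom F H h
    using h(1) by (intro group_hom.intro group_hom_axioms.intro) unfold_locales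
  have fr: "h (frag_of (a, b)) = f a b" if "a \<in> carrier A" "b \<in> carrier B" for a b
    using h(2)[of "(a, b)"] that by simp
  have prod: "finprod H (\<lambda>p. f (fst p) (snd p) [^]\<^bsub>H\<^esub> Poly_Mapping.lookup u p) (Poly_Mapping.keys u) = h u"
    if u: "u \<in> carrier F" for u
  proof -
    have k: "Poly_Mapping.keys u \<subseteq> pairs" using u by simp
    have cl: "f (fst p) (snd p) \<in> carrier H" if "p \<in> pairs" for p
      using h(2)[OF that] h.hom_closed[of "frag_of p"] that by simp
    have "h u = h (\<Sum>p\<in>Poly_Mapping.keys u. frag_cmul (Poly_Mapping.lookup u p) (frag_of p))"
      using frag_expansion[of u] by (simp add: frag_extend_def)
    also have "\<dots> = finprod H (\<lambda>p. h (frag_cmul (Poly_Mapping.lookup u p) (frag_of p))) (Poly_Mapping.keys u)"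
      by (rule finprod_hom_sum[OF H.comm_group_axioms h(1)])
        (use k in \<open>auto dest!: subsetD[OF keys_cmul]\<close>)
    also have "\<dots> = finprod H (\<lambda>p. f (fst p) (snd p) [^]\<^bsub>H\<^esub> Poly_Mapping.lookup u p) (Poly_Mapping.keys u)"
    proof (rule H.finprod_cong')
      fix p assume "p \<in> Poly_Mapping.keys u"
      then have p: "p \<in> pairs" using k by blast
      then have "h (frag_of p [^]\<^bsub>F\<^esub> Poly_Mapping.lookup u p) = h (frag_of p) [^]\<^bsub>H\<^esub> Poly_Mapping.lookup u p"
        by (intro h.hom_int_pow) simp
      then show "h (frag_cmul (Poly_Mapping.lookup u p) (frag_of p)) = f (fst p) (snd p) [^]\<^bsub>H\<^esub> Poly_Mapping.lookup u p"
        using p h(2)[OF p] by simp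
    qed (use k cl in auto)
    finally show ?thesis by simp
  qed
  have minus: "h (u - v) = h u \<otimes>\<^bsub>H\<^esub> inv\<^bsub>H\<^esub> h v" if "u \<in> carrier F" "v \<in> carrier F" for u v
  proof -
    have "h (u \<otimes>\<^bsub>F\<^esub> inv\<^bsub>F\<^esub> v) = h u \<otimes>\<^bsub>H\<^esub> inv\<^bsub>H\<^esub> h v"
      using that by (simp del: carrier_free_Abelian_group_iff mult_free_Abelian_group inv_free_Abelian_group)
    then show ?thesis using that by simp
  qed
  have rel: "h u = \<one>\<^bsub>H\<^esub>" if "u \<in> tensor_relations K A B" for u
  proof -
    have c: "f a b \<in> carrier H" if "a \<in> carrier A" "b \<in> carrier B" for a b
      using assms that unfolding balanced_def by blast
    have add1: "h (u - v - w) = \<one>\<^bsub>H\<^esub>"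
      if "u \<in> carrier F" "v \<in> carrier F" "w \<in> carrier F" "h u = h v \<otimes>\<^bsub>H\<^esub> h w" for u v w
    proof -
      have "h (u - (v + w)) = h u \<otimes>\<^bsub>H\<^esub> inv\<^bsub>H\<^esub> (h (v \<otimes>\<^bsub>F\<^esub> w))"
        using minus[of u "v + w"] that frag_add_closed by simp
      then show ?thesis using that h.hom_closed
        by (simp add: diff_diff_add h.hom_mult del: mult_free_Abelian_group carrier_free_Abelian_group_iff)
    qed
    from that show ?thesis unfolding tensor_relations_def
    proof (elim UnE CollectE exE conjE)
      fix a a' b
      assume "u = frag_of (a \<oplus>\<^bsub>A\<^esub> a', b) - frag_of (a, b) - frag_of (a', b)"
        "a \<in> carrier A" "a' \<in> carrier A" "b \<in> carrier B"
      moreover from this have "f (a \<oplus>\<^bsub>A\<^esub> a') b = f a b \<otimes>\<^bsub>H\<^esub> f a' b"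
        using assms unfolding balanced_def by blast
      ultimately show ?thesis
        by (simp only:) (intro add1 frag_closed A.M.a_closed; simp add: fr)
    next
      fix a b b'
      assume "u = frag_of (a, b \<oplus>\<^bsub>B\<^esub> b') - frag_of (a, b) - frag_of (a, b')"
        "a \<in> carrier A" "b \<in> carrier B" "b' \<in> carrier B"
      moreover from this have "f a (b \<oplus>\<^bsub>B\<^esub> b') = f a b \<otimes>\<^bsub>H\<^esub> f a b'"
        using assms unfolding balanced_def by blast
      ultimately show ?thesis
        by (simp only:) (intro add1 frag_closed B.M.a_closed; simp add: fr)
    next
      fix a b c'
      assume u: "u = frag_of (c' \<odot>\<^bsub>A\<^esub> a, b) - frag_of (a, c' \<odot>\<^bsub>B\<^esub> b)"
        "a \<in> carrier A" "b \<in> carrier B" "c' \<in> carrier K"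
      then have "h u = f (c' \<odot>\<^bsub>A\<^esub> a) b \<otimes>\<^bsub>H\<^esub> inv\<^bsub>H\<^esub> f a (c' \<odot>\<^bsub>B\<^esub> b)"
        using minus frag_closed fr by simp
      also have "f (c' \<odot>\<^bsub>A\<^esub> a) b = f a (c' \<odot>\<^bsub>B\<^esub> b)"
        using assms u unfolding balanced_def by blast
      finally show ?thesis using u c by simp
    qed
  qed
  have null: "h u = \<one>\<^bsub>H\<^esub>" if "u \<in> N" for u
    using that unfolding tensor_null_def
  proof (induction rule: generate.induct)
    case (inv u)
    then have "u \<in> carrier F" using relations_closed by blast
    then show ?case using rel[OF inv] by (simp only: h.hom_inv H.inv_one)
  next
    case (eng u v)
    then have "u \<in> carrier F" "v \<in> carrier F"
      using F.generate_in_carrier[OF relations_closed] by blast+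
    then show ?case using eng by (simp add: h.hom_mult del: mult_free_Abelian_group carrier_free_Abelian_group_iff)
  qed (use rel h.hom_one in auto)
  have "tensor_lift H f (cls u) = h u" if u: "u \<in> carrier F" for u
  proof -
    have mem: "v \<in> cls u \<Longrightarrow> v \<in> carrier F \<and> h v = h u" for v
    proof -
      assume "v \<in> cls u"
      then obtain n where n: "n \<in> N" "v = n \<otimes>\<^bsub>F\<^esub> u" unfolding cls_def r_coset_def by auto
      then show ?thesis using null[OF n(1)] N.mem_carrier[OF n(1)] u
        by (simp add: h.hom_mult del: mult_free_Abelian_group carrier_free_Abelian_group_iff)
    qed
    have "u \<in> cls u" unfolding cls_def using F.rcos_self[OF u null_subgroup] .
    then show ?thesis
      unfolding tensor_lift_def
    proof (intro the_equality)
      fix z assume "\<exists>v\<in>cls u. z = finprod H (\<lambda>p. f (fst p) (snd p) [^]\<^bsub>H\<^esub> Poly_Mapping.lookup v p) (Poly_Mapping.keys v)"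
      then obtain v where "v \<in> cls u"
        "z = finprod H (\<lambda>p. f (fst p) (snd p) [^]\<^bsub>H\<^esub> Poly_Mapping.lookup v p) (Poly_Mapping.keys v)"
        by blast
      then show "z = h u" using mem[of v] prod[of v] by simp
    qed (use prod[OF u] in \<open>auto intro!: bexI[of _ u]\<close>)
  qed
  then show ?thesis using h(1) fr by blast
qed

lemma lift_tensor:
  assumes "balanced K A B H f" "a \<in> carrier A" "b \<in> carrier B"
  shows "tensor_lift H f (a \<otimes>\<^sub>t b) = f a b"
proof -
  obtain h where "h (frag_of (a, b)) = f a b" "\<forall>u \<in> carrier F. tensor_lift H f (cls u) = h u"
    using lift_eq[OF assms(1)] assms(2,3) by blast
  then show ?thesis using frag_closed[OF assms(2,3)] unfolding tensor_cls by simp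
qed

lemma lift_closed:
  assumes "balanced K A B H f" "s \<in> carrier E"
  shows "tensor_lift H f s \<in> carrier H"
  using lift_eq[OF assms(1)] assms(2) unfolding carrier_E carrier_G_cls hom_def by fastforce

lemma lift_add:
  assumes "balanced K A B H f" "s \<in> carrier E" "t \<in> carrier E"
  shows "tensor_lift H f (s \<oplus>\<^sub>E t) = tensor_lift H f s \<otimes>\<^bsub>H\<^esub> tensor_lift H f t"
proof -
  obtain u v where uv: "u \<in> carrier F" "s = cls u" "v \<in> carrier F" "t = cls v"
    using assms carrier_G_cls carrier_E by auto
  obtain h where h: "h \<in> hom F H" "\<forall>u \<in> carrier F. tensor_lift H f (cls u) = h u"
    using lift_eq[OF assms(1)] by blast
  have "s \<oplus>\<^sub>E t = cls (u + v)" using uv cls_add by (simp add: add_E)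
  then show ?thesis using uv h hom_mult[OF h(1) uv(1,3)] frag_add_closed by simp
qed

end

text \<open>A lift depends on its target only through carrier, multiplication and unit. Hence the
  \<open>tensor_group\<close> that occurs in the definitions can be traded for the
  \<open>add_monoid\<close> of the tensor algebra, which suits maps between rings.\<close>

lemma tensor_lift_cong:
  assumes "carrier G = carrier H" "monoid.mult G = monoid.mult H" "one G = one H"
  shows "tensor_lift G = tensor_lift H"
  unfolding tensor_lift_def finprod_def int_pow_def nat_pow_def m_inv_def assms ..

lemma tensor_lift_group:
  "tensor_lift (tensor_group K A B) = tensor_lift (add_monoid (tensor_algebra K A B))"
  by (rule tensor_lift_cong) (simp_all add: tensor_algebra_def)

lemma balanced_addI:
  assumes "abelian_group H"
    and "\<And>a b. a \<in> carrier A \<Longrightarrow> b \<in> carrier B \<Longrightarrow> f a b \<in> carrier H"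
    and "\<And>a a' b. a \<in> carrier A \<Longrightarrow> a' \<in> carrier A \<Longrightarrow> b \<in> carrier B \<Longrightarrow>
        f (a \<oplus>\<^bsub>A\<^esub> a') b = f a b \<oplus>\<^bsub>H\<^esub> f a' b"
    and "\<And>a b b'. a \<in> carrier A \<Longrightarrow> b \<in> carrier B \<Longrightarrow> b' \<in> carrier B \<Longrightarrow>
        f a (b \<oplus>\<^bsub>B\<^esub> b') = f a b \<oplus>\<^bsub>H\<^esub> f a b'"
    and "\<And>c a b. c \<in> carrier K \<Longrightarrow> a \<in> carrier A \<Longrightarrow> b \<in> carrier B \<Longrightarrow>
        f (c \<odot>\<^bsub>A\<^esub> a) b = f a (c \<odot>\<^bsub>B\<^esub> b)"
  shows "balanced K A B (add_monoid H) f"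
  by (rule balancedI) (use assms abelian_group.a_comm_group in auto)

section \<open>Additive and linear maps\<close>

definition additive :: "('a, 'm) ring_scheme \<Rightarrow> ('b, 'n) ring_scheme \<Rightarrow> ('a \<Rightarrow> 'b) \<Rightarrow> bool"
  where "additive A B f \<longleftrightarrow> f \<in> carrier A \<rightarrow> carrier B \<and>
    (\<forall>x\<in>carrier A. \<forall>y\<in>carrier A. f (x \<oplus>\<^bsub>A\<^esub> y) = f x \<oplus>\<^bsub>B\<^esub> f y)"

lemma additiveI:
  assumes "\<And>x. x \<in> carrier A \<Longrightarrow> f x \<in> carrier B"
    and "\<And>x y. x \<in> carrier A \<Longrightarrow> y \<in> carrier A \<Longrightarrow> f (x \<oplus>\<^bsub>A\<^esub> y) = f x \<oplus>\<^bsub>B\<^esub> f y"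
  shows "additive A B f"
  using assms unfolding additive_def by blast

lemma additive_closed: "additive A B f \<Longrightarrow> x \<in> carrier A \<Longrightarrow> f x \<in> carrier B"
  and additive_add: "additive A B f \<Longrightarrow> x \<in> carrier A \<Longrightarrow> y \<in> carrier A \<Longrightarrow>
    f (x \<oplus>\<^bsub>A\<^esub> y) = f x \<oplus>\<^bsub>B\<^esub> f y"
  unfolding additive_def by blast+

lemma additive_zero:
  assumes "abelian_group A" "abelian_group B" "additive A B f"
  shows "f \<zero>\<^bsub>A\<^esub> = \<zero>\<^bsub>B\<^esub>"
proof -
  interpret A: abelian_group A by fact
  interpret B: abelian_group B by fact
  have "f \<zero>\<^bsub>A\<^esub> = f \<zero>\<^bsub>A\<^esub> \<oplus>\<^bsub>B\<^esub> f \<zero>\<^bsub>A\<^esub>"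
    using additive_add[OF assms(3), of "\<zero>\<^bsub>A\<^esub>" "\<zero>\<^bsub>A\<^esub>"] by simp
  then show ?thesis
    using B.add.l_cancel_one[of "f \<zero>\<^bsub>A\<^esub>" "f \<zero>\<^bsub>A\<^esub>"] additive_closed[OF assms(3)] by simp
qed

lemma linear_mapI:
  assumes "\<And>x. x \<in> carrier A \<Longrightarrow> f x \<in> carrier B"
    and "\<And>x y. x \<in> carrier A \<Longrightarrow> y \<in> carrier A \<Longrightarrow> f (x \<oplus>\<^bsub>A\<^esub> y) = f x \<oplus>\<^bsub>B\<^esub> f y"
    and "\<And>c x. c \<in> carrier K \<Longrightarrow> x \<in> carrier A \<Longrightarrow> f (c \<odot>\<^bsub>A\<^esub> x) = c \<odot>\<^bsub>B\<^esub> f x"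
  shows "f \<in> linear_map K A B"
  using assms unfolding linear_map_def by blast

lemma linear_additive: "f \<in> linear_map K A B \<Longrightarrow> additive A B f"
  unfolding linear_map_def additive_def by blast

lemma linear_closed: "f \<in> linear_map K A B \<Longrightarrow> x \<in> carrier A \<Longrightarrow> f x \<in> carrier B"
  and linear_add: "f \<in> linear_map K A B \<Longrightarrow> x \<in> carrier A \<Longrightarrow> y \<in> carrier A \<Longrightarrow>
    f (x \<oplus>\<^bsub>A\<^esub> y) = f x \<oplus>\<^bsub>B\<^esub> f y"
  and linear_smult: "f \<in> linear_map K A B \<Longrightarrow> c \<in> carrier K \<Longrightarrow> x \<in> carrier A \<Longrightarrow>
    f (c \<odot>\<^bsub>A\<^esub> x) = c \<odot>\<^bsub>B\<^esub> f x"
  unfolding linear_map_def by blast+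

lemma linear_id: "(\<lambda>y. y) \<in> linear_map K A A"
  unfolding linear_map_def by auto

lemma linear_comp:
  "f \<in> linear_map K A B \<Longrightarrow> g \<in> linear_map K B C \<Longrightarrow> (\<lambda>x. g (f x)) \<in> linear_map K A C"
  by (rule linear_mapI) (simp_all add: linear_closed linear_add linear_smult)

context tensor_product
begin

lemma lift_additive:
  "balanced K A B (add_monoid H) f \<Longrightarrow> additive E H (tensor_lift (add_monoid H) f)"
  unfolding additive_def
  using lift_closed[of "add_monoid H" f] lift_add[of "add_monoid H" f] by simp

text \<open>This is the uniqueness half of the universal property.\<close>

lemma additive_eqI:
  assumes "additive E H \<phi>" "additive E H \<psi>" "s \<in> carrier E"
    and "\<And>a b. a \<in> carrier A \<Longrightarrow> b \<in> carrier B \<Longrightarrow> \<phi> (a \<otimes>\<^sub>t b) = \<psi> (a \<otimes>\<^sub>t b)"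
  shows "\<phi> s = \<psi> s"
  using assms(3) by (induction s rule: tensor_induct)
    (simp_all add: assms(4) additive_add[OF assms(1)] additive_add[OF assms(2)])

lemma smult_eq: "c \<odot>\<^bsub>E\<^esub> s = tensor_lift (add_monoid E) (\<lambda>a b. (c \<odot>\<^bsub>A\<^esub> a) \<otimes>\<^sub>t b) s"
  unfolding tensor_lift_group[symmetric] by (simp add: tensor_algebra_def)

lemma balanced_smult:
  assumes "c \<in> carrier K"
  shows "balanced K A B (add_monoid E) (\<lambda>a b. (c \<odot>\<^bsub>A\<^esub> a) \<otimes>\<^sub>t b)"
proof (rule balanced_addI[OF abelian_group_E])
  fix d a b assume "d \<in> carrier K" "a \<in> carrier A" "b \<in> carrier B"
  then show "(c \<odot>\<^bsub>A\<^esub> (d \<odot>\<^bsub>A\<^esub> a)) \<otimes>\<^sub>t b = (c \<odot>\<^bsub>A\<^esub> a) \<otimes>\<^sub>t (d \<odot>\<^bsub>B\<^esub> b)"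
    using assms by (simp add: tensor_smult A.smult_assoc1[symmetric] B.smult_assoc1[symmetric] A.R.m_comm)
qed (use assms in \<open>simp_all add: tensor_closed tensor_add_left tensor_add_right A.smult_r_distr\<close>)

lemma smult_tensor:
  "c \<in> carrier K \<Longrightarrow> a \<in> carrier A \<Longrightarrow> b \<in> carrier B \<Longrightarrow> c \<odot>\<^bsub>E\<^esub> (a \<otimes>\<^sub>t b) = (c \<odot>\<^bsub>A\<^esub> a) \<otimes>\<^sub>t b"
  unfolding smult_eq by (rule lift_tensor[OF balanced_smult])

lemma smult_additive: "c \<in> carrier K \<Longrightarrow> additive E E (\<lambda>s. c \<odot>\<^bsub>E\<^esub> s)"
  using lift_additive[OF balanced_smult] unfolding smult_eq .

lemmas smult_closed' = additive_closed[OF smult_additive]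
lemmas smult_add = additive_add[OF smult_additive]

lemma module_E: "module K E"
proof (rule moduleI)
  show "cring K" by (rule A.R.is_cring)
  show "abelian_group E" by (rule abelian_group_E)
  show "\<And>c s. c \<in> carrier K \<Longrightarrow> s \<in> carrier E \<Longrightarrow> c \<odot>\<^bsub>E\<^esub> s \<in> carrier E"
    by (rule smult_closed')
  show "\<And>c s t. c \<in> carrier K \<Longrightarrow> s \<in> carrier E \<Longrightarrow> t \<in> carrier E \<Longrightarrow>
    c \<odot>\<^bsub>E\<^esub> (s \<oplus>\<^sub>E t) = c \<odot>\<^bsub>E\<^esub> s \<oplus>\<^sub>E c \<odot>\<^bsub>E\<^esub> t"
    by (rule smult_add)
next
  fix c d s assume cd: "c \<in> carrier K" "d \<in> carrier K" and s: "s \<in> carrier E"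
  show "(c \<oplus>\<^bsub>K\<^esub> d) \<odot>\<^bsub>E\<^esub> s = c \<odot>\<^bsub>E\<^esub> s \<oplus>\<^sub>E d \<odot>\<^bsub>E\<^esub> s"
    using s by (induction s rule: tensor_induct)
      (use cd in \<open>simp_all add: smult_tensor smult_add smult_closed' E.a_ac A.smult_l_distr tensor_add_left\<close>)
  show "(c \<otimes>\<^bsub>K\<^esub> d) \<odot>\<^bsub>E\<^esub> s = c \<odot>\<^bsub>E\<^esub> (d \<odot>\<^bsub>E\<^esub> s)"
    using s by (induction s rule: tensor_induct)
      (use cd in \<open>simp_all add: smult_tensor smult_add smult_closed' A.smult_assoc1\<close>)
next
  fix s assume s: "s \<in> carrier E"
  then show "\<one>\<^bsub>K\<^esub> \<odot>\<^bsub>E\<^esub> s = s"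
    by (induction s rule: tensor_induct) (simp_all add: smult_tensor smult_add)
qed

end

section \<open>The tensor product of two algebras\<close>

lemma (in assoc_algebra) module_A: "module K A" by (rule module_axioms)

locale tensor_alg = A: assoc_algebra K A + B: assoc_algebra K B
  for K :: "('k, 'n) ring_scheme" and A :: "('k, 'a, 'm) module_scheme"
    and B :: "('k, 'b, 'l) module_scheme"

sublocale tensor_alg \<subseteq> tensor_product K A B
  by (intro tensor_product.intro A.module_A B.module_A)

context tensor_alg
begin

text \<open>The product of the tensor algebra is a nested lift. This is the inner level, left
  multiplication by a pure tensor; its properties are needed before the outer level can be shown to
  be balanced.\<close>

definition mulr where "mulr a b t = tensor_lift (add_monoid E) (\<lambda>a' b'. (a \<otimes>\<^bsub>A\<^esub> a') \<otimes>\<^sub>t (b \<otimes>\<^bsub>B\<^esub> b')) t"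

lemma mult_eq: "s \<otimes>\<^sub>E t = tensor_lift (add_monoid E) (\<lambda>a b. mulr a b t) s"
  unfolding mulr_def tensor_lift_group[symmetric] by (simp add: tensor_algebra_def)

lemma balanced_mulr:
  assumes "a \<in> carrier A" "b \<in> carrier B"
  shows "balanced K A B (add_monoid E) (\<lambda>a' b'. (a \<otimes>\<^bsub>A\<^esub> a') \<otimes>\<^sub>t (b \<otimes>\<^bsub>B\<^esub> b'))"
proof (rule balanced_addI[OF abelian_group_E])
  fix d a' b' assume "d \<in> carrier K" "a' \<in> carrier A" "b' \<in> carrier B"
  then show "(a \<otimes>\<^bsub>A\<^esub> (d \<odot>\<^bsub>A\<^esub> a')) \<otimes>\<^sub>t (b \<otimes>\<^bsub>B\<^esub> b') = (a \<otimes>\<^bsub>A\<^esub> a') \<otimes>\<^sub>t (b \<otimes>\<^bsub>B\<^esub> (d \<odot>\<^bsub>B\<^esub> b'))"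
    using assms by (simp add: A.smult_mult_right B.smult_mult_right tensor_smult)
qed (use assms in \<open>simp_all add: tensor_closed tensor_add_left tensor_add_right A.A.r_distr B.A.r_distr\<close>)

lemma mulr_tensor:
  "a \<in> carrier A \<Longrightarrow> b \<in> carrier B \<Longrightarrow> a' \<in> carrier A \<Longrightarrow> b' \<in> carrier B \<Longrightarrow>
    mulr a b (a' \<otimes>\<^sub>t b') = (a \<otimes>\<^bsub>A\<^esub> a') \<otimes>\<^sub>t (b \<otimes>\<^bsub>B\<^esub> b')"
  unfolding mulr_def by (rule lift_tensor[OF balanced_mulr])

lemma mulr_additive: "a \<in> carrier A \<Longrightarrow> b \<in> carrier B \<Longrightarrow> additive E E (mulr a b)"
  using lift_additive[OF balanced_mulr] unfolding mulr_def[abs_def] .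

lemmas mulr_closed = additive_closed[OF mulr_additive]
lemmas mulr_add = additive_add[OF mulr_additive]

lemma balanced_mult:
  assumes t: "t \<in> carrier E"
  shows "balanced K A B (add_monoid E) (\<lambda>a b. mulr a b t)"
proof (rule balanced_addI[OF abelian_group_E])
  fix a b assume "a \<in> carrier A" "b \<in> carrier B"
  then show "mulr a b t \<in> carrier E" using t by (rule mulr_closed)
next
  fix a a' b assume ab: "a \<in> carrier A" "a' \<in> carrier A" "b \<in> carrier B"
  show "mulr (a \<oplus>\<^bsub>A\<^esub> a') b t = mulr a b t \<oplus>\<^sub>E mulr a' b t"
    using t ab by (induction t rule: tensor_induct)
      (simp_all add: mulr_tensor mulr_add mulr_closed A.A.l_distr tensor_add_left E.a_ac)
next
  fix a b b' assume ab: "a \<in> carrier A" "b \<in> carrier B" "b' \<in> carrier B"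
  show "mulr a (b \<oplus>\<^bsub>B\<^esub> b') t = mulr a b t \<oplus>\<^sub>E mulr a b' t"
    using t ab by (induction t rule: tensor_induct)
      (simp_all add: mulr_tensor mulr_add mulr_closed B.A.l_distr tensor_add_right E.a_ac)
next
  fix c a b assume ab: "c \<in> carrier K" "a \<in> carrier A" "b \<in> carrier B"
  show "mulr (c \<odot>\<^bsub>A\<^esub> a) b t = mulr a (c \<odot>\<^bsub>B\<^esub> b) t"
    using t ab by (induction t rule: tensor_induct)
      (simp_all add: mulr_tensor mulr_add mulr_closed A.smult_mult_left B.smult_mult_left tensor_smult)
qed

lemma mult_additive_left: "t \<in> carrier E \<Longrightarrow> additive E E (\<lambda>s. s \<otimes>\<^sub>E t)"
  using lift_additive[OF balanced_mult] unfolding mult_eq .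

lemma tensor_mult_mulr:
  "a \<in> carrier A \<Longrightarrow> b \<in> carrier B \<Longrightarrow> t \<in> carrier E \<Longrightarrow> (a \<otimes>\<^sub>t b) \<otimes>\<^sub>E t = mulr a b t"
  unfolding mult_eq by (rule lift_tensor[OF balanced_mult])

lemma tensor_mult:
  "a \<in> carrier A \<Longrightarrow> b \<in> carrier B \<Longrightarrow> a' \<in> carrier A \<Longrightarrow> b' \<in> carrier B \<Longrightarrow>
    (a \<otimes>\<^sub>t b) \<otimes>\<^sub>E (a' \<otimes>\<^sub>t b') = (a \<otimes>\<^bsub>A\<^esub> a') \<otimes>\<^sub>t (b \<otimes>\<^bsub>B\<^esub> b')"
  by (simp add: tensor_mult_mulr mulr_tensor tensor_closed)

lemmas mult_closed' = additive_closed[OF mult_additive_left]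
lemmas mult_l_distr = additive_add[OF mult_additive_left]

lemma mult_r_distr:
  assumes "s \<in> carrier E" "t \<in> carrier E" "u \<in> carrier E"
  shows "s \<otimes>\<^sub>E (t \<oplus>\<^sub>E u) = s \<otimes>\<^sub>E t \<oplus>\<^sub>E s \<otimes>\<^sub>E u"
  using assms by (induction s rule: tensor_induct)
    (simp_all add: tensor_mult_mulr mulr_add mult_l_distr mult_closed' E.a_ac)

lemma mult_assoc':
  assumes "s \<in> carrier E" "t \<in> carrier E" "u \<in> carrier E"
  shows "(s \<otimes>\<^sub>E t) \<otimes>\<^sub>E u = s \<otimes>\<^sub>E (t \<otimes>\<^sub>E u)"
  using assms(1,2,3)
proof (induction s rule: tensor_induct)
  case (pure a b)
  from pure(3,4,1,2) show ?case
  proof (induction t rule: tensor_induct)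
    case (pure a' b')
    from pure(3,1,2,4,5) show ?case
      by (induction u rule: tensor_induct)
        (simp_all add: tensor_mult mult_closed' mult_r_distr tensor_closed A.A.m_assoc B.A.m_assoc)
  qed (simp_all add: mult_closed' mult_l_distr mult_r_distr tensor_closed)
qed (simp_all add: mult_closed' mult_l_distr)

lemma one_E: "\<one>\<^bsub>E\<^esub> = \<one>\<^bsub>A\<^esub> \<otimes>\<^sub>t \<one>\<^bsub>B\<^esub>"
  by (simp add: tensor_algebra_def)

lemma ring_E: "ring E"
proof (rule ringI)
  show "Group.monoid E"
  proof (rule monoidI)
    fix s assume s: "s \<in> carrier E"
    show "\<one>\<^bsub>E\<^esub> \<otimes>\<^sub>E s = s"
      using s by (induction s rule: tensor_induct)
        (simp_all add: one_E tensor_mult mult_r_distr tensor_closed)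
    show "s \<otimes>\<^sub>E \<one>\<^bsub>E\<^esub> = s"
      using s by (induction s rule: tensor_induct)
        (simp_all add: one_E tensor_mult mult_l_distr tensor_closed)
  qed (simp_all add: mult_closed' mult_assoc' one_E tensor_closed)
qed (simp_all add: abelian_group_E mult_l_distr mult_r_distr)

lemma assoc_algebra_E: "assoc_algebra K E"
proof -
  interpret E: ring E by (rule ring_E)
  interpret EM: module K E by (rule module_E)
  show ?thesis
  proof (intro assoc_algebra.intro assoc_algebra_axioms.intro)
    show "field K" by (rule A.field_axioms)
  next
    fix c s t assume c: "c \<in> carrier K" and s: "s \<in> carrier E" and t: "t \<in> carrier E"
    show "c \<odot>\<^bsub>E\<^esub> s \<otimes>\<^sub>E t = c \<odot>\<^bsub>E\<^esub> (s \<otimes>\<^sub>E t)"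
      using s t
    proof (induction s rule: tensor_induct)
      case (pure a b)
      from pure(3,1,2) show ?case
        by (induction t rule: tensor_induct)
          (use c in \<open>simp_all add: tensor_mult smult_tensor tensor_closed A.smult_mult_left mult_r_distr EM.smult_r_distr\<close>)
    qed (use c in \<open>simp_all add: mult_l_distr EM.smult_r_distr\<close>)
    show "s \<otimes>\<^sub>E (c \<odot>\<^bsub>E\<^esub> t) = c \<odot>\<^bsub>E\<^esub> (s \<otimes>\<^sub>E t)"
      using s t
    proof (induction s rule: tensor_induct)
      case (pure a b)
      from pure(3,1,2) show ?case
        by (induction t rule: tensor_induct)
          (use c in \<open>simp_all add: tensor_mult smult_tensor tensor_closed A.smult_mult_right mult_r_distr EM.smult_r_distr\<close>)
    qed (use c in \<open>simp_all add: mult_l_distr EM.smult_r_distr\<close>)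
  qed (rule module_E ring_E)+
qed

end

locale tensor_pair = D: tensor_product K A B + C: tensor_product K C D
  for K :: "('k, 'n) ring_scheme"
    and A :: "('k, 'a, 'm) module_scheme" and B :: "('k, 'b, 'l) module_scheme"
    and C :: "('k, 'c, 'o) module_scheme" and D :: "('k, 'd, 'p) module_scheme"
begin

lemma balanced_map:
  assumes "f \<in> linear_map K A C" "g \<in> linear_map K B D"
  shows "balanced K A B (add_monoid (tensor_algebra K C D)) (\<lambda>a b. tensor K C D (f a) (g b))"
  by (rule balanced_addI[OF C.abelian_group_E])
    (simp_all add: C.tensor_closed linear_closed[OF assms(1)] linear_closed[OF assms(2)]
      linear_add[OF assms(1)] linear_add[OF assms(2)] linear_smult[OF assms(1)]
      linear_smult[OF assms(2)] C.tensor_add_left C.tensor_add_right C.tensor_smult)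

lemma map_tensor:
  assumes "f \<in> linear_map K A C" "g \<in> linear_map K B D" "a \<in> carrier A" "b \<in> carrier B"
  shows "tensor_map K C D f g (tensor K A B a b) = tensor K C D (f a) (g b)"
  unfolding tensor_map_def tensor_lift_group
  by (rule D.lift_tensor[OF balanced_map[OF assms(1,2)] assms(3,4)])

lemma map_additive:
  assumes "f \<in> linear_map K A C" "g \<in> linear_map K B D"
  shows "additive (tensor_algebra K A B) (tensor_algebra K C D) (tensor_map K C D f g)"
  unfolding tensor_map_def tensor_lift_group
  by (rule D.lift_additive[OF balanced_map[OF assms]])

end

section \<open>Coefficients in Ore extensions\<close>

text \<open>The sum runs over an initial segment and not over the support as in
  \<open>skew_polynomial_ext\<close>, so that two expansions can be brought to a common bound and
  then added or compared. The link between the two forms is \<open>expansion_iff\<close>.\<close>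

definition expansion :: "('a, 'm) ring_scheme \<Rightarrow> 'a set \<Rightarrow> (nat \<Rightarrow> 'a) \<Rightarrow> 'a \<Rightarrow> (nat \<Rightarrow> 'a) \<Rightarrow> bool"
  where "expansion E A b t c \<longleftrightarrow> (\<forall>i. c i \<in> A) \<and>
    (\<exists>n. (\<forall>i>n. c i = \<zero>\<^bsub>E\<^esub>) \<and> t = (\<Oplus>\<^bsub>E\<^esub>i\<in>{..n}. c i \<otimes>\<^bsub>E\<^esub> b i))"

context ring
begin

lemma diff_self: "u \<in> carrier R \<Longrightarrow> u \<ominus> u = \<zero>"
  by simp

lemma finsum_extend:
  fixes n N :: nat
  assumes "\<forall>i>n. c i = \<zero>" "n \<le> N" "\<And>i. c i \<in> carrier R" "\<And>i. b i \<in> carrier R"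
  shows "(\<Oplus>i\<in>{..N}. c i \<otimes> b i) = (\<Oplus>i\<in>{..n}. c i \<otimes> b i)"
  by (rule add.finprod_mono_neutral_cong_right) (use assms in auto)

lemma expansionE:
  assumes "expansion R A b t c"
  shows "\<exists>n. (\<forall>i. c i \<in> A) \<and> (\<forall>i>n. c i = \<zero>) \<and> t = (\<Oplus>i\<in>{..n}. c i \<otimes> b i)"
  using assms unfolding expansion_def by blast

lemma expansion_iff:
  assumes "A \<subseteq> carrier R" "\<And>i. b i \<in> carrier R"
  shows "expansion R A b t c \<longleftrightarrow> (\<forall>i. c i \<in> A) \<and> finite {i. c i \<noteq> \<zero>} \<and>
    t = finsum R (\<lambda>i. c i \<otimes> b i) {i. c i \<noteq> \<zero>}"
proof -
  have eq: "finsum R (\<lambda>i. c i \<otimes> b i) {i. c i \<noteq> \<zero>} = (\<Oplus>i\<in>{..n}. c i \<otimes> b i)"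
    if "\<forall>i. c i \<in> A" "\<forall>i>n. c i = \<zero>" for n
  proof (rule add.finprod_mono_neutral_cong_left)
    show "{i. c i \<noteq> \<zero>} \<subseteq> {..n}" using that by (auto simp: not_less[symmetric])
    show "(\<lambda>i. c i \<otimes> b i) \<in> {..n} \<rightarrow> carrier R" using that(1) assms by blast
    show "c i \<otimes> b i = \<zero>" if "i \<in> {..n} - {i. c i \<noteq> \<zero>}" for i using that assms by auto
  qed auto
  show ?thesis
  proof
    assume "expansion R A b t c"
    then obtain n where n: "\<forall>i. c i \<in> A" "\<forall>i>n. c i = \<zero>" "t = (\<Oplus>i\<in>{..n}. c i \<otimes> b i)"
      unfolding expansion_def by blast
    moreover have "finite {i. c i \<noteq> \<zero>}"
      by (rule finite_subset[of _ "{..n}"]) (use n in \<open>auto simp: not_less[symmetric]\<close>)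
    ultimately show "(\<forall>i. c i \<in> A) \<and> finite {i. c i \<noteq> \<zero>} \<and>
      t = finsum R (\<lambda>i. c i \<otimes> b i) {i. c i \<noteq> \<zero>}"
      using eq[OF n(1,2)] by simp
  next
    assume r: "(\<forall>i. c i \<in> A) \<and> finite {i. c i \<noteq> \<zero>} \<and>
      t = finsum R (\<lambda>i. c i \<otimes> b i) {i. c i \<noteq> \<zero>}"
    then obtain n where "\<forall>i\<in>{i. c i \<noteq> \<zero>}. i \<le> n"
      using finite_nat_set_iff_bounded_le[of "{i. c i \<noteq> \<zero>}"] by auto
    then have "\<forall>i>n. c i = \<zero>" by (auto simp: not_le[symmetric])
    then show "expansion R A b t c" using r eq[of n] unfolding expansion_def by auto
  qed
qed

lemma expansion_add:
  assumes "A \<subseteq> carrier R" "\<And>i. b i \<in> carrier R" "\<And>x y. x \<in> A \<Longrightarrow> y \<in> A \<Longrightarrow> x \<oplus> y \<in> A"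
    and "expansion R A b s c" "expansion R A b t d"
  shows "expansion R A b (s \<oplus> t) (\<lambda>i. c i \<oplus> d i)"
proof -
  obtain m where m: "\<And>i. c i \<in> A" "\<And>i. i > m \<Longrightarrow> c i = \<zero>" "s = (\<Oplus>i\<in>{..m}. c i \<otimes> b i)"
    using expansionE[OF assms(4)] by blast
  obtain n where n: "\<And>i. d i \<in> A" "\<And>i. i > n \<Longrightarrow> d i = \<zero>" "t = (\<Oplus>i\<in>{..n}. d i \<otimes> b i)"
    using expansionE[OF assms(5)] by blast
  let ?N = "max m n"
  have cl: "c i \<in> carrier R" "d i \<in> carrier R" for i using m(1) n(1) assms(1) by auto
  have "(\<Oplus>i\<in>{..?N}. c i \<otimes> b i) = s" "(\<Oplus>i\<in>{..?N}. d i \<otimes> b i) = t"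
    unfolding m(3) n(3) by (rule finsum_extend; use m(2) n(2) cl assms(2) in simp)+
  moreover have "(\<Oplus>i\<in>{..?N}. c i \<otimes> b i) \<oplus> (\<Oplus>i\<in>{..?N}. d i \<otimes> b i)
      = (\<Oplus>i\<in>{..?N}. c i \<otimes> b i \<oplus> d i \<otimes> b i)"
    by (rule finsum_addf[symmetric]) (use cl assms(2) in auto)
  ultimately have "s \<oplus> t = (\<Oplus>i\<in>{..?N}. c i \<otimes> b i \<oplus> d i \<otimes> b i)" by simp
  also have "\<dots> = (\<Oplus>i\<in>{..?N}. (c i \<oplus> d i) \<otimes> b i)"
    using cl assms(2) by (simp add: l_distr)
  finally have e: "s \<oplus> t = \<dots>" .
  show ?thesis unfolding expansion_def
    by (intro conjI exI[of _ ?N]) (use e m n assms(3) in auto)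
qed

lemma expansion_lmult:
  assumes "A \<subseteq> carrier R" "\<And>i. b i \<in> carrier R" "\<And>x y. x \<in> A \<Longrightarrow> y \<in> A \<Longrightarrow> x \<otimes> y \<in> A"
    and "expansion R A b t c" "r \<in> A"
  shows "expansion R A b (r \<otimes> t) (\<lambda>i. r \<otimes> c i)"
proof -
  obtain m where m: "\<And>i. c i \<in> A" "\<And>i. i > m \<Longrightarrow> c i = \<zero>" "t = (\<Oplus>i\<in>{..m}. c i \<otimes> b i)"
    using expansionE[OF assms(4)] by blast
  have cl: "c i \<in> carrier R" "r \<in> carrier R" for i using m(1) assms(1,5) by auto
  have "r \<otimes> t = (\<Oplus>i\<in>{..m}. r \<otimes> c i \<otimes> b i)"
    unfolding m(3) using cl assms(2) by (simp add: finsum_rdistr m_assoc)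
  then show ?thesis unfolding expansion_def
    by (intro conjI exI[of _ m]) (use m assms(3,5) cl in auto)
qed

lemma expansion_shift:
  assumes "A \<subseteq> carrier R" "y \<in> carrier R" "\<zero> \<in> A"
    and "expansion R A (\<lambda>i. y [^] i) t c"
  shows "expansion R A (\<lambda>i. y [^] i) (t \<otimes> y) (case_nat \<zero> c)"
proof -
  obtain m where m: "\<And>i. c i \<in> A" "\<And>i. i > m \<Longrightarrow> c i = \<zero>" "t = (\<Oplus>i\<in>{..m}. c i \<otimes> y [^] i)"
    using expansionE[OF assms(4)] by blast
  have cl: "c i \<in> carrier R" for i using m(1) assms(1) by auto
  let ?d = "case_nat \<zero> c"
  have "(\<Oplus>i\<in>{..n}. c i \<otimes> y [^] i) \<otimes> y = (\<Oplus>i\<in>{..Suc n}. ?d i \<otimes> y [^] i)" for n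
  proof (induction n)
    case 0
    have dcl: "?d i \<in> carrier R" for i using cl by (cases i) auto
    have "(\<Oplus>i\<in>{..Suc 0}. ?d i \<otimes> y [^] i) = ?d (Suc 0) \<otimes> y [^] Suc 0 \<oplus> (\<Oplus>i\<in>{..0}. ?d i \<otimes> y [^] i)"
      by (rule finsum_Suc) (use dcl assms(2) in auto)
    then show ?case using cl assms(2) by (simp add: m_assoc del: finsum_Suc)
  next
    case (Suc n)
    have dcl: "?d i \<in> carrier R" for i using cl by (cases i) auto
    have "(\<Oplus>i\<in>{..Suc n}. c i \<otimes> y [^] i) = c (Suc n) \<otimes> y [^] Suc n \<oplus> (\<Oplus>i\<in>{..n}. c i \<otimes> y [^] i)"
      by (rule finsum_Suc) (use cl assms(2) in auto)
    moreover have "(\<Oplus>i\<in>{..Suc (Suc n)}. ?d i \<otimes> y [^] i)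
      = ?d (Suc (Suc n)) \<otimes> y [^] Suc (Suc n) \<oplus> (\<Oplus>i\<in>{..Suc n}. ?d i \<otimes> y [^] i)"
      by (rule finsum_Suc) (use dcl assms(2) in auto)
    ultimately show ?case
      using Suc cl assms(2) by (simp add: l_distr m_assoc del: finsum_Suc)
  qed
  then have "t \<otimes> y = (\<Oplus>i\<in>{..Suc m}. ?d i \<otimes> y [^] i)" using m(3) by simp
  moreover have "?d i \<in> A" for i using m assms(3) by (cases i) auto
  moreover have "i > Suc m \<Longrightarrow> ?d i = \<zero>" for i using m by (cases i) auto
  ultimately show ?thesis unfolding expansion_def by blast
qed

lemma expansion_const:
  assumes "A \<subseteq> carrier R" "y \<in> carrier R" "\<zero> \<in> A" "r \<in> A"
  shows "expansion R A (\<lambda>i. y [^] i) r (\<lambda>i. if i = 0 then r else \<zero>)"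
proof -
  have r: "r \<in> carrier R" using assms by auto
  then have "r = (\<Oplus>i\<in>{..(0::nat)}. (if i = 0 then r else \<zero>) \<otimes> y [^] i)" by simp
  then show ?thesis unfolding expansion_def using assms by (metis (no_types, lifting) less_nat_zero_code)
qed

end

text \<open>\<open>p j u\<close> is the coefficient of \<open>Y\<^sup>j\<close> in \<open>u\<close>; freeness over \<open>A\<close> is encoded by the
  coefficient maps, so that no sums are needed in degree arguments.\<close>

locale ore_ring = ring E for E (structure) +
  fixes A :: "'a set" and Y :: 'a and p :: "nat \<Rightarrow> 'a \<Rightarrow> 'a" and \<tau> \<delta> :: "'a \<Rightarrow> 'a"
  assumes A_sub: "A \<subseteq> carrier E"
    and A_zero: "\<zero> \<in> A" and A_one: "\<one> \<in> A"
    and A_add: "\<And>u v. u \<in> A \<Longrightarrow> v \<in> A \<Longrightarrow> u \<oplus> v \<in> A"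
    and A_mult: "\<And>u v. u \<in> A \<Longrightarrow> v \<in> A \<Longrightarrow> u \<otimes> v \<in> A"
    and Y_closed: "Y \<in> carrier E"
    and p_closed: "\<And>j u. u \<in> carrier E \<Longrightarrow> p j u \<in> A"
    and p_add: "\<And>j u v. u \<in> carrier E \<Longrightarrow> v \<in> carrier E \<Longrightarrow> p j (u \<oplus> v) = p j u \<oplus> p j v"
    and p_lmult: "\<And>j u v. v \<in> A \<Longrightarrow> u \<in> carrier E \<Longrightarrow> p j (v \<otimes> u) = v \<otimes> p j u"
    and p_Y: "\<And>j u. u \<in> carrier E \<Longrightarrow> p j (u \<otimes> Y) = (case j of 0 \<Rightarrow> \<zero> | Suc i \<Rightarrow> p i u)"
    and p_A: "\<And>j v. v \<in> A \<Longrightarrow> p j v = (if j = 0 then v else \<zero>)"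
    and p_bounded: "\<And>u. u \<in> carrier E \<Longrightarrow> \<exists>n. \<forall>i>n. p i u = \<zero>"
    and p_separates: "\<And>u. u \<in> carrier E \<Longrightarrow> (\<And>j. p j u = \<zero>) \<Longrightarrow> u = \<zero>"
    and \<tau>_closed: "\<And>v. v \<in> A \<Longrightarrow> \<tau> v \<in> A" and \<delta>_closed: "\<And>v. v \<in> A \<Longrightarrow> \<delta> v \<in> A"
    and Y_comm: "\<And>v. v \<in> A \<Longrightarrow> Y \<otimes> v = \<tau> v \<otimes> Y \<oplus> \<delta> v"
begin

lemma A_car: "v \<in> A \<Longrightarrow> v \<in> carrier E"
  using A_sub by blast

lemma p_car: "u \<in> carrier E \<Longrightarrow> p j u \<in> carrier E"
  using p_closed A_sub by blast

lemma p_zero: "p j \<zero> = \<zero>"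
  using p_A[OF A_zero] by simp

lemma p_minus: "u \<in> carrier E \<Longrightarrow> p j (\<ominus> u) = \<ominus> p j u"
  using p_add[of "\<ominus> u" u j] p_car by (simp add: l_neg p_zero minus_equality[symmetric])

lemma p_diff: "u \<in> carrier E \<Longrightarrow> v \<in> carrier E \<Longrightarrow> p j (u \<ominus> v) = p j u \<ominus> p j v"
  by (simp add: a_minus_def p_add p_minus)

lemma tau_pow_closed: "v \<in> A \<Longrightarrow> (\<tau> ^^ n) v \<in> A"
  by (induction n) (auto simp: \<tau>_closed)

definition deg_le :: "nat \<Rightarrow> 'a \<Rightarrow> bool"
  where "deg_le n u \<longleftrightarrow> u \<in> carrier E \<and> (\<forall>i>n. p i u = \<zero>)"

lemma deg_le_closed: "deg_le n u \<Longrightarrow> u \<in> carrier E"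
  by (simp add: deg_le_def)

lemma deg_le_add: "deg_le n u \<Longrightarrow> deg_le n v \<Longrightarrow> deg_le n (u \<oplus> v)"
  by (simp add: deg_le_def p_add)

lemma deg_le_diff: "deg_le n u \<Longrightarrow> deg_le n v \<Longrightarrow> deg_le n (u \<ominus> v)"
  by (simp add: deg_le_def p_diff diff_self)

lemma deg_le_mono: "deg_le n u \<Longrightarrow> n \<le> m \<Longrightarrow> deg_le m u"
  by (simp add: deg_le_def)

lemma deg_le_A: "v \<in> A \<Longrightarrow> deg_le n v"
  by (simp add: deg_le_def p_A A_car)

lemma deg_le_lmult: "v \<in> A \<Longrightarrow> deg_le n u \<Longrightarrow> deg_le n (v \<otimes> u)"
  by (simp add: deg_le_def p_lmult A_car)

lemma deg_le_zero: assumes "deg_le 0 u" shows "u = p 0 u"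
proof -
  have u: "u \<in> carrier E" using assms by (rule deg_le_closed)
  have "p j (u \<ominus> p 0 u) = \<zero>" for j
    using u assms p_closed[OF u, of 0]
    by (cases "j = 0") (simp_all add: p_diff p_A p_car deg_le_def diff_self)
  then have "u \<ominus> p 0 u = \<zero>" using p_separates[of "u \<ominus> p 0 u"] u p_car by simp
  then show ?thesis using u p_car by (metis r_right_minus_eq)
qed

lemma p_mult_pow: "u \<in> carrier E \<Longrightarrow> p j (u \<otimes> Y [^] n) = (if j < n then \<zero> else p (j - n) u)"
proof (induction n arbitrary: j)
  case (Suc n)
  have "u \<otimes> Y [^] Suc n = (u \<otimes> Y [^] n) \<otimes> Y" using Suc.prems Y_closed by (simp add: m_assoc)
  then show ?case using Suc Y_closed by (cases j) (simp_all add: p_Y)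
qed simp

lemma deg_le_mult_pow: "deg_le a u \<Longrightarrow> deg_le (a + n) (u \<otimes> Y [^] n)"
  unfolding deg_le_def using Y_closed by (auto simp: p_mult_pow)

lemma deg_le_Suc:
  assumes "deg_le (Suc n) u"
  obtains u' where "deg_le n u'" "u = u' \<oplus> p (Suc n) u \<otimes> Y [^] Suc n"
proof
  let ?m = "p (Suc n) u \<otimes> Y [^] Suc n"
  have u: "u \<in> carrier E" using assms by (rule deg_le_closed)
  have m: "?m \<in> carrier E" using u p_car Y_closed by simp
  show "u = (u \<ominus> ?m) \<oplus> ?m" using u m by (simp add: a_minus_def a_assoc l_neg)
  have "p i (u \<ominus> ?m) = \<zero>" if "i > n" for i
  proof -
    have "p i ?m = (if i < Suc n then \<zero> else p (i - Suc n) (p (Suc n) u))"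
      by (rule p_mult_pow) (use u p_car in auto)
    then show ?thesis
      using that assms u m p_closed[OF u, of "Suc n"] p_car[OF u]
      by (cases "i = Suc n") (simp_all add: p_diff deg_le_def p_A diff_self)
  qed
  then show "deg_le n (u \<ominus> ?m)" unfolding deg_le_def using u m by simp
qed

text \<open>Each passage of Y across a coefficient applies \<tau> to the leading term, while
  \<delta> contributes only to lower degrees.\<close>

lemma deg_Y_pow: "v \<in> A \<Longrightarrow> deg_le n (Y [^] n \<otimes> v) \<and> p n (Y [^] n \<otimes> v) = (\<tau> ^^ n) v"
proof (induction n arbitrary: v)
  case 0
  then show ?case by (simp add: deg_le_A A_car p_A)
next
  case (Suc n)
  have v: "v \<in> carrier E" "\<tau> v \<in> carrier E" "\<delta> v \<in> carrier E" using Suc.prems A_car \<tau>_closed \<delta>_closed by auto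
  have "Y [^] Suc n \<otimes> v = Y [^] n \<otimes> \<tau> v \<otimes> Y \<oplus> Y [^] n \<otimes> \<delta> v"
    using v Y_closed Suc.prems by (simp add: m_assoc Y_comm r_distr)
  moreover have "deg_le (Suc n) (Y [^] n \<otimes> \<tau> v \<otimes> Y)"
    using deg_le_mult_pow[of n "Y [^] n \<otimes> \<tau> v" 1] Suc.IH[of "\<tau> v"] Suc.prems \<tau>_closed Y_closed by simp
  moreover have "deg_le n (Y [^] n \<otimes> \<delta> v)" using Suc.IH Suc.prems \<delta>_closed by blast
  moreover have "p (Suc n) (Y [^] n \<otimes> \<tau> v \<otimes> Y) = (\<tau> ^^ n) (\<tau> v)"
    using Suc.IH[of "\<tau> v"] Suc.prems \<tau>_closed Y_closed v by (simp add: p_Y)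
  moreover have "p (Suc n) (Y [^] n \<otimes> \<delta> v) = \<zero>"
    using \<open>deg_le n (Y [^] n \<otimes> \<delta> v)\<close> unfolding deg_le_def by simp
  moreover have "(\<tau> ^^ n) (\<tau> v) \<in> carrier E" using tau_pow_closed \<tau>_closed Suc.prems A_car by blast
  ultimately show ?case
    using v Y_closed by (simp add: deg_le_add deg_le_mono[of n _ "Suc n"] p_add funpow_swap1)
qed

lemma deg_mult_A:
  assumes "v \<in> A"
  shows "deg_le a u \<Longrightarrow> deg_le a (u \<otimes> v) \<and> p a (u \<otimes> v) = p a u \<otimes> (\<tau> ^^ a) v"
proof (induction a arbitrary: u)
  case 0
  then have "u \<in> A" using deg_le_zero deg_le_closed p_closed by metis
  then show ?case using assms A_mult by (simp add: deg_le_A p_A)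
next
  case (Suc n)
  obtain u' where u': "deg_le n u'" "u = u' \<oplus> p (Suc n) u \<otimes> Y [^] Suc n"
    using deg_le_Suc[OF Suc.prems] .
  let ?c = "p (Suc n) u"
  have c: "?c \<in> A" using p_closed deg_le_closed[OF Suc.prems] by blast
  have v: "v \<in> carrier E" "u' \<in> carrier E" "?c \<in> carrier E" using assms A_car u'(1) deg_le_closed c by auto
  have "u \<otimes> v = u' \<otimes> v \<oplus> ?c \<otimes> (Y [^] Suc n \<otimes> v)"
    by (subst u'(2)) (use v Y_closed in \<open>simp add: l_distr m_assoc\<close>)
  moreover have d1: "deg_le n (u' \<otimes> v)" using Suc.IH[OF u'(1)] by blast
  moreover have d2: "deg_le (Suc n) (?c \<otimes> (Y [^] Suc n \<otimes> v))"
    using deg_le_lmult[OF c] deg_Y_pow[OF assms] by blast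
  moreover have "p (Suc n) (?c \<otimes> (Y [^] Suc n \<otimes> v)) = ?c \<otimes> (\<tau> ^^ Suc n) v"
    using deg_Y_pow[OF assms, of "Suc n"] p_lmult[OF c] v Y_closed by simp
  moreover have "p (Suc n) (u' \<otimes> v) = \<zero>" using d1 unfolding deg_le_def by simp
  moreover have "(\<tau> ^^ Suc n) v \<in> carrier E" using tau_pow_closed[OF assms] A_car by blast
  ultimately show ?case
    using v Y_closed deg_le_closed[OF d2] by (simp add: deg_le_add deg_le_mono[of n _ "Suc n"] p_add del: funpow.simps nat_pow_Suc)
qed

text \<open>Working with upper bounds for degrees avoids cases on vanishing coefficients: the
  formula for the coefficient at a + b is valid even if it is zero. Exact degrees follow wherever
  the coefficient ring is a domain and \<tau> is injective.\<close>

lemma deg_mult: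
  "deg_le b v \<Longrightarrow> deg_le a u \<Longrightarrow> deg_le (a + b) (u \<otimes> v) \<and> p (a + b) (u \<otimes> v) = p a u \<otimes> (\<tau> ^^ a) (p b v)"
proof (induction b arbitrary: v)
  case 0
  then have "v = p 0 v" "v \<in> A" using deg_le_zero deg_le_closed p_closed by metis+
  then show ?case using deg_mult_A 0 by simp
next
  case (Suc n)
  obtain v' where v': "deg_le n v'" "v = v' \<oplus> p (Suc n) v \<otimes> Y [^] Suc n"
    using deg_le_Suc[OF Suc.prems(1)] .
  let ?c = "p (Suc n) v"
  have c: "?c \<in> A" using p_closed deg_le_closed[OF Suc.prems(1)] by blast
  have u: "u \<in> carrier E" "v' \<in> carrier E" "?c \<in> carrier E" using Suc.prems(2) A_car v'(1) deg_le_closed c by auto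
  have "u \<otimes> v = u \<otimes> v' \<oplus> (u \<otimes> ?c) \<otimes> Y [^] Suc n"
    by (subst v'(2)) (use u Y_closed in \<open>simp add: r_distr m_assoc\<close>)
  moreover have d1: "deg_le (a + n) (u \<otimes> v')" using Suc.IH[OF v'(1) Suc.prems(2)] by blast
  moreover have d2: "deg_le a (u \<otimes> ?c)" and e2: "p a (u \<otimes> ?c) = p a u \<otimes> (\<tau> ^^ a) ?c"
    using deg_mult_A[OF c Suc.prems(2)] by blast+
  moreover have "deg_le (a + Suc n) ((u \<otimes> ?c) \<otimes> Y [^] Suc n)" using deg_le_mult_pow[OF d2] .
  moreover have "p (a + Suc n) ((u \<otimes> ?c) \<otimes> Y [^] Suc n) = p a u \<otimes> (\<tau> ^^ a) ?c"
    using p_mult_pow[of "u \<otimes> ?c" "a + Suc n" "Suc n"] u e2 by simp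
  moreover have "p (a + Suc n) (u \<otimes> v') = \<zero>" using d1 unfolding deg_le_def by simp
  moreover have "(\<tau> ^^ a) ?c \<in> carrier E" using tau_pow_closed[OF c] A_car by blast
  moreover have "deg_le (a + Suc n) (u \<otimes> v')" using deg_le_mono[OF d1] by simp
  ultimately show ?case
    using u Y_closed p_car[OF u(1)] by (simp add: deg_le_add p_add del: nat_pow_Suc)
qed

lemma degree_exists:
  assumes "u \<in> carrier E" "u \<noteq> \<zero>"
  shows "\<exists>n. deg_le n u \<and> p n u \<noteq> \<zero>"
proof -
  obtain N where N: "\<forall>i>N. p i u = \<zero>" using p_bounded[OF assms(1)] by blast
  obtain j where j: "p j u \<noteq> \<zero>" using p_separates[OF assms(1)] assms(2) by blast
  have b: "\<And>i. p i u \<noteq> \<zero> \<Longrightarrow> i \<le> N" using N not_less by blast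
  define n where "n = (GREATEST i. p i u \<noteq> \<zero>)"
  have "p n u \<noteq> \<zero>" unfolding n_def by (rule GreatestI_nat[of _ j N]) (use j b in auto)
  moreover have "i \<le> n" if "p i u \<noteq> \<zero>" for i
    unfolding n_def by (rule Greatest_le_nat[of _ i N]) (use that b in auto)
  ultimately show ?thesis using assms(1) unfolding deg_le_def by (intro exI[of _ n]) (auto simp: not_less[symmetric])
qed

text \<open>By \<open>deg_mult\<close> the leading coefficient of a product is a product of nonzero
  elements of C. The statement is relative to a subset B with coefficients in C so that it can be
  applied to T \<otimes> R, with coefficients in R \<otimes> R, inside the larger ring T \<otimes>
  T.\<close>

lemma no_zero_divisors_sub:
  assumes B: "B \<subseteq> carrier E" and C: "\<And>u j. u \<in> B \<Longrightarrow> p j u \<in> C"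
    and tau: "\<And>v. v \<in> C \<Longrightarrow> \<tau> v \<in> C" "\<And>v. v \<in> C \<Longrightarrow> \<tau> v = \<zero> \<Longrightarrow> v = \<zero>"
    and dom: "\<And>v w. v \<in> C \<Longrightarrow> w \<in> C \<Longrightarrow> v \<otimes> w = \<zero> \<Longrightarrow> v = \<zero> \<or> w = \<zero>"
    and uv: "u \<in> B" "v \<in> B" "u \<otimes> v = \<zero>"
  shows "u = \<zero> \<or> v = \<zero>"
proof (rule ccontr)
  assume "\<not> ?thesis"
  then obtain a b where ab: "deg_le a u" "p a u \<noteq> \<zero>" "deg_le b v" "p b v \<noteq> \<zero>"
    using uv B degree_exists[of u] degree_exists[of v] by blast
  have t: "(\<tau> ^^ n) w \<in> C" "(\<tau> ^^ n) w \<noteq> \<zero>" if "w \<in> C" "w \<noteq> \<zero>" for n w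
  proof -
    have "(\<tau> ^^ n) w \<in> C \<and> (\<tau> ^^ n) w \<noteq> \<zero>"
    proof (induction n)
      case (Suc n)
      then show ?case using tau(1)[of "(\<tau> ^^ n) w"] tau(2)[of "(\<tau> ^^ n) w"] by auto
    qed (use that in simp)
    then show "(\<tau> ^^ n) w \<in> C" "(\<tau> ^^ n) w \<noteq> \<zero>" by simp_all
  qed
  have "p a u \<otimes> (\<tau> ^^ a) (p b v) = \<zero>"
    using deg_mult[OF ab(3,1)] uv(3) p_zero by simp
  then show False using dom[of "p a u" "(\<tau> ^^ a) (p b v)"] t[of "p b v" a] C uv ab by blast
qed

text \<open>Degrees add up under these hypotheses and the unit has degree 0, so both factors have
  degree 0. A one-sided inverse is enough for this.\<close>

lemma invertible_in_A:
  assumes dom: "\<And>v w. v \<in> A \<Longrightarrow> w \<in> A \<Longrightarrow> v \<otimes> w = \<zero> \<Longrightarrow> v = \<zero> \<or> w = \<zero>"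
    and tau: "\<And>v. v \<in> A \<Longrightarrow> \<tau> v = \<zero> \<Longrightarrow> v = \<zero>"
    and uv: "u \<in> carrier E" "v \<in> carrier E" "u \<otimes> v = \<one>" and nt: "\<one> \<noteq> \<zero>"
  shows "u \<in> A \<and> v \<in> A"
proof -
  have "u \<noteq> \<zero>" "v \<noteq> \<zero>" using uv nt by auto
  then obtain a b where ab: "deg_le a u" "p a u \<noteq> \<zero>" "deg_le b v" "p b v \<noteq> \<zero>"
    using uv degree_exists[of u] degree_exists[of v] by blast
  have t: "(\<tau> ^^ n) w \<in> A" "(\<tau> ^^ n) w \<noteq> \<zero>" if "w \<in> A" "w \<noteq> \<zero>" for n w
  proof -
    have "(\<tau> ^^ n) w \<in> A \<and> (\<tau> ^^ n) w \<noteq> \<zero>"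
    proof (induction n)
      case (Suc n)
      then show ?case using \<tau>_closed[of "(\<tau> ^^ n) w"] tau[of "(\<tau> ^^ n) w"] by auto
    qed (use that in simp)
    then show "(\<tau> ^^ n) w \<in> A" "(\<tau> ^^ n) w \<noteq> \<zero>" by simp_all
  qed
  have "p a u \<otimes> (\<tau> ^^ a) (p b v) \<noteq> \<zero>"
    using dom[of "p a u" "(\<tau> ^^ a) (p b v)"] t[of "p b v" a] p_closed uv ab by blast
  then have "p (a + b) \<one> \<noteq> \<zero>" using deg_mult[OF ab(3,1)] uv(3) by simp
  then have "a = 0" "b = 0" using p_A[OF A_one, of "a + b"] by (auto split: if_splits)
  then show ?thesis using ab deg_le_zero p_closed uv by metis
qed

lemma eq_sum:
  "deg_le n u \<Longrightarrow> u = (\<Oplus>j\<in>{..n}. p j u \<otimes> Y [^] j)"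
proof (induction n arbitrary: u)
  case 0
  have "(\<Oplus>j\<in>{..(0::nat)}. p j u \<otimes> Y [^] j) = p 0 u \<otimes> Y [^] (0::nat)"
    by (rule finsum_0) (use p_car[OF deg_le_closed[OF 0]] Y_closed in auto)
  then show ?case using deg_le_zero[OF 0] deg_le_closed[OF 0] by simp
next
  case (Suc n)
  obtain u' where u': "deg_le n u'" "u = u' \<oplus> p (Suc n) u \<otimes> Y [^] Suc n"
    using deg_le_Suc[OF Suc.prems] .
  let ?c = "p (Suc n) u"
  have u: "u \<in> carrier E" "u' \<in> carrier E" "?c \<in> carrier E"
    using deg_le_closed Suc.prems u'(1) p_car by blast+
  have "p j u' = p j u" if "j \<le> n" for j
  proof -
    have "p j u = p j u' \<oplus> p j (?c \<otimes> Y [^] Suc n)"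
      by (subst u'(2)) (use u Y_closed p_add in simp)
    moreover have "p j (?c \<otimes> Y [^] Suc n) = \<zero>" by (subst p_mult_pow) (use that u in auto)
    ultimately show ?thesis using u p_car by simp
  qed
  then have "(\<Oplus>j\<in>{..n}. p j u' \<otimes> Y [^] j) = (\<Oplus>j\<in>{..n}. p j u \<otimes> Y [^] j)"
    by (intro finsum_cong') (use u p_car Y_closed in auto)
  then have "u' = (\<Oplus>j\<in>{..n}. p j u \<otimes> Y [^] j)" using Suc.IH[OF u'(1)] by simp
  moreover have "(\<Oplus>j\<in>{..Suc n}. p j u \<otimes> Y [^] j) = ?c \<otimes> Y [^] Suc n \<oplus> (\<Oplus>j\<in>{..n}. p j u \<otimes> Y [^] j)"
    by (rule finsum_Suc) (use u p_car Y_closed in auto)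
  ultimately show ?case
    using u'(2) u Y_closed by (simp add: a_comm del: finsum_Suc nat_pow_Suc)
qed

text \<open>The passage from the powers of Y to the family b is triangular with invertible diagonal
  entries. Elimination from the top degree yields the coefficients, and comparing top coefficients
  shows that they are unique. It is meant for the powers of a new variable.\<close>

lemma triangular_basis:
  assumes b: "\<And>n. deg_le n (b n)"
    and k: "\<And>n. k n \<in> A" "\<And>n. k n \<otimes> p n (b n) = \<one>" "\<And>n. p n (b n) \<otimes> k n = \<one>"
    and t: "t \<in> carrier E"
  shows "\<exists>!c. expansion E A b t c"
proof -
  let ?s = "\<lambda>c n. \<Oplus>i\<in>{..n}. c i \<otimes> b i"
  have bc: "b n \<in> carrier E" "p n (b n) \<in> carrier E" "k n \<in> carrier E" for n
    using b[of n] deg_le_closed p_car k(1) A_car by blast+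
  have ex: "deg_le n t \<Longrightarrow> \<exists>c. (\<forall>i. c i \<in> A) \<and> (\<forall>i>n. c i = \<zero>) \<and> t = ?s c n" for n t
  proof (induction n arbitrary: t)
    case 0
    have t: "t \<in> A" "b 0 \<in> A" "p 0 (b 0) = b 0"
      using deg_le_zero[OF 0] deg_le_zero[OF b[of 0]] p_closed deg_le_closed[OF 0] bc by metis+
    let ?c = "\<lambda>i. if i = 0 then t \<otimes> k 0 else \<zero>"
    have "t = ?s ?c (0::nat)"
      using t A_car bc k(2)[of 0] by (simp add: m_assoc)
    moreover have "\<forall>i. ?c i \<in> A" using t A_mult k(1) A_zero by simp
    ultimately show ?case by (intro exI[of _ ?c]) simp
  next
    case (Suc n)
    \<comment> \<open>This multiple of b at \<open>Suc n\<close> has the same top coefficient as t,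
      so subtracting it lowers the degree.\<close>
    let ?a = "p (Suc n) t \<otimes> k (Suc n)"
    have tc: "t \<in> carrier E" using Suc.prems deg_le_closed by blast
    have a: "?a \<in> A" "?a \<in> carrier E" using p_closed[OF tc] k(1) A_mult A_car by auto
    have d: "deg_le (Suc n) (t \<ominus> ?a \<otimes> b (Suc n))"
      by (intro deg_le_diff Suc.prems deg_le_lmult a b)
    have "p (Suc n) (?a \<otimes> b (Suc n)) = p (Suc n) t \<otimes> (k (Suc n) \<otimes> p (Suc n) (b (Suc n)))"
      using p_lmult[OF a(1) bc(1)[of "Suc n"]] p_car[OF tc] bc by (simp add: m_assoc)
    also have "\<dots> = p (Suc n) t" using k(2)[of "Suc n"] p_car[OF tc] by simp
    finally have "p (Suc n) (t \<ominus> ?a \<otimes> b (Suc n)) = \<zero>"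
      using a tc bc p_car by (simp add: p_diff)
    then have "deg_le n (t \<ominus> ?a \<otimes> b (Suc n))"
      using d unfolding deg_le_def by (metis Suc_lessI)
    then obtain c where c: "\<forall>i. c i \<in> A" "\<forall>i>n. c i = \<zero>" "t \<ominus> ?a \<otimes> b (Suc n) = ?s c n"
      using Suc.IH by blast
    have cc: "c i \<in> carrier E" for i using c A_car by blast
    let ?c = "c(Suc n := ?a)"
    have "(?s ?c (Suc n)) = ?c (Suc n) \<otimes> b (Suc n) \<oplus> (?s ?c n)"
      by (rule finsum_Suc) (use cc a bc in auto)
    also have "(?s ?c n) = ?s c n"
      by (rule finsum_cong') (use cc bc in auto)
    also have "?c (Suc n) \<otimes> b (Suc n) \<oplus> \<dots> = t"
      unfolding c(3)[symmetric] using tc a bc by (simp add: a_minus_def a_lcomm r_neg)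
    finally show ?case using c a by (intro exI[of _ ?c]) auto
  qed
  have sum: "(?s c n) \<in> carrier E \<and> deg_le n (?s c n) \<and>
      p n (?s c n) = c n \<otimes> p n (b n)" if "\<And>i. c i \<in> A" for c n
  proof (induction n)
    case 0
    then show ?case using that A_car bc b by (simp add: deg_le_lmult p_lmult)
  next
    case (Suc n)
    have cc: "c i \<in> carrier E" for i using that A_car by blast
    have s: "(?s c (Suc n)) = c (Suc n) \<otimes> b (Suc n) \<oplus> (?s c n)"
      by (rule finsum_Suc) (use cc bc in auto)
    have "p (Suc n) (?s c n) = \<zero>" using Suc unfolding deg_le_def by blast
    then show ?case
      unfolding s using Suc cc bc b that
      by (simp add: p_add p_lmult deg_le_add deg_le_lmult deg_le_mono[of n _ "Suc n"])
  qed
  have uniq: "(?s c n) = ?s d n \<Longrightarrow> \<forall>i\<le>n. c i = d i"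
    if "\<And>i. c i \<in> A" "\<And>i. d i \<in> A" for c d n
  proof (induction n)
    case 0
    have "c 0 \<otimes> p 0 (b 0) = d 0 \<otimes> p 0 (b 0)"
      using 0 sum[of c 0] sum[of d 0] that by metis
    then have "c 0 \<otimes> p 0 (b 0) \<otimes> k 0 = d 0 \<otimes> p 0 (b 0) \<otimes> k 0" by simp
    then show ?case using that A_car bc k by (simp add: m_assoc)
  next
    case (Suc n)
    have "c (Suc n) \<otimes> p (Suc n) (b (Suc n)) = d (Suc n) \<otimes> p (Suc n) (b (Suc n))"
      using Suc.prems sum[of c "Suc n"] sum[of d "Suc n"] that by metis
    then have "c (Suc n) \<otimes> p (Suc n) (b (Suc n)) \<otimes> k (Suc n) = d (Suc n) \<otimes> p (Suc n) (b (Suc n)) \<otimes> k (Suc n)"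
      by simp
    then have e: "c (Suc n) = d (Suc n)" using that A_car bc k by (simp add: m_assoc)
    have cc: "c i \<in> carrier E" "d i \<in> carrier E" for i using that A_car by blast+
    have s: "(?s c (Suc n)) = c (Suc n) \<otimes> b (Suc n) \<oplus> (?s c n)"
        "(?s d (Suc n)) = d (Suc n) \<otimes> b (Suc n) \<oplus> (?s d n)"
      by (rule finsum_Suc; use cc bc in auto)+
    have "(?s c n) = ?s d n"
      using Suc.prems unfolding s e using sum[of c n] sum[of d n] that cc bc by simp
    then show ?case using Suc.IH e by (metis le_Suc_eq)
  qed
  obtain n where "deg_le n t" using p_bounded[OF t] t unfolding deg_le_def by blast
  then obtain c where c: "expansion E A b t c" using ex[of n t] unfolding expansion_def by blast
  moreover have "d = c" if d: "expansion E A b t d" for d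
  proof -
    obtain m where m: "\<And>i. c i \<in> A" "\<And>i. i > m \<Longrightarrow> c i = \<zero>" "t = ?s c m"
      using expansionE[OF c] by blast
    obtain l where l: "\<And>i. d i \<in> A" "\<And>i. i > l \<Longrightarrow> d i = \<zero>" "t = ?s d l"
      using expansionE[OF d] by blast
    \<comment> \<open>The two expansions come with different bounds; \<open>uniq\<close> compares
      sums of equal length.\<close>
    let ?N = "max m l"
    have "(?s c ?N) = ?s c m"
      "(?s d ?N) = ?s d l"
      by (rule finsum_extend; use m(1,2) l(1,2) A_car bc in simp)+
    then have "(?s c ?N) = ?s d ?N"
      by (simp only: m(3)[symmetric] l(3)[symmetric])
    then have "\<forall>i\<le>?N. d i = c i" by (intro uniq[OF l(1) m(1)]) simp
    moreover have "d i = c i" if "\<not> i \<le> ?N" for i using m(2)[of i] l(2)[of i] that by simp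
    ultimately show ?thesis by blast
  qed
  ultimately show ?thesis by blast
qed

end

section \<open>Coefficient maps of R[x; \<sigma>, \<delta>] and change of the variable\<close>

locale skew_ext =
  fixes K :: "('k, 'n) ring_scheme"
    and R :: "('k, 'a, 'm) module_scheme"
    and T :: "('k, 'a, 'l) module_scheme" (structure)
    and x :: 'a and \<sigma> \<delta> :: "'a \<Rightarrow> 'a"
  assumes skew: "skew_polynomial_ext K R T x \<sigma> \<delta>"

sublocale skew_ext \<subseteq> T: assoc_algebra K T
  using skew unfolding skew_polynomial_ext_def by blast

sublocale skew_ext \<subseteq> R: assoc_algebra K R
  using skew unfolding skew_polynomial_ext_def by blast

context skew_ext
begin

lemma incl_hom: "(\<lambda>r. r) \<in> alg_hom K R T"
  using skew unfolding skew_polynomial_ext_def by blast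

lemma sub_carrier: "r \<in> carrier R \<Longrightarrow> r \<in> carrier T"
  and sub_mult: "r \<in> carrier R \<Longrightarrow> s \<in> carrier R \<Longrightarrow> r \<otimes>\<^bsub>R\<^esub> s = r \<otimes> s"
  and sub_add: "r \<in> carrier R \<Longrightarrow> s \<in> carrier R \<Longrightarrow> r \<oplus>\<^bsub>R\<^esub> s = r \<oplus> s"
  and sub_one: "\<one>\<^bsub>R\<^esub> = \<one>"
  and sub_smult: "c \<in> carrier K \<Longrightarrow> r \<in> carrier R \<Longrightarrow> c \<odot>\<^bsub>R\<^esub> r = c \<odot> r"
  using incl_hom unfolding alg_hom_def ring_hom_def linear_map_def by auto

lemma incl_linear: "(\<lambda>r. r) \<in> linear_map K R T"
  using incl_hom unfolding alg_hom_def by blast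

lemma sub_zero: "\<zero>\<^bsub>R\<^esub> = \<zero>"
  using additive_zero[OF R.M.abelian_group_axioms T.M.abelian_group_axioms linear_additive[OF incl_linear]] .

lemma R_zero: "\<zero> \<in> carrier R" and R_one: "\<one> \<in> carrier R"
  using R.M.zero_closed R.A.one_closed sub_zero sub_one by auto

lemma R_add: "r \<in> carrier R \<Longrightarrow> s \<in> carrier R \<Longrightarrow> r \<oplus> s \<in> carrier R"
  and R_mult: "r \<in> carrier R \<Longrightarrow> s \<in> carrier R \<Longrightarrow> r \<otimes> s \<in> carrier R"
  and R_smult: "c \<in> carrier K \<Longrightarrow> r \<in> carrier R \<Longrightarrow> c \<odot> r \<in> carrier R"
  using R.M.add.m_closed R.A.m_closed R.smult_closed sub_add sub_mult sub_smult by metis+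

lemma x_closed: "x \<in> carrier T"
  using skew unfolding skew_polynomial_ext_def by blast

lemma sigma_auto: "\<sigma> \<in> alg_auto K R" and delta_der: "skew_derivation K R \<sigma> \<delta>"
  using skew unfolding skew_polynomial_ext_def by blast+

lemma sigma_linear: "\<sigma> \<in> linear_map K R R"
  and sigma_bij: "bij_betw \<sigma> (carrier R) (carrier R)"
  and sigma_one: "\<sigma> \<one> = \<one>"
  using sigma_auto sub_one unfolding alg_auto_def alg_hom_def ring_hom_def by auto

lemma sigma_closed: "r \<in> carrier R \<Longrightarrow> \<sigma> r \<in> carrier R"
  using sigma_linear by (rule linear_closed)

lemma sigma_mult: "r \<in> carrier R \<Longrightarrow> s \<in> carrier R \<Longrightarrow> \<sigma> (r \<otimes> s) = \<sigma> r \<otimes> \<sigma> s"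
  using sigma_auto sub_mult sigma_closed unfolding alg_auto_def alg_hom_def ring_hom_def by auto

lemma delta_linear: "\<delta> \<in> linear_map K R R"
  using delta_der unfolding skew_derivation_def by blast

lemma sigma_add: "r \<in> carrier R \<Longrightarrow> s \<in> carrier R \<Longrightarrow> \<sigma> (r \<oplus> s) = \<sigma> r \<oplus> \<sigma> s"
  using linear_add[OF sigma_linear] by (simp add: sub_add sigma_closed)

lemma delta_closed: "r \<in> carrier R \<Longrightarrow> \<delta> r \<in> carrier R"
  using delta_linear by (rule linear_closed)

lemma sigma_smult: "c \<in> carrier K \<Longrightarrow> r \<in> carrier R \<Longrightarrow> \<sigma> (c \<odot> r) = c \<odot> \<sigma> r"
  using linear_smult[OF sigma_linear] by (simp add: sub_smult sigma_closed)

lemma delta_add: "r \<in> carrier R \<Longrightarrow> s \<in> carrier R \<Longrightarrow> \<delta> (r \<oplus> s) = \<delta> r \<oplus> \<delta> s"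
  using linear_add[OF delta_linear] by (simp add: sub_add delta_closed)

lemma delta_smult: "c \<in> carrier K \<Longrightarrow> r \<in> carrier R \<Longrightarrow> \<delta> (c \<odot> r) = c \<odot> \<delta> r"
  using linear_smult[OF delta_linear] by (simp add: sub_smult delta_closed)

lemma delta_mult:
  "r \<in> carrier R \<Longrightarrow> s \<in> carrier R \<Longrightarrow> \<delta> (r \<otimes> s) = \<sigma> r \<otimes> \<delta> s \<oplus> \<delta> r \<otimes> s"
  using delta_der sub_mult sub_add sigma_closed delta_closed R_mult unfolding skew_derivation_def by simp

lemma x_comm: "r \<in> carrier R \<Longrightarrow> x \<otimes> r = \<sigma> r \<otimes> x \<oplus> \<delta> r"
  using skew unfolding skew_polynomial_ext_def by blast

lemma sigma_zero: "\<sigma> \<zero> = \<zero>"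
  using additive_zero[OF R.M.abelian_group_axioms R.M.abelian_group_axioms linear_additive[OF sigma_linear]]
  by (simp add: sub_zero)

lemma sigma_inj: "r \<in> carrier R \<Longrightarrow> \<sigma> r = \<zero> \<Longrightarrow> r = \<zero>"
  using sigma_bij sigma_zero R_zero unfolding bij_betw_def inj_on_def by metis

abbreviation "expn \<equiv> expansion T (carrier R) (\<lambda>i. x [^] (i::nat))"

lemma R_sub: "carrier R \<subseteq> carrier T"
  using sub_carrier by blast

lemma expansion_ex1: "t \<in> carrier T \<Longrightarrow> \<exists>!c. expn t c"
  using skew x_closed unfolding skew_polynomial_ext_def
  by (subst T.A.expansion_iff[OF R_sub]) (auto simp: sub_zero)

definition \<pi> :: "nat \<Rightarrow> 'a \<Rightarrow> 'a"
  where "\<pi> j t = (THE c. expn t c) j"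

lemma expn_coef: assumes "t \<in> carrier T" shows "expn t (\<lambda>j. \<pi> j t)"
  using theI'[OF expansion_ex1[OF assms]] unfolding \<pi>_def .

lemma coef_eq: assumes "t \<in> carrier T" "expn t c" shows "\<pi> j t = c j"
  unfolding \<pi>_def using the1_equality[OF expansion_ex1[OF assms(1)], of c] assms(2) by simp

sublocale ore_ring T "carrier R" x \<pi> \<sigma> \<delta>
proof (intro ore_ring.intro ore_ring_axioms.intro)
  show "ring T" by (rule T.A.ring_axioms)
  show "\<And>j u. u \<in> carrier T \<Longrightarrow> \<pi> j u \<in> carrier R"
    using expn_coef unfolding expansion_def by blast
  have pow: "\<And>i. x [^] (i::nat) \<in> carrier T" using x_closed by simp
  show "\<pi> j (u \<oplus> v) = \<pi> j u \<oplus> \<pi> j v" if "u \<in> carrier T" "v \<in> carrier T" for j u v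
    using that coef_eq[OF _ T.A.expansion_add[OF R_sub pow R_add expn_coef expn_coef]] by simp
  show "\<pi> j (v \<otimes> u) = v \<otimes> \<pi> j u" if "v \<in> carrier R" "u \<in> carrier T" for j u v
    using that sub_carrier coef_eq[OF _ T.A.expansion_lmult[OF R_sub pow R_mult expn_coef]] by simp
  show "\<pi> j (u \<otimes> x) = (case j of 0 \<Rightarrow> \<zero> | Suc i \<Rightarrow> \<pi> i u)" if "u \<in> carrier T" for j u
    using that x_closed coef_eq[OF _ T.A.expansion_shift[OF R_sub x_closed R_zero expn_coef]] by simp
  show "\<pi> j v = (if j = 0 then v else \<zero>)" if "v \<in> carrier R" for j v
    using that sub_carrier coef_eq[OF _ T.A.expansion_const[OF R_sub x_closed R_zero]] by simp
  show "\<exists>n. \<forall>i>n. \<pi> i u = \<zero>" if "u \<in> carrier T" for u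
    using expn_coef[OF that] unfolding expansion_def by blast
  show "u = \<zero>" if u: "u \<in> carrier T" and z: "\<And>j. \<pi> j u = \<zero>" for u
  proof -
    obtain n where "u = (\<Oplus>i\<in>{..n}. \<pi> i u \<otimes> x [^] (i::nat))"
      using expn_coef[OF u] unfolding expansion_def by blast
    also have "\<dots> = \<zero>"
      unfolding z using x_closed by (intro T.M.add.finprod_one_eqI) simp
    finally show ?thesis .
  qed
qed (use R_sub R_zero R_one R_add R_mult x_closed sigma_closed delta_closed x_comm in auto)

lemma pi_smult:
  assumes "c \<in> carrier K" "t \<in> carrier T"
  shows "\<pi> j (c \<odot> t) = c \<odot> \<pi> j t"
proof -
  \<comment> \<open>A scalar acts as left multiplication by an element of R, so R-linearity of the
    coefficient maps gives K-linearity.\<close>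
  have e: "c \<odot> s = (c \<odot> \<one>) \<otimes> s" if "s \<in> carrier T" for s
    using assms that by (simp add: T.smult_mult_left)
  show ?thesis
    using p_lmult[OF R_smult[OF assms(1) R_one] assms(2)] unfolding e[OF assms(2)] e[OF p_car[OF assms(2)]] .
qed

lemma pi_linear: "\<pi> j \<in> linear_map K T T"
  by (rule linear_mapI) (simp_all add: p_car p_add pi_smult)

lemma pi_linear_R: "\<pi> j \<in> linear_map K T R"
  by (rule linear_mapI) (simp_all add: p_closed p_add pi_smult sub_add sub_smult)

text \<open>The unit u conjugates the automorphism: u x r = (u \<sigma>(r) v) u x + u \<delta>(r).
  Freeness over the powers of u x comes from \<open>triangular_basis\<close>, whose diagonal entries
  are units of R.\<close>

lemma change_of_variable:
  assumes u: "u \<in> carrier R" and v: "v \<in> carrier R" and uv: "u \<otimes> v = \<one>" "v \<otimes> u = \<one>"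
  shows "skew_polynomial_ext K R T (u \<otimes> x) (\<lambda>r. u \<otimes> \<sigma> r \<otimes> v) (\<lambda>r. u \<otimes> \<delta> r)"
proof -
  have uvT: "u \<in> carrier T" "v \<in> carrier T" using u v sub_carrier by auto
  have vu: "v \<otimes> (u \<otimes> t) = t" "u \<otimes> (v \<otimes> t) = t" if "t \<in> carrier T" for t
    using that uvT uv by (simp_all add: T.A.m_assoc[symmetric])
  have sT: "\<sigma> r \<in> carrier T" "\<delta> r \<in> carrier T" "r \<in> carrier T" if "r \<in> carrier R" for r
    using that sigma_closed delta_closed sub_carrier by auto
  define b where "b n = (u \<otimes> x) [^] (n::nat)" for n
  have ux: "u \<otimes> x \<in> carrier T" using uvT x_closed by simp
  have ux1: "deg_le 1 (u \<otimes> x)" "\<pi> 1 (u \<otimes> x) = u"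
    using deg_le_mult_pow[OF deg_le_A[OF u], of 0 1] p_mult_pow[of u 1 1] uvT x_closed u
    by (simp_all add: p_A)
  have sig: "(\<sigma> ^^ n) u \<otimes> (\<sigma> ^^ n) v = \<one>" "(\<sigma> ^^ n) v \<otimes> (\<sigma> ^^ n) u = \<one>" for n
    using uv by (induction n)
      (simp_all add: sigma_mult[symmetric] tau_pow_closed u v sigma_one)
  \<comment> \<open>The diagonal entry is u \<sigma>(u) ... \<sigma>^(n-1)(u); its inverse is the
    product of the \<sigma>^i(v) in the reverse order, built up by multiplying with the next power
    on the left.\<close>
  have tri: "deg_le n (b n) \<and> (\<exists>k\<in>carrier R. k \<otimes> \<pi> n (b n) = \<one> \<and> \<pi> n (b n) \<otimes> k = \<one>)" for n
  proof (induction n)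
    case 0
    then show ?case using deg_le_A[OF R_one] p_A[OF R_one] R_one
      by (auto simp: b_def intro!: bexI[of _ \<one>])
  next
    case (Suc n)
    then obtain k where k: "k \<in> carrier R" "k \<otimes> \<pi> n (b n) = \<one>" "\<pi> n (b n) \<otimes> k = \<one>" by blast
    have d: "deg_le (Suc n) (b (Suc n))" "\<pi> (Suc n) (b (Suc n)) = \<pi> n (b n) \<otimes> (\<sigma> ^^ n) u"
      using deg_mult[OF ux1(1), of n "b n"] Suc ux1(2) unfolding b_def by simp_all
    have s: "(\<sigma> ^^ n) u \<in> carrier R" "(\<sigma> ^^ n) v \<in> carrier R" using tau_pow_closed u v by auto
    have bn: "\<pi> n (b n) \<in> carrier R" using Suc deg_le_closed p_closed by blast
    note c = sT(3)[OF k(1)] sT(3)[OF s(1)] sT(3)[OF s(2)] sT(3)[OF bn]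
    have "((\<sigma> ^^ n) v \<otimes> k) \<otimes> (\<pi> n (b n) \<otimes> (\<sigma> ^^ n) u) = (\<sigma> ^^ n) v \<otimes> (k \<otimes> \<pi> n (b n)) \<otimes> (\<sigma> ^^ n) u"
      using c by (simp add: T.A.m_assoc)
    moreover have "(\<pi> n (b n) \<otimes> (\<sigma> ^^ n) u) \<otimes> ((\<sigma> ^^ n) v \<otimes> k) = \<pi> n (b n) \<otimes> ((\<sigma> ^^ n) u \<otimes> (\<sigma> ^^ n) v) \<otimes> k"
      using c by (simp add: T.A.m_assoc)
    ultimately show ?case
      using d k s c sig[of n] R_mult by (intro conjI bexI[of _ "(\<sigma> ^^ n) v \<otimes> k"]) simp_all
  qed
  then obtain k where k: "\<And>n. k n \<in> carrier R" "\<And>n. k n \<otimes> \<pi> n (b n) = \<one>" "\<And>n. \<pi> n (b n) \<otimes> k n = \<one>"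
    by metis
  have "\<exists>!c. expansion T (carrier R) b t c" if "t \<in> carrier T" for t
    by (rule triangular_basis[of b k]) (use tri k that in auto)
  then have basis: "\<exists>!c :: nat \<Rightarrow> 'a. (\<forall>i. c i \<in> carrier R) \<and> finite {i. c i \<noteq> \<zero>\<^bsub>R\<^esub>} \<and>
      t = finsum T (\<lambda>i. c i \<otimes> (u \<otimes> x) [^] i) {i. c i \<noteq> \<zero>\<^bsub>R\<^esub>}" if "t \<in> carrier T" for t
  proof -
    have "expansion T (carrier R) b t = (\<lambda>c. (\<forall>i. c i \<in> carrier R) \<and> finite {i. c i \<noteq> \<zero>} \<and>
        t = finsum T (\<lambda>i. c i \<otimes> b i) {i. c i \<noteq> \<zero>})"
      by (rule ext, rule T.A.expansion_iff[OF R_sub]) (use ux in \<open>simp add: b_def\<close>)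
    with \<open>\<And>t. t \<in> carrier T \<Longrightarrow> \<exists>!c. expansion T (carrier R) b t c\<close>[OF that]
    show ?thesis unfolding sub_zero b_def by (simp only:)
  qed
  have bij_conj: "bij_betw (\<lambda>r. u \<otimes> r \<otimes> v) (carrier R) (carrier R)"
    by (rule bij_betw_byWitness[where f' = "\<lambda>r. v \<otimes> r \<otimes> u"])
      (use u v uvT sT uv vu R_mult in \<open>auto simp: T.A.m_assoc\<close>)
  have "(\<lambda>r. u \<otimes> \<sigma> r \<otimes> v) \<in> alg_auto K R"
    unfolding alg_auto_def alg_hom_def
  proof (intro CollectI conjI IntI)
    show "bij_betw (\<lambda>r. u \<otimes> \<sigma> r \<otimes> v) (carrier R) (carrier R)"
      using bij_betw_trans[OF sigma_bij bij_conj] by (simp add: comp_def)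
    show "(\<lambda>r. u \<otimes> \<sigma> r \<otimes> v) \<in> ring_hom R R"
      by (rule ring_hom_memI)
        (use u v uvT sT uv vu in \<open>simp_all add: sub_mult sub_add sub_one R_mult sigma_closed sigma_one
          sigma_mult sigma_add T.A.m_assoc T.A.l_distr T.A.r_distr R_add\<close>)
    show "(\<lambda>r. u \<otimes> \<sigma> r \<otimes> v) \<in> linear_map K R R"
      by (rule linear_mapI)
        (use u v uvT sT in \<open>simp_all add: sub_add sub_smult R_mult sigma_closed R_smult R_add
          sigma_add sigma_smult
          T.smult_mult_left T.smult_mult_right T.A.l_distr T.A.r_distr\<close>)
  qed
  moreover have "skew_derivation K R (\<lambda>r. u \<otimes> \<sigma> r \<otimes> v) (\<lambda>r. u \<otimes> \<delta> r)"
    unfolding skew_derivation_def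
  proof (intro conjI ballI)
    show "(\<lambda>r. u \<otimes> \<delta> r) \<in> linear_map K R R"
      by (rule linear_mapI)
        (use u uvT sT in \<open>simp_all add: sub_add sub_smult R_mult delta_closed R_smult R_add
          delta_add delta_smult T.smult_mult_right T.A.r_distr\<close>)
    fix r s assume "r \<in> carrier R" "s \<in> carrier R"
    then show "u \<otimes> \<delta> (r \<otimes>\<^bsub>R\<^esub> s) = (u \<otimes> \<sigma> r \<otimes> v) \<otimes>\<^bsub>R\<^esub> (u \<otimes> \<delta> s) \<oplus>\<^bsub>R\<^esub> (u \<otimes> \<delta> r) \<otimes>\<^bsub>R\<^esub> s"
      using u v uvT sT vu by (simp add: sub_mult sub_add R_mult sigma_closed delta_closed delta_mult
          T.A.m_assoc T.A.r_distr)
  qed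
  moreover have "(u \<otimes> x) \<otimes> r = (u \<otimes> \<sigma> r \<otimes> v) \<otimes> (u \<otimes> x) \<oplus> u \<otimes> \<delta> r" if "r \<in> carrier R" for r
    using that uvT sT[OF that] vu x_closed by (simp add: T.A.m_assoc x_comm T.A.r_distr)
  ultimately show ?thesis
    unfolding skew_polynomial_ext_def
    using basis ux incl_hom R.assoc_algebra_axioms T.assoc_algebra_axioms by blast
qed

end

section \<open>The tensor square of an Ore extension\<close>

lemma (in ring) additive_finsum:
  assumes "ring S" "additive S R f" "\<And>i. i \<in> I \<Longrightarrow> g i \<in> carrier S" "finite I"
  shows "f (\<Oplus>\<^bsub>S\<^esub>i\<in>I. g i) = (\<Oplus>i\<in>I. f (g i))"
  using assms(4,3)
proof (induction I rule: finite_induct)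
  case empty
  interpret S: ring S by fact
  show ?case using additive_zero[OF S.abelian_group_axioms abelian_group_axioms assms(2)] by simp
next
  case (insert i I)
  interpret S: ring S by fact
  have "f (g i \<oplus>\<^bsub>S\<^esub> (\<Oplus>\<^bsub>S\<^esub>j\<in>I. g j)) = f (g i) \<oplus> f (\<Oplus>\<^bsub>S\<^esub>j\<in>I. g j)"
    by (rule additive_add[OF assms(2)]) (use insert in auto)
  then show ?case
    using insert additive_closed[OF assms(2)] by (simp add: Pi_iff)
qed

text \<open>An involutive ring automorphism carries one presentation as an Ore extension to another.
  With the flip of the two tensor factors for s, the extension in 1 \<otimes> x gives the one in x
  \<otimes> 1 without a second proof.\<close>

lemma (in ore_ring) transport:
  assumes s: "additive E E s" "\<And>u v. u \<in> carrier E \<Longrightarrow> v \<in> carrier E \<Longrightarrow> s (u \<otimes> v) = s u \<otimes> s v"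
    "s \<one> = \<one>" "\<And>u. u \<in> carrier E \<Longrightarrow> s (s u) = u"
  shows "ore_ring E {u \<in> carrier E. s u \<in> A} (s Y) (\<lambda>j u. s (p j (s u)))
    (\<lambda>v. s (\<tau> (s v))) (\<lambda>v. s (\<delta> (s v)))"
proof (intro ore_ring.intro ore_ring_axioms.intro)
  have z: "s \<zero> = \<zero>" using additive_zero[OF abelian_group_axioms abelian_group_axioms s(1)] .
  have c: "\<And>u. u \<in> carrier E \<Longrightarrow> s u \<in> carrier E" using additive_closed[OF s(1)] .
  have a: "\<And>u v. u \<in> carrier E \<Longrightarrow> v \<in> carrier E \<Longrightarrow> s (u \<oplus> v) = s u \<oplus> s v"
    using additive_add[OF s(1)] .
  note cl = c p_car p_closed A_car \<tau>_closed \<delta>_closed Y_closed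
  show "ring E" by (rule ring_axioms)
  show "\<exists>n. \<forall>i>n. s (p i (s u)) = \<zero>" if "u \<in> carrier E" for u
    using p_bounded[OF c[OF that]] z by metis
  show "u = \<zero>" if u: "u \<in> carrier E" and e: "\<And>j. s (p j (s u)) = \<zero>" for u
  proof -
    have "p j (s u) = \<zero>" for j using e[of j] s(4)[OF p_car[OF c[OF u]], of j] z by simp
    then have "s u = \<zero>" using p_separates[OF c[OF u]] by blast
    then show ?thesis using s(4)[OF u] z by simp
  qed
  show "s (p j (s v)) = (if j = 0 then v else \<zero>)" if "v \<in> {u \<in> carrier E. s u \<in> A}" for j v
    using that p_A[of "s v" j] s(4) z by auto
  show "s Y \<otimes> v = s (\<tau> (s v)) \<otimes> s Y \<oplus> s (\<delta> (s v))" if "v \<in> {u \<in> carrier E. s u \<in> A}" for v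
  proof -
    have "s (Y \<otimes> s v) = s (\<tau> (s v) \<otimes> Y \<oplus> \<delta> (s v))" using that Y_comm by simp
    then show ?thesis using that cl by (simp add: s a)
  qed
  show "s (p j (s (u \<otimes> s Y))) = (case j of 0 \<Rightarrow> \<zero> | Suc i \<Rightarrow> s (p i (s u)))" if "u \<in> carrier E" for j u
    using that cl by (cases j) (simp_all add: s p_Y z)
  show "s (p j (s (v \<otimes> u))) = v \<otimes> s (p j (s u))" if "v \<in> {u \<in> carrier E. s u \<in> A}" "u \<in> carrier E" for j u v
    using that cl by (simp add: s p_lmult)
qed (use A_zero A_one A_add A_mult additive_zero[OF abelian_group_axioms abelian_group_axioms s(1)] s
    additive_closed[OF s(1)] additive_add[OF s(1)] p_car p_closed A_car \<tau>_closed \<delta>_closed Y_closed p_add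
    in \<open>auto simp: p_add\<close>)

sublocale skew_ext \<subseteq> TT: tensor_alg K T T
  by (rule tensor_alg.intro) (rule T.assoc_algebra_axioms)+

sublocale skew_ext \<subseteq> RR: tensor_alg K R R
  by (rule tensor_alg.intro) (rule R.assoc_algebra_axioms)+

sublocale skew_ext \<subseteq> TP: tensor_pair K T T T T
  by (intro tensor_pair.intro TT.tensor_product_axioms)

sublocale skew_ext \<subseteq> TRP: tensor_pair K T T R R
  by (intro tensor_pair.intro TT.tensor_product_axioms RR.tensor_product_axioms)

sublocale skew_ext \<subseteq> RTP: tensor_pair K R R T T
  by (intro tensor_pair.intro TT.tensor_product_axioms RR.tensor_product_axioms)

context skew_ext
begin

abbreviation "E \<equiv> tensor_algebra K T T"
abbreviation tens (infixl \<open>\<otimes>\<^sub>t\<close> 75) where "a \<otimes>\<^sub>t b \<equiv> tensor K T T a b"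

abbreviation times_E (infixl \<open>\<otimes>\<^sub>E\<close> 70) where "u \<otimes>\<^sub>E v \<equiv> u \<otimes>\<^bsub>E\<^esub> v"
abbreviation plus_E (infixl \<open>\<oplus>\<^sub>E\<close> 65) where "u \<oplus>\<^sub>E v \<equiv> u \<oplus>\<^bsub>E\<^esub> v"

abbreviation one_E (\<open>\<one>\<^sub>E\<close>) where "\<one>\<^sub>E \<equiv> \<one>\<^bsub>E\<^esub>"
abbreviation zero_E (\<open>\<zero>\<^sub>E\<close>) where "\<zero>\<^sub>E \<equiv> \<zero>\<^bsub>E\<^esub>"

lemma ring_E: "ring E" by (rule TT.ring_E)

sublocale E: ring E by (rule ring_E)

lemmas E_simps = TT.tensor_closed TT.tensor_mult TT.tensor_add_left TT.tensor_add_right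

definition "rmap f = tensor_map K T T (\<lambda>y. y) f"

lemma rmap_tensor:
  "f \<in> linear_map K T T \<Longrightarrow> a \<in> carrier T \<Longrightarrow> b \<in> carrier T \<Longrightarrow> rmap f (a \<otimes>\<^sub>t b) = a \<otimes>\<^sub>t f b"
  unfolding rmap_def by (rule TP.map_tensor[OF linear_id])

lemma rmap_additive: "f \<in> linear_map K T T \<Longrightarrow> additive E E (rmap f)"
  unfolding rmap_def by (rule TP.map_additive[OF linear_id])

lemmas rmap_closed = additive_closed[OF rmap_additive]
lemmas rmap_add = additive_add[OF rmap_additive]
lemmas rmap_zero = additive_zero[OF TT.abelian_group_E TT.abelian_group_E rmap_additive]

lemma rmap_comp:
  assumes "f \<in> linear_map K T T" "g \<in> linear_map K T T" "h \<in> linear_map K T T" "u \<in> carrier E"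
    and "\<And>t. t \<in> carrier T \<Longrightarrow> f (g t) = h t"
  shows "rmap f (rmap g u) = rmap h u"
  using assms(4) by (induction u rule: TT.tensor_induct)
    (simp_all add: assms(1-3,5) rmap_tensor rmap_add rmap_closed linear_closed[OF assms(2)])

definition "swap = tensor_lift (add_monoid E) (\<lambda>a b. b \<otimes>\<^sub>t a)"

lemma balanced_swap: "balanced K T T (add_monoid E) (\<lambda>a b. b \<otimes>\<^sub>t a)"
  by (rule balanced_addI[OF TT.abelian_group_E]) (simp_all add: E_simps TT.tensor_smult)

lemma swap_tensor: "a \<in> carrier T \<Longrightarrow> b \<in> carrier T \<Longrightarrow> swap (a \<otimes>\<^sub>t b) = b \<otimes>\<^sub>t a"
  unfolding swap_def by (rule TT.lift_tensor[OF balanced_swap])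

lemma swap_additive: "additive E E swap"
  unfolding swap_def by (rule TT.lift_additive[OF balanced_swap])

lemmas swap_closed = additive_closed[OF swap_additive]
lemmas swap_add = additive_add[OF swap_additive]

lemma swap_swap: "u \<in> carrier E \<Longrightarrow> swap (swap u) = u"
  by (induction u rule: TT.tensor_induct) (simp_all add: swap_tensor swap_add swap_closed)

lemma swap_mult:
  assumes "u \<in> carrier E" "v \<in> carrier E"
  shows "swap (u \<otimes>\<^sub>E v) = swap u \<otimes>\<^sub>E swap v"
  using assms
proof (induction u rule: TT.tensor_induct)
  case (pure a b)
  from pure(3,1,2) show ?case
    by (induction v rule: TT.tensor_induct)
      (simp_all add: swap_tensor swap_add swap_closed E_simps E.r_distr)
qed (simp_all add: swap_add swap_closed E.l_distr)

text \<open>The conjugated form is chosen over a direct \<open>tensor_map\<close> because it makes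
  the extension in the first factor a literal instance of \<open>transport\<close>.\<close>

definition "lmap f u = swap (rmap f (swap u))"

lemma lmap_tensor:
  "f \<in> linear_map K T T \<Longrightarrow> a \<in> carrier T \<Longrightarrow> b \<in> carrier T \<Longrightarrow> lmap f (a \<otimes>\<^sub>t b) = f a \<otimes>\<^sub>t b"
  by (simp add: lmap_def swap_tensor rmap_tensor linear_closed)

lemma lmap_additive: "f \<in> linear_map K T T \<Longrightarrow> additive E E (lmap f)"
  unfolding lmap_def by (rule additiveI) (simp_all add: swap_add swap_closed rmap_add rmap_closed)

lemmas lmap_closed = additive_closed[OF lmap_additive]
lemmas lmap_add = additive_add[OF lmap_additive]
lemmas lmap_zero = additive_zero[OF TT.abelian_group_E TT.abelian_group_E lmap_additive]

lemma lmap_rmap: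
  assumes "f \<in> linear_map K T T" "g \<in> linear_map K T T" "u \<in> carrier E"
  shows "lmap f (rmap g u) = rmap g (lmap f u)"
  using assms(3) by (induction u rule: TT.tensor_induct)
    (simp_all add: assms(1,2) rmap_tensor lmap_tensor rmap_add lmap_add rmap_closed lmap_closed
      linear_closed[OF assms(1)] linear_closed[OF assms(2)])

lemma lmap_comp:
  assumes "f \<in> linear_map K T T" "g \<in> linear_map K T T" "h \<in> linear_map K T T" "u \<in> carrier E"
    and "\<And>t. t \<in> carrier T \<Longrightarrow> f (g t) = h t"
  shows "lmap f (lmap g u) = lmap h u"
  using assms(4) by (induction u rule: TT.tensor_induct)
    (simp_all add: assms(1-3,5) lmap_tensor lmap_add lmap_closed linear_closed[OF assms(2)])

text \<open>\<open>TR\<close> and \<open>RT\<close> are the images of \<open>T \<otimes> R\<close> and \<open>R \<otimes> T\<close> in \<open>T \<otimes> T\<close>.\<close>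

definition "TR = {u \<in> carrier E. rmap (\<pi> 0) u = u}"
definition "RT = {u \<in> carrier E. swap u \<in> TR}"

text \<open>\<open>rmap\<close> and \<open>lmap\<close> expect linear maps on all of T, whereas
  \<sigma> and \<delta> are controlled on R only. Composing with the retraction
  \<open>\<pi> 0\<close> extends them without changing their values on R.\<close>

definition "sig t = \<sigma> (\<pi> 0 t)"
definition "del t = \<delta> (\<pi> 0 t)"

lemma sig_linear: "sig \<in> linear_map K T T" and del_linear: "del \<in> linear_map K T T"
  unfolding sig_def[abs_def] del_def[abs_def]
  using linear_comp[OF pi_linear_R linear_comp[OF sigma_linear incl_linear]]
    linear_comp[OF pi_linear_R linear_comp[OF delta_linear incl_linear]] by simp_all

definition R_linear :: "('a \<Rightarrow> 'a) \<Rightarrow> bool"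
  where "R_linear f \<longleftrightarrow> f \<in> linear_map K T T \<and>
    (\<forall>r\<in>carrier R. \<forall>t\<in>carrier T. f (r \<otimes> t) = r \<otimes> f t)"

lemma pi_R_linear: "R_linear (\<pi> j)"
  unfolding R_linear_def using pi_linear p_lmult by blast

lemma rmap_lmult:
  assumes f: "R_linear f" and v: "v \<in> TR" and u: "u \<in> carrier E"
  shows "rmap f (v \<otimes>\<^sub>E u) = v \<otimes>\<^sub>E rmap f u"
proof -
  have l: "f \<in> linear_map K T T" using f unfolding R_linear_def by blast
  have m: "f (r \<otimes> t) = r \<otimes> f t" if "r \<in> carrier R" "t \<in> carrier T" for r t
    using f that unfolding R_linear_def by blast
  \<comment> \<open>Elements of \<open>TR\<close> are written as images of the projection. The
    induction can then run over all of T \<otimes> T, and the second component of each pure tensor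
    lies in R automatically.\<close>
  have "rmap f (rmap (\<pi> 0) v \<otimes>\<^sub>E u) = rmap (\<pi> 0) v \<otimes>\<^sub>E rmap f u" if "v \<in> carrier E" for v
    using that u
  proof (induction v rule: TT.tensor_induct)
    case (pure a b)
    from pure(3,1,2) show ?case
      by (induction u rule: TT.tensor_induct)
        (simp_all add: l m linear_closed[OF l] pi_linear rmap_tensor rmap_add rmap_closed E_simps
          E.r_distr p_car p_closed)
  qed (simp_all add: l pi_linear rmap_add rmap_closed E.l_distr)
  from this[of v] v show ?thesis unfolding TR_def by simp
qed

lemma one_tensor_pow: "t \<in> carrier T \<Longrightarrow> (\<one> \<otimes>\<^sub>t t) [^]\<^bsub>E\<^esub> (n::nat) = \<one> \<otimes>\<^sub>t (t [^] n)"
  by (induction n) (simp_all add: TT.one_E E_simps)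

text \<open>The expansion is claimed for all sufficiently large n, since the bounds of two summands
  have to be merged when tensors are added.\<close>

lemma r_expand:
  assumes "u \<in> carrier E"
  shows "\<exists>N. \<forall>n\<ge>N. u = (\<Oplus>\<^bsub>E\<^esub>j\<in>{..n}. rmap (\<pi> j) u \<otimes>\<^sub>E (\<one> \<otimes>\<^sub>t x) [^]\<^bsub>E\<^esub> j)"
  using assms
proof (induction u rule: TT.tensor_induct)
  let ?s = "\<lambda>n u. \<Oplus>\<^bsub>E\<^esub>j\<in>{..n}. rmap (\<pi> j) u \<otimes>\<^sub>E (\<one> \<otimes>\<^sub>t x) [^]\<^bsub>E\<^esub> j"
  case (pure a b)
  obtain N where N: "deg_le N b" using p_bounded[OF pure(2)] pure(2) unfolding deg_le_def by blast
  have add: "additive T E (\<lambda>b. a \<otimes>\<^sub>t b)"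
    by (rule additiveI) (simp_all add: pure E_simps)
  have "a \<otimes>\<^sub>t b = ?s n (a \<otimes>\<^sub>t b)" if "n \<ge> N" for n
  proof -
    have "b = (\<Oplus>j\<in>{..n}. \<pi> j b \<otimes> x [^] j)" by (rule eq_sum[OF deg_le_mono[OF N that]])
    then have "a \<otimes>\<^sub>t b = a \<otimes>\<^sub>t (\<Oplus>j\<in>{..n}. \<pi> j b \<otimes> x [^] j)" by (rule arg_cong)
    also have "\<dots> = (\<Oplus>\<^bsub>E\<^esub>j\<in>{..n}. a \<otimes>\<^sub>t (\<pi> j b \<otimes> x [^] j))"
      by (rule E.additive_finsum[OF T.A.ring_axioms add]) (simp_all add: pure p_car x_closed)
    also have "\<dots> = ?s n (a \<otimes>\<^sub>t b)"
      by (rule TT.E.finsum_cong')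
        (simp_all add: pure p_car x_closed pi_linear rmap_tensor one_tensor_pow E_simps)
    finally show ?thesis .
  qed
  then show ?case by blast
next
  let ?s = "\<lambda>n u. \<Oplus>\<^bsub>E\<^esub>j\<in>{..n}. rmap (\<pi> j) u \<otimes>\<^sub>E (\<one> \<otimes>\<^sub>t x) [^]\<^bsub>E\<^esub> j"
  case (add u v)
  obtain M N where M: "\<forall>n\<ge>M. u = ?s n u"
    and N: "\<forall>n\<ge>N. v = ?s n v"
    using add by blast
  have "u \<oplus>\<^sub>E v = ?s n (u \<oplus>\<^sub>E v)"
    if "n \<ge> max M N" for n
  proof -
    have c: "rmap (\<pi> j) u \<in> carrier E" "rmap (\<pi> j) v \<in> carrier E" "(\<one> \<otimes>\<^sub>t x) [^]\<^bsub>E\<^esub> j \<in> carrier E" for j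
      using add by (simp_all add: pi_linear rmap_closed x_closed TT.tensor_closed)
    have "(?s n (u \<oplus>\<^sub>E v)) =
      (\<Oplus>\<^bsub>E\<^esub>j\<in>{..n}. rmap (\<pi> j) u \<otimes>\<^sub>E (\<one> \<otimes>\<^sub>t x) [^]\<^bsub>E\<^esub> j \<oplus>\<^sub>E rmap (\<pi> j) v \<otimes>\<^sub>E (\<one> \<otimes>\<^sub>t x) [^]\<^bsub>E\<^esub> j)"
      using add c by (intro TT.E.finsum_cong') (auto simp: pi_linear rmap_add E.l_distr)
    also have "\<dots> = ?s n u \<oplus>\<^sub>E
      (?s n v)"
      by (rule TT.E.finsum_addf) (use c in auto)
    also have "\<dots> = u \<oplus>\<^sub>E v"
      using M[rule_format, of n] N[rule_format, of n] that by simp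
    finally show ?thesis by simp
  qed
  then show ?case by blast
qed

lemma right_ore: "ore_ring E TR (\<one> \<otimes>\<^sub>t x) (\<lambda>j. rmap (\<pi> j)) (rmap sig) (rmap del)"
proof (intro ore_ring.intro ore_ring_axioms.intro)
  note [simp] = pi_linear sig_linear del_linear x_closed p_car
  show "ring E" by (rule ring_E)
  show "TR \<subseteq> carrier E" unfolding TR_def by blast
  show "\<zero>\<^sub>E \<in> TR" unfolding TR_def using rmap_zero by simp
  show "\<one>\<^sub>E \<in> TR" unfolding TR_def by (simp add: TT.one_E rmap_tensor p_A R_one TT.tensor_closed)
  show "u \<oplus>\<^sub>E v \<in> TR" if "u \<in> TR" "v \<in> TR" for u v
    using that unfolding TR_def by (simp add: rmap_add)
  show "u \<otimes>\<^sub>E v \<in> TR" if "u \<in> TR" "v \<in> TR" for u v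
    using that rmap_lmult[OF pi_R_linear, of u v 0] unfolding TR_def by simp
  show "\<one> \<otimes>\<^sub>t x \<in> carrier E" by (simp add: TT.tensor_closed)
  show "rmap (\<pi> j) u \<in> TR" if "u \<in> carrier E" for j u
    unfolding TR_def using that rmap_comp[of "\<pi> 0" "\<pi> j" "\<pi> j" u] by (simp add: rmap_closed p_A p_closed)
  show "rmap (\<pi> j) (u \<oplus>\<^sub>E v) = rmap (\<pi> j) u \<oplus>\<^sub>E rmap (\<pi> j) v"
    if "u \<in> carrier E" "v \<in> carrier E" for j u v using that by (simp add: rmap_add)
  show "rmap (\<pi> j) (v \<otimes>\<^sub>E u) = v \<otimes>\<^sub>E rmap (\<pi> j) u" if "v \<in> TR" "u \<in> carrier E" for j u v
    using that rmap_lmult[OF pi_R_linear] by simp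
  show "rmap (\<pi> j) (u \<otimes>\<^sub>E (\<one> \<otimes>\<^sub>t x)) = (case j of 0 \<Rightarrow> \<zero>\<^sub>E | Suc i \<Rightarrow> rmap (\<pi> i) u)"
    if "u \<in> carrier E" for j u
    using that
    by (induction u rule: TT.tensor_induct; cases j)
      (simp_all add: rmap_tensor rmap_add rmap_closed E_simps E.l_distr p_Y TT.tensor_zero_right)
  show "rmap (\<pi> j) v = (if j = 0 then v else \<zero>\<^sub>E)" if "v \<in> TR" for j v
  proof (cases "j = 0")
    case False
    have "rmap (\<pi> j) (rmap (\<pi> 0) u) = \<zero>\<^sub>E" if "u \<in> carrier E" for u
      using that False by (induction u rule: TT.tensor_induct)
        (simp_all add: rmap_tensor rmap_add rmap_closed p_A p_closed TT.tensor_zero_right)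
    then show ?thesis using that False unfolding TR_def by force
  qed (use that in \<open>simp add: TR_def\<close>)
  show "\<exists>n. \<forall>i>n. rmap (\<pi> i) u = \<zero>\<^sub>E" if "u \<in> carrier E" for u
    using that
  proof (induction u rule: TT.tensor_induct)
    case (pure a b)
    then obtain n where "\<forall>i>n. \<pi> i b = \<zero>" using p_bounded by blast
    then show ?case using pure by (intro exI[of _ n]) (simp add: rmap_tensor TT.tensor_zero_right)
  next
    case (add u v)
    then obtain m n where "\<forall>i>m. rmap (\<pi> i) u = \<zero>\<^sub>E" "\<forall>i>n. rmap (\<pi> i) v = \<zero>\<^sub>E" by blast
    then show ?case using add by (intro exI[of _ "max m n"]) (simp add: rmap_add)
  qed
  show "u = \<zero>\<^sub>E" if u: "u \<in> carrier E" and z: "\<And>j. rmap (\<pi> j) u = \<zero>\<^sub>E" for u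
  proof -
    obtain n where "u = (\<Oplus>\<^bsub>E\<^esub>j\<in>{..n}. rmap (\<pi> j) u \<otimes>\<^sub>E (\<one> \<otimes>\<^sub>t x) [^]\<^bsub>E\<^esub> j)"
      using r_expand[OF u] by blast
    also have "\<dots> = \<zero>\<^sub>E"
      unfolding z by (intro TT.E.add.finprod_one_eqI) (simp add: TT.tensor_closed)
    finally show ?thesis .
  qed
  show "rmap sig v \<in> TR" if "v \<in> TR" for v
    unfolding TR_def using that[unfolded TR_def] rmap_comp[of "\<pi> 0" sig sig v]
    by (simp add: rmap_closed p_A p_closed sig_def sigma_closed)
  show "rmap del v \<in> TR" if "v \<in> TR" for v
    unfolding TR_def using that[unfolded TR_def] rmap_comp[of "\<pi> 0" del del v]
    by (simp add: rmap_closed p_A p_closed del_def delta_closed)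
  show "(\<one> \<otimes>\<^sub>t x) \<otimes>\<^sub>E v = rmap sig v \<otimes>\<^sub>E (\<one> \<otimes>\<^sub>t x) \<oplus>\<^sub>E rmap del v" if "v \<in> TR" for v
  proof -
    have "(\<one> \<otimes>\<^sub>t x) \<otimes>\<^sub>E rmap (\<pi> 0) u = rmap sig u \<otimes>\<^sub>E (\<one> \<otimes>\<^sub>t x) \<oplus>\<^sub>E rmap del u" if "u \<in> carrier E" for u
      using that
    proof (induction u rule: TT.tensor_induct)
      case (pure a b)
      then show ?case
        using x_comm[OF p_closed[OF pure(2), of 0]] linear_closed[OF sig_linear pure(2)]
          linear_closed[OF del_linear pure(2)]
        by (simp add: rmap_tensor E_simps) (simp add: sig_def del_def TT.tensor_add_right[symmetric])
    next
      case (add u v)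
      then show ?case
        by (simp add: rmap_add rmap_closed TT.tensor_closed E.r_distr E.l_distr TT.E.a_ac)
    qed
    then show ?thesis using that unfolding TR_def by force
  qed
qed

end

sublocale skew_ext \<subseteq> right: ore_ring "tensor_algebra K T T" TR "\<one> \<otimes>\<^sub>t x" "\<lambda>j. rmap (\<pi> j)" "rmap sig" "rmap del"
  by (rule right_ore)

lemma (in skew_ext) left_ore:
  "ore_ring E RT (x \<otimes>\<^sub>t \<one>) (\<lambda>j. lmap (\<pi> j)) (lmap sig) (lmap del)"
proof -
  have "swap \<one>\<^sub>E = \<one>\<^sub>E" "swap (\<one> \<otimes>\<^sub>t x) = x \<otimes>\<^sub>t \<one>"
    by (simp_all add: TT.one_E swap_tensor x_closed)
  then have one: "swap \<one>\<^sub>E = \<one>\<^sub>E" and var: "swap (\<one> \<otimes>\<^sub>t x) = x \<otimes>\<^sub>t \<one>" by blast+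
  show ?thesis
    unfolding RT_def lmap_def[abs_def] var[symmetric]
    by (rule right.transport[OF swap_additive swap_mult one swap_swap])
qed

sublocale skew_ext \<subseteq> left: ore_ring "tensor_algebra K T T" RT "x \<otimes>\<^sub>t \<one>" "\<lambda>j. lmap (\<pi> j)" "lmap sig" "lmap del"
  by (rule left_ore)

context skew_ext
begin

lemma RT_iff: "u \<in> RT \<longleftrightarrow> u \<in> carrier E \<and> lmap (\<pi> 0) u = u"
proof
  assume "u \<in> RT"
  then have u: "u \<in> carrier E" "rmap (\<pi> 0) (swap u) = swap u" unfolding RT_def TR_def by auto
  then show "u \<in> carrier E \<and> lmap (\<pi> 0) u = u" by (simp add: lmap_def swap_swap)
next
  assume u: "u \<in> carrier E \<and> lmap (\<pi> 0) u = u"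
  then have "swap (lmap (\<pi> 0) u) = swap u" by simp
  then show "u \<in> RT"
    using u rmap_closed[OF pi_linear, of "swap u" 0] unfolding RT_def TR_def
    by (simp add: lmap_def swap_swap swap_closed)
qed

lemma TR_iff: "u \<in> TR \<longleftrightarrow> u \<in> carrier E \<and> rmap (\<pi> 0) u = u"
  unfolding TR_def by blast

lemma lmap_TR: "f \<in> linear_map K T T \<Longrightarrow> u \<in> TR \<Longrightarrow> lmap f u \<in> TR"
  unfolding TR_iff using lmap_rmap[of f "\<pi> 0" u] pi_linear lmap_closed by simp

lemma tensor_TR: "a \<in> carrier T \<Longrightarrow> r \<in> carrier R \<Longrightarrow> a \<otimes>\<^sub>t r \<in> TR"
  unfolding TR_iff by (simp add: pi_linear rmap_tensor p_A sub_carrier TT.tensor_closed)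

lemma tensor_RT: "r \<in> carrier R \<Longrightarrow> a \<in> carrier T \<Longrightarrow> r \<otimes>\<^sub>t a \<in> RT"
  unfolding RT_iff by (simp add: pi_linear lmap_tensor p_A sub_carrier TT.tensor_closed)

lemma lmap_lmult:
  assumes f: "R_linear f" and v: "v \<in> RT" and u: "u \<in> carrier E"
  shows "lmap f (v \<otimes>\<^sub>E u) = v \<otimes>\<^sub>E lmap f u"
proof -
  have l: "f \<in> linear_map K T T" using f unfolding R_linear_def by blast
  have v': "v \<in> carrier E" "swap v \<in> TR" using v unfolding RT_def by auto
  then have "rmap f (swap v \<otimes>\<^sub>E swap u) = swap v \<otimes>\<^sub>E rmap f (swap u)"
    using u by (intro rmap_lmult f swap_closed) auto
  then show ?thesis
    using u v' l by (simp add: lmap_def swap_mult swap_closed rmap_closed swap_swap)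
qed

lemma tensor_one_pow: "t \<in> carrier T \<Longrightarrow> (t \<otimes>\<^sub>t \<one>) [^]\<^bsub>E\<^esub> (n::nat) = (t [^] n) \<otimes>\<^sub>t \<one>"
  by (induction n) (simp_all add: TT.one_E E_simps)

text \<open>Expand u in powers of x \<otimes> 1: an R-linear f acts only on these powers, and if it
  kills all lower ones, then only the leading coefficient of u survives. Applied to maps obtained
  from the coproduct, this extracts leading terms from coassociativity.\<close>

lemma lmap_lead:
  assumes f: "R_linear f"
  shows "left.deg_le n u \<Longrightarrow> (\<And>j. j < n \<Longrightarrow> f (x [^] j) = \<zero>) \<Longrightarrow>
    lmap f u = lmap (\<pi> n) u \<otimes>\<^sub>E (f (x [^] n) \<otimes>\<^sub>t \<one>)"
proof (induction n arbitrary: u)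
  case 0
  have l: "f \<in> linear_map K T T" using f unfolding R_linear_def by blast
  have u: "u \<in> carrier E" "u \<in> RT" "lmap (\<pi> 0) u = u"
    using left.deg_le_zero[OF 0(1)] left.deg_le_closed[OF 0(1)] left.p_closed[of u 0] by auto
  have "lmap f (u \<otimes>\<^sub>E \<one>\<^sub>E) = u \<otimes>\<^sub>E lmap f \<one>\<^sub>E" using u by (intro lmap_lmult f) auto
  then show ?case using u l by (simp add: TT.one_E[symmetric]) (simp add: TT.one_E lmap_tensor)
next
  case (Suc n)
  have l: "f \<in> linear_map K T T" using f unfolding R_linear_def by blast
  obtain u' where u': "left.deg_le n u'"
    "u = u' \<oplus>\<^sub>E lmap (\<pi> (Suc n)) u \<otimes>\<^sub>E (x \<otimes>\<^sub>t \<one>) [^]\<^bsub>E\<^esub> Suc n"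
    using left.deg_le_Suc[OF Suc.prems(1)] .
  let ?c = "lmap (\<pi> (Suc n)) u"
  have c: "?c \<in> RT" "?c \<in> carrier E" "u' \<in> carrier E"
    using left.p_closed left.p_car left.deg_le_closed Suc.prems(1) u'(1) by blast+
  have xn: "x [^] i \<in> carrier T" for i :: nat using x_closed by simp
  have "lmap f u' = lmap (\<pi> n) u' \<otimes>\<^sub>E (f (x [^] n) \<otimes>\<^sub>t \<one>)"
    using Suc.IH[OF u'(1)] Suc.prems(2) by simp
  \<comment> \<open>The remainder has degree at most n, so it contributes only a multiple of f(x^n)
    \<otimes> 1, and f(x^n) = 0 by assumption.\<close>
  then have z: "lmap f u' = \<zero>\<^sub>E"
    using Suc.prems(2)[of n] c(3) by (simp add: TT.tensor_zero_left lmap_closed pi_linear)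
  have "lmap f u = lmap f u' \<oplus>\<^sub>E lmap f (?c \<otimes>\<^sub>E (x [^] Suc n) \<otimes>\<^sub>t \<one>)"
    by (subst u'(2)) (use c l xn in \<open>simp add: lmap_add tensor_one_pow x_closed E_simps\<close>)
  also have "\<dots> = ?c \<otimes>\<^sub>E (f (x [^] Suc n) \<otimes>\<^sub>t \<one>)"
    using c l xn[of "Suc n"] lmap_lmult[OF f c(1), of "(x [^] Suc n) \<otimes>\<^sub>t \<one>"]
    by (simp add: z lmap_tensor TT.tensor_closed linear_closed del: nat_pow_Suc)
  finally show ?case .
qed

text \<open>\<open>TR\<close> is the image of the projection \<open>rmap (\<pi> 0)\<close>, which
  turns pure tensors into pure tensors with second component in R.\<close>

lemma TR_induct [consumes 1, case_names pure add]:
  assumes u: "u \<in> TR"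
    and "\<And>a r. a \<in> carrier T \<Longrightarrow> r \<in> carrier R \<Longrightarrow> P (a \<otimes>\<^sub>t r)"
    and "\<And>s t. s \<in> TR \<Longrightarrow> t \<in> TR \<Longrightarrow> P s \<Longrightarrow> P t \<Longrightarrow> P (s \<oplus>\<^sub>E t)"
  shows "P u"
proof -
  have "P (rmap (\<pi> 0) v)" if "v \<in> carrier E" for v
    using that by (induction v rule: TT.tensor_induct)
      (simp_all add: assms(2,3) pi_linear rmap_tensor rmap_add p_closed right.p_closed)
  from this[of u] u show ?thesis unfolding TR_def by simp
qed

section \<open>R \<otimes> R as a subring of T \<otimes> T\<close>

definition "incl = tensor_incl K T"
definition "to_RR = tensor_map K R R (\<pi> 0) (\<pi> 0)"

lemma incl_tensor: "r \<in> carrier R \<Longrightarrow> s \<in> carrier R \<Longrightarrow> incl (tensor K R R r s) = r \<otimes>\<^sub>t s"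
  unfolding incl_def tensor_incl_def by (rule RTP.map_tensor[OF incl_linear incl_linear])

lemma incl_additive: "additive RR.E E incl"
  unfolding incl_def tensor_incl_def by (rule RTP.map_additive[OF incl_linear incl_linear])

lemma to_RR_tensor: "a \<in> carrier T \<Longrightarrow> b \<in> carrier T \<Longrightarrow> to_RR (a \<otimes>\<^sub>t b) = tensor K R R (\<pi> 0 a) (\<pi> 0 b)"
  unfolding to_RR_def by (rule TRP.map_tensor[OF pi_linear_R pi_linear_R])

lemma to_RR_additive: "additive E RR.E to_RR"
  unfolding to_RR_def by (rule TRP.map_additive[OF pi_linear_R pi_linear_R])

lemmas incl_closed = additive_closed[OF incl_additive]
lemmas incl_add = additive_add[OF incl_additive]
lemmas to_RR_closed = additive_closed[OF to_RR_additive]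
lemmas to_RR_add = additive_add[OF to_RR_additive]

lemma incl_mult:
  assumes "u \<in> carrier RR.E" "v \<in> carrier RR.E"
  shows "incl (u \<otimes>\<^bsub>RR.E\<^esub> v) = incl u \<otimes>\<^sub>E incl v"
  using assms
proof (induction u rule: RR.tensor_induct)
  case (pure a b)
  from pure(3,1,2) show ?case
    by (induction v rule: RR.tensor_induct)
      (simp_all add: incl_tensor incl_add incl_closed E_simps E.r_distr RR.tensor_mult RR.tensor_closed
        RR.mult_r_distr RR.mult_closed' sub_mult sub_carrier R_mult)
qed (simp_all add: incl_add incl_closed E.l_distr RR.mult_l_distr RR.mult_closed')

text \<open>Since \<open>\<pi> 0\<close> is a linear retraction of T onto R, its tensor square is a
  left inverse of the inclusion, which is therefore injective.\<close>

lemma to_RR_incl: "u \<in> carrier RR.E \<Longrightarrow> to_RR (incl u) = u"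
  by (induction u rule: RR.tensor_induct)
    (simp_all add: incl_tensor to_RR_tensor incl_add to_RR_add incl_closed p_A sub_carrier)

lemma incl_to_RR: "u \<in> carrier E \<Longrightarrow> incl (to_RR u) = lmap (\<pi> 0) (rmap (\<pi> 0) u)"
  by (induction u rule: TT.tensor_induct)
    (simp_all add: incl_tensor to_RR_tensor incl_add to_RR_add incl_closed to_RR_closed p_closed p_car pi_linear
      rmap_tensor lmap_tensor rmap_add lmap_add rmap_closed)

text \<open>With \<open>to_RR_incl\<close> and \<open>incl_RR\<close> this identifies R \<otimes> R
  with \<open>TR \<inter> RT\<close>, and the domain hypothesis can be moved into T \<otimes>
  T.\<close>

lemma incl_to_RR': "u \<in> TR \<Longrightarrow> u \<in> RT \<Longrightarrow> incl (to_RR u) = u"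
  using incl_to_RR unfolding TR_iff RT_iff by simp

lemma incl_RR: assumes "u \<in> carrier RR.E" shows "incl u \<in> TR \<and> incl u \<in> RT"
  using assms by (induction u rule: RR.tensor_induct)
    (simp_all add: incl_tensor incl_add tensor_TR tensor_RT sub_carrier right.A_add left.A_add)

end

section \<open>Zero divisors in T \<otimes> R\<close>

locale skew_domain = skew_ext +
  assumes dom: "nc_domain (tensor_algebra K R R)"
begin

lemma RR_domain:
  assumes "u \<in> TR \<inter> RT" "v \<in> TR \<inter> RT" "u \<otimes>\<^sub>E v = \<zero>\<^sub>E"
  shows "u = \<zero>\<^sub>E \<or> v = \<zero>\<^sub>E"
proof -
  interpret D: nc_domain RR.E by (rule dom)
  have c: "to_RR u \<in> carrier RR.E" "to_RR v \<in> carrier RR.E"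
    using assms to_RR_closed right.A_car by auto
  have z: "incl \<zero>\<^bsub>RR.E\<^esub> = \<zero>\<^sub>E"
    by (rule additive_zero[OF RR.abelian_group_E TT.abelian_group_E incl_additive])
  have i: "incl (to_RR u) = u" "incl (to_RR v) = v" using assms incl_to_RR' by auto
  have "incl (to_RR u \<otimes>\<^bsub>RR.E\<^esub> to_RR v) = \<zero>\<^sub>E"
    using incl_mult[OF c] i assms(3) by simp
  then have "to_RR u \<otimes>\<^bsub>RR.E\<^esub> to_RR v = \<zero>\<^bsub>RR.E\<^esub>"
    using to_RR_incl[of "to_RR u \<otimes>\<^bsub>RR.E\<^esub> to_RR v"] to_RR_incl[of "\<zero>\<^bsub>RR.E\<^esub>"] c z by simp
  then show ?thesis using D.no_zero_divisors[OF c] i z by auto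
qed

lemma one_neq_zero_E: "\<one>\<^sub>E \<noteq> \<zero>\<^sub>E"
proof
  interpret D: nc_domain RR.E by (rule dom)
  assume e: "\<one>\<^sub>E = \<zero>\<^sub>E"
  have "to_RR \<one>\<^sub>E = \<one>\<^bsub>RR.E\<^esub>"
    by (simp add: TT.one_E RR.one_E to_RR_tensor p_A R_one sub_one)
  moreover have "to_RR \<zero>\<^sub>E = \<zero>\<^bsub>RR.E\<^esub>"
    by (rule additive_zero[OF TT.abelian_group_E RR.abelian_group_E to_RR_additive])
  ultimately show False using e D.one_not_zero by simp
qed

text \<open>The inverse of \<open>\<sigma>\<close> shows that the automorphisms induced on the coefficient rings are injective.\<close>

definition "sigi t = inv_into (carrier R) \<sigma> (\<pi> 0 t)"

lemma sigi_sig: "t \<in> carrier T \<Longrightarrow> sigi (sig t) = \<pi> 0 t"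
  unfolding sigi_def sig_def using sigma_bij p_closed sigma_closed
  by (simp add: p_A bij_betw_def inv_into_f_f)

lemma sigi_linear: "sigi \<in> linear_map K T T"
proof -
  have b: "\<exists>s\<in>carrier R. r = \<sigma> s" if "r \<in> carrier R" for r
    using that sigma_bij unfolding bij_betw_def by auto
  have i: "inv_into (carrier R) \<sigma> (\<sigma> r) = r" if "r \<in> carrier R" for r
    using that sigma_bij by (simp add: bij_betw_def inv_into_f_f)
  have "inv_into (carrier R) \<sigma> \<in> linear_map K R R"
  proof (rule linear_mapI)
    fix r assume "r \<in> carrier R"
    then show "inv_into (carrier R) \<sigma> r \<in> carrier R"
      using sigma_bij unfolding bij_betw_def by (metis inv_into_into)
  next
    fix r s assume rs: "r \<in> carrier R" "s \<in> carrier R"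
    obtain r' where "r' \<in> carrier R" "r = \<sigma> r'" using b[OF rs(1)] by (rule bexE)
    moreover obtain s' where "s' \<in> carrier R" "s = \<sigma> s'" using b[OF rs(2)] by (rule bexE)
    ultimately show "inv_into (carrier R) \<sigma> (r \<oplus>\<^bsub>R\<^esub> s) = inv_into (carrier R) \<sigma> r \<oplus>\<^bsub>R\<^esub> inv_into (carrier R) \<sigma> s"
      using i by (simp add: linear_add[OF sigma_linear, symmetric])
  next
    fix c r assume c: "c \<in> carrier K" and r: "r \<in> carrier R"
    obtain r' where "r' \<in> carrier R" "r = \<sigma> r'" using b[OF r] by (rule bexE)
    with c show "inv_into (carrier R) \<sigma> (c \<odot>\<^bsub>R\<^esub> r) = c \<odot>\<^bsub>R\<^esub> inv_into (carrier R) \<sigma> r"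
      using i by (simp add: linear_smult[OF sigma_linear, symmetric])
  qed
  then show ?thesis
    using linear_comp[OF pi_linear_R linear_comp[OF _ incl_linear]] unfolding sigi_def[abs_def] by simp
qed

lemma rmap_sig_inj: "v \<in> TR \<Longrightarrow> rmap sig v = \<zero>\<^sub>E \<Longrightarrow> v = \<zero>\<^sub>E"
  using rmap_comp[OF sigi_linear sig_linear pi_linear _ sigi_sig, of v] rmap_zero[OF sigi_linear]
  unfolding TR_iff by metis

lemma lmap_sig_inj: "v \<in> RT \<Longrightarrow> lmap sig v = \<zero>\<^sub>E \<Longrightarrow> v = \<zero>\<^sub>E"
  using lmap_comp[OF sigi_linear sig_linear pi_linear _ sigi_sig, of v] lmap_zero[OF sigi_linear]
  unfolding RT_iff by metis

text \<open>The degree is taken in x \<otimes> 1, in the ring T \<otimes> T over R \<otimes> T. For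
  elements of T \<otimes> R the coefficients fall into R \<otimes> R, where there are no zero
  divisors, and \<sigma> \<otimes> id preserves R \<otimes> R and is injective there.\<close>

lemma TR_domain:
  assumes "u \<in> TR" "v \<in> TR" "u \<otimes>\<^sub>E v = \<zero>\<^sub>E"
  shows "u = \<zero>\<^sub>E \<or> v = \<zero>\<^sub>E"
proof (rule left.no_zero_divisors_sub[where B = TR and C = "TR \<inter> RT"])
  show "lmap (\<pi> j) w \<in> TR \<inter> RT" if "w \<in> TR" for w j
    using that left.p_closed lmap_TR[OF pi_linear] right.A_car by blast
  show "lmap sig w \<in> TR \<inter> RT" if "w \<in> TR \<inter> RT" for w
    using that left.\<tau>_closed lmap_TR[OF sig_linear] by blast
qed (use assms RR_domain lmap_sig_inj right.A_sub in auto)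

end

section \<open>Hopf structures on Ore extensions\<close>

lemma additive_comp:
  "additive A B f \<Longrightarrow> additive B C g \<Longrightarrow> additive A C (\<lambda>x. g (f x))"
  unfolding additive_def by (simp add: Pi_iff)

locale hopf_skew = skew_domain K R T x \<sigma> \<delta>
  for K :: "('k, 'n) ring_scheme"
    and R :: "('k, 'a, 'm) hopf_scheme"
    and T :: "('k, 'a, 'l) hopf_scheme" (structure)
    and x :: 'a and \<sigma> \<delta> :: "'a \<Rightarrow> 'a" +
  assumes sub: "hopf_subalgebra K R T"
begin

abbreviation "\<Delta> \<equiv> comult T"
abbreviation "eps \<equiv> counit T"
abbreviation "S \<equiv> antipode T"
abbreviation "functional e \<equiv> e \<in> linear_map K T (ground_algebra K)"

lemma hopf_T: "hopf_algebra K T" and hopf_R: "hopf_algebra K R"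
  using sub unfolding hopf_subalgebra_def by blast+

lemma Delta_linear: "\<Delta> \<in> linear_map K T E"
  using hopf_algebra.comult_hom[OF hopf_T] unfolding alg_hom_def by blast

lemmas Delta_additive = linear_additive[OF Delta_linear]
lemmas Delta_closed = linear_closed[OF Delta_linear]
lemmas Delta_add = linear_add[OF Delta_linear]
lemmas Delta_smult = linear_smult[OF Delta_linear]

lemma Delta_mult: "a \<in> carrier T \<Longrightarrow> b \<in> carrier T \<Longrightarrow> \<Delta> (a \<otimes> b) = \<Delta> a \<otimes>\<^sub>E \<Delta> b"
  and Delta_one: "\<Delta> \<one> = \<one>\<^sub>E"
  using hopf_algebra.comult_hom[OF hopf_T] unfolding alg_hom_def ring_hom_def by blast+

lemma Delta_pow: "a \<in> carrier T \<Longrightarrow> \<Delta> (a [^] (n::nat)) = \<Delta> a [^]\<^bsub>E\<^esub> n"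
  by (induction n) (simp_all add: Delta_one Delta_mult)

lemma Delta_zero: "\<Delta> \<zero> = \<zero>\<^sub>E"
  by (rule additive_zero[OF T.M.abelian_group_axioms TT.abelian_group_E Delta_additive])

lemma comult_R_closed: "r \<in> carrier R \<Longrightarrow> comult R r \<in> carrier RR.E"
  using hopf_algebra.comult_hom[OF hopf_R] unfolding alg_hom_def linear_map_def by blast

lemma Delta_R: "r \<in> carrier R \<Longrightarrow> \<Delta> r = incl (comult R r)"
  using sub unfolding hopf_subalgebra_def incl_def by blast

lemma Delta_R_TR: "r \<in> carrier R \<Longrightarrow> \<Delta> r \<in> TR" and Delta_R_RT: "r \<in> carrier R \<Longrightarrow> \<Delta> r \<in> RT"
  using incl_RR[OF comult_R_closed] Delta_R by simp_all

lemma eps_functional: "functional eps"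
  using hopf_algebra.counit_hom[OF hopf_T] unfolding alg_hom_def by blast

lemma eps_mult: "a \<in> carrier T \<Longrightarrow> b \<in> carrier T \<Longrightarrow> eps (a \<otimes> b) = eps a \<otimes>\<^bsub>K\<^esub> eps b"
  and eps_one: "eps \<one> = \<one>\<^bsub>K\<^esub>"
  using hopf_algebra.counit_hom[OF hopf_T] unfolding alg_hom_def ring_hom_def ground_algebra_def by auto

lemma functional_closed: "functional e \<Longrightarrow> a \<in> carrier T \<Longrightarrow> e a \<in> carrier K"
  and functional_add: "functional e \<Longrightarrow> a \<in> carrier T \<Longrightarrow> b \<in> carrier T \<Longrightarrow> e (a \<oplus> b) = e a \<oplus>\<^bsub>K\<^esub> e b"
  and functional_smult: "functional e \<Longrightarrow> c \<in> carrier K \<Longrightarrow> a \<in> carrier T \<Longrightarrow> e (c \<odot> a) = c \<otimes>\<^bsub>K\<^esub> e a"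
  unfolding linear_map_def ground_algebra_def by auto

lemma functional_pi: "functional (\<lambda>t. eps (\<pi> j t))"
  by (rule linear_comp[OF pi_linear eps_functional])

lemma antipode_linear: "S \<in> linear_map K T T"
  by (rule hopf_algebra.antipode_linear[OF hopf_T])

subsection \<open>Consequences of coassociativity\<close>

text \<open>Coassociativity after applying an additive map from \<open>T \<otimes> T \<otimes> T\<close>, which is given by its two
  partial evaluations \<open>P s = (- \<otimes> - \<otimes> s)\<close> and \<open>Q u = (u \<otimes> - \<otimes> -)\<close>.\<close>

lemma coassoc_apply:
  assumes G: "abelian_group G"
    and P: "\<And>s. s \<in> carrier T \<Longrightarrow> additive E G (P s)"
    and Q: "\<And>u. u \<in> carrier T \<Longrightarrow> additive E G (Q u)"
    and PQ: "\<And>a b c. a \<in> carrier T \<Longrightarrow> b \<in> carrier T \<Longrightarrow> c \<in> carrier T \<Longrightarrow> P c (a \<otimes>\<^sub>t b) = Q a (b \<otimes>\<^sub>t c)"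
    and L: "additive E G L" "\<And>u s. u \<in> carrier T \<Longrightarrow> s \<in> carrier T \<Longrightarrow> L (u \<otimes>\<^sub>t s) = P s (\<Delta> u)"
    and M: "additive E G M" "\<And>u s. u \<in> carrier T \<Longrightarrow> s \<in> carrier T \<Longrightarrow> M (u \<otimes>\<^sub>t s) = Q u (\<Delta> s)"
    and t: "t \<in> carrier T"
  shows "L (\<Delta> t) = M (\<Delta> t)"
proof -
  interpret G: abelian_group G by (rule G)
  interpret TE: tensor_product K T E by (intro tensor_product.intro TT.module_E T.module_A)
  interpret ET: tensor_product K E T by (intro tensor_product.intro TT.module_E T.module_A)
  interpret m1: tensor_pair K T T E T by unfold_locales
  interpret m2: tensor_pair K T T T E by unfold_locales
  \<comment> \<open>Additivity of Q in its first argument is not among the assumptions. On pure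
    tensors it is inherited from P through \<open>PQ\<close>, and then it spreads by
    induction.\<close>
  have bQ: "balanced K T E (add_monoid G) Q"
  proof (rule balanced_addI[OF G])
    fix a u assume "a \<in> carrier T" "u \<in> carrier E"
    then show "Q a u \<in> carrier G" using additive_closed[OF Q] by blast
  next
    fix a a' u assume a: "a \<in> carrier T" "a' \<in> carrier T" and u: "u \<in> carrier E"
    show "Q (a \<oplus> a') u = Q a u \<oplus>\<^bsub>G\<^esub> Q a' u"
      using u
    proof (induction u rule: TT.tensor_induct)
      case (pure b c)
      then show ?case using a additive_add[OF P[OF pure(2)], of "a \<otimes>\<^sub>t b" "a' \<otimes>\<^sub>t b"]
        by (simp add: PQ[symmetric] E_simps)
    next
      case (add u v)
      then show ?case using a additive_closed[OF Q]
        by (simp add: additive_add[OF Q] G.a_ac)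
    qed
  next
    fix a u v assume "a \<in> carrier T" "u \<in> carrier E" "v \<in> carrier E"
    then show "Q a (u \<oplus>\<^sub>E v) = Q a u \<oplus>\<^bsub>G\<^esub> Q a v" by (simp add: additive_add[OF Q])
  next
    fix c a u assume c: "c \<in> carrier K" and a: "a \<in> carrier T" and u: "u \<in> carrier E"
    show "Q (c \<odot> a) u = Q a (c \<odot>\<^bsub>E\<^esub> u)"
      using u
    proof (induction u rule: TT.tensor_induct)
      case (pure b d)
      then show ?case using a c TT.tensor_smult[of c a b] by (simp add: PQ[symmetric] TT.smult_tensor)
    next
      case (add u v)
      then show ?case using a c by (simp add: additive_add[OF Q] TT.smult_add TT.smult_closed')
    qed
  qed
  \<comment> \<open>This is the given additive map on T \<otimes> (T \<otimes> T), rebuilt from its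
    partial evaluations Q.\<close>
  define \<Psi> where "\<Psi> = tensor_lift (add_monoid G) Q"
  have \<Psi>: "additive TE.E G \<Psi>" unfolding \<Psi>_def by (rule TE.lift_additive[OF bQ])
  have \<Psi>t: "\<Psi> (tensor K T E a u) = Q a u" if "a \<in> carrier T" "u \<in> carrier E" for a u
    unfolding \<Psi>_def by (rule TE.lift_tensor[OF bQ that])
  \<comment> \<open>The associator is a nested lift; this is its inner level, with the third factor
    c fixed.\<close>
  define A where "A c w = tensor_lift (add_monoid TE.E) (\<lambda>a b. tensor K T E a (b \<otimes>\<^sub>t c)) w" for c w
  have bA: "balanced K T T (add_monoid TE.E) (\<lambda>a b. tensor K T E a (b \<otimes>\<^sub>t c))" if c: "c \<in> carrier T" for c
    by (rule balanced_addI[OF TE.abelian_group_E])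
      (use c in \<open>simp_all add: E_simps TE.tensor_closed TE.tensor_add_left TE.tensor_add_right TE.tensor_smult
        TT.smult_tensor\<close>)
  have Aadd: "additive E TE.E (A c)" if "c \<in> carrier T" for c
    unfolding A_def[abs_def] by (rule TT.lift_additive[OF bA[OF that]])
  have At: "A c (a \<otimes>\<^sub>t b) = tensor K T E a (b \<otimes>\<^sub>t c)"
    if "c \<in> carrier T" "a \<in> carrier T" "b \<in> carrier T" for a b c
    unfolding A_def by (rule TT.lift_tensor[OF bA[OF that(1)] that(2,3)])
  have bA2: "balanced K E T (add_monoid TE.E) (\<lambda>w c. A c w)"
  proof (rule balanced_addI[OF TE.abelian_group_E])
    fix w c assume "w \<in> carrier E" "c \<in> carrier T"
    then show "A c w \<in> carrier TE.E" using additive_closed[OF Aadd] by blast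
  next
    fix w w' c assume "w \<in> carrier E" "w' \<in> carrier E" "c \<in> carrier T"
    then show "A c (w \<oplus>\<^sub>E w') = A c w \<oplus>\<^bsub>TE.E\<^esub> A c w'" by (simp add: additive_add[OF Aadd])
  next
    fix w c c' assume w: "w \<in> carrier E" and c: "c \<in> carrier T" "c' \<in> carrier T"
    show "A (c \<oplus> c') w = A c w \<oplus>\<^bsub>TE.E\<^esub> A c' w"
      using w
    proof (induction w rule: TT.tensor_induct)
      case (add u v)
      then show ?case using c additive_closed[OF Aadd]
        by (simp add: additive_add[OF Aadd] TE.E.a_ac)
    qed (use c in \<open>simp add: At E_simps TE.tensor_add_right\<close>)
  next
    fix k w c assume k: "k \<in> carrier K" and w: "w \<in> carrier E" and c: "c \<in> carrier T"
    show "A c (k \<odot>\<^bsub>E\<^esub> w) = A (k \<odot> c) w"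
      using w
    proof (induction w rule: TT.tensor_induct)
      case (add u v)
      then show ?case using c k by (simp add: additive_add[OF Aadd] TT.smult_add TT.smult_closed')
    next
      case (pure a b)
      then show ?case
        using c k by (simp add: At TT.smult_tensor TE.tensor_smult E_simps TT.tensor_smult)
    qed
  qed
  have assoc: "tensor_assoc K T T T = tensor_lift (add_monoid TE.E) (\<lambda>w c. A c w)"
    unfolding tensor_assoc_def A_def tensor_lift_group ..
  have \<Psi>A: "\<Psi> (A c w) = P c w" if c: "c \<in> carrier T" and w: "w \<in> carrier E" for c w
    by (rule TT.additive_eqI[OF additive_comp[OF Aadd[OF c] \<Psi>] P[OF c] w])
      (use c in \<open>simp add: At \<Psi>t PQ E_simps\<close>)
  have "\<Psi> (tensor_assoc K T T T (tensor_map K E T \<Delta> (\<lambda>y. y) s)) = L s" if s: "s \<in> carrier E" for s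
  proof (rule TT.additive_eqI[OF _ L(1) s])
    show "additive E G (\<lambda>s. \<Psi> (tensor_assoc K T T T (tensor_map K E T \<Delta> (\<lambda>y. y) s)))"
      unfolding assoc
      by (rule additive_comp[OF additive_comp[OF m1.map_additive[OF Delta_linear linear_id] ET.lift_additive[OF bA2]] \<Psi>])
    fix a b assume ab: "a \<in> carrier T" "b \<in> carrier T"
    have "tensor_assoc K T T T (tensor K E T (\<Delta> a) b) = A b (\<Delta> a)"
      unfolding assoc by (rule ET.lift_tensor[OF bA2]) (use ab Delta_closed in auto)
    then show "\<Psi> (tensor_assoc K T T T (tensor_map K E T \<Delta> (\<lambda>y. y) (a \<otimes>\<^sub>t b))) = L (a \<otimes>\<^sub>t b)"
      using ab by (simp add: m1.map_tensor[OF Delta_linear linear_id] \<Psi>A L(2) Delta_closed)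
  qed
  moreover have "\<Psi> (tensor_map K T E (\<lambda>y. y) \<Delta> s) = M s" if s: "s \<in> carrier E" for s
    by (rule TT.additive_eqI[OF additive_comp[OF m2.map_additive[OF linear_id Delta_linear] \<Psi>] M(1) s])
      (simp add: m2.map_tensor[OF linear_id Delta_linear] \<Psi>t M(2) Delta_closed)
  moreover have "tensor_assoc K T T T (tensor_map K E T \<Delta> (\<lambda>y. y) (\<Delta> t)) = tensor_map K T E (\<lambda>y. y) \<Delta> (\<Delta> t)"
    by (rule hopf_algebra.coassoc[OF hopf_T t])
  ultimately show ?thesis using Delta_closed[OF t] by metis
qed

section \<open>Contractions id \<otimes> e and e \<otimes> id with a functional e\<close>

definition "evr e = tensor_lift (add_monoid T) (\<lambda>y z. e z \<odot> y)"
definition "evl e = tensor_lift (add_monoid T) (\<lambda>y z. e y \<odot> z)"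

lemma balanced_ev:
  assumes "functional e"
  shows "balanced K T T (add_monoid T) (\<lambda>y z. e z \<odot> y)" "balanced K T T (add_monoid T) (\<lambda>y z. e y \<odot> z)"
  by (rule balanced_addI[OF T.M.abelian_group_axioms];
      simp add: functional_closed[OF assms] functional_add[OF assms] functional_smult[OF assms]
        T.smult_l_distr T.smult_r_distr T.smult_assoc1 T.m_comm;
      simp add: functional_closed[OF assms] T.smult_assoc1[symmetric] T.m_comm)+

lemma evr_tensor:
  assumes "functional e" "a \<in> carrier T" "b \<in> carrier T"
  shows "evr e (a \<otimes>\<^sub>t b) = e b \<odot> a"
  unfolding evr_def by (rule TT.lift_tensor[OF balanced_ev(1)[OF assms(1)] assms(2,3)])

lemma evl_tensor:
  assumes "functional e" "a \<in> carrier T" "b \<in> carrier T"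
  shows "evl e (a \<otimes>\<^sub>t b) = e a \<odot> b"
  unfolding evl_def by (rule TT.lift_tensor[OF balanced_ev(2)[OF assms(1)] assms(2,3)])

lemma evr_additive: "functional e \<Longrightarrow> additive E T (evr e)"
  and evl_additive: "functional e \<Longrightarrow> additive E T (evl e)"
  unfolding evr_def evl_def by (rule TT.lift_additive[OF balanced_ev(1)], assumption)
    (rule TT.lift_additive[OF balanced_ev(2)], assumption)

lemmas evr_closed = additive_closed[OF evr_additive]
lemmas evl_closed = additive_closed[OF evl_additive]
lemmas evr_add = additive_add[OF evr_additive]
lemmas evl_add = additive_add[OF evl_additive]
lemmas evr_zero = additive_zero[OF TT.abelian_group_E T.M.abelian_group_axioms evr_additive]
lemmas evl_zero = additive_zero[OF TT.abelian_group_E T.M.abelian_group_axioms evl_additive]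

lemma evr_linear: assumes "functional e" shows "evr e \<in> linear_map K E T"
proof (rule linear_mapI)
  fix c u assume c: "c \<in> carrier K" and u: "u \<in> carrier E"
  show "evr e (c \<odot>\<^bsub>E\<^esub> u) = c \<odot> evr e u"
    using u by (induction u rule: TT.tensor_induct)
      (use c assms in \<open>simp_all add: TT.smult_tensor evr_tensor evr_add evr_closed TT.smult_add
        TT.smult_closed' T.smult_r_distr functional_closed T.smult_assoc1[symmetric] T.m_comm\<close>)
qed (use assms in \<open>simp_all add: evr_add evr_closed\<close>)

lemma evl_linear: assumes "functional e" shows "evl e \<in> linear_map K E T"
proof (rule linear_mapI)
  fix c u assume c: "c \<in> carrier K" and u: "u \<in> carrier E"
  show "evl e (c \<odot>\<^bsub>E\<^esub> u) = c \<odot> evl e u"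
    using u by (induction u rule: TT.tensor_induct)
      (use c assms in \<open>simp_all add: TT.smult_tensor evl_tensor evl_add evl_closed TT.smult_add
        TT.smult_closed' T.smult_r_distr functional_smult T.smult_assoc1 functional_closed\<close>)
qed (use assms in \<open>simp_all add: evl_add evl_closed\<close>)

lemma counit_r: "t \<in> carrier T \<Longrightarrow> evr eps (\<Delta> t) = t"
  unfolding evr_def by (rule hopf_algebra.counit_right[OF hopf_T])

lemma counit_l: "t \<in> carrier T \<Longrightarrow> evl eps (\<Delta> t) = t"
  unfolding evl_def by (rule hopf_algebra.counit_left[OF hopf_T])

lemma evr_rmap:
  assumes "functional e" "f \<in> linear_map K T T" "functional e'" "u \<in> carrier E"
    "\<And>t. t \<in> carrier T \<Longrightarrow> e (f t) = e' t"
  shows "evr e (rmap f u) = evr e' u"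
  using assms(4) by (induction u rule: TT.tensor_induct)
    (simp_all add: assms(1-3,5) rmap_tensor rmap_add rmap_closed evr_tensor evr_add linear_closed[OF assms(2)])

lemma evl_lmap:
  assumes "functional e" "f \<in> linear_map K T T" "functional e'" "u \<in> carrier E"
    "\<And>t. t \<in> carrier T \<Longrightarrow> e (f t) = e' t"
  shows "evl e (lmap f u) = evl e' u"
  using assms(4) by (induction u rule: TT.tensor_induct)
    (simp_all add: assms(1-3,5) lmap_tensor lmap_add lmap_closed evl_tensor evl_add linear_closed[OF assms(2)])

lemma evr_lmap:
  assumes "functional e" "f \<in> linear_map K T T" "u \<in> carrier E"
  shows "evr e (lmap f u) = f (evr e u)"
  using assms(3) by (induction u rule: TT.tensor_induct)
    (simp_all add: assms(1,2) lmap_tensor lmap_add lmap_closed evr_tensor evr_add evr_closed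
      linear_closed[OF assms(2)] linear_smult[OF assms(2)] linear_add[OF assms(2)] functional_closed)

lemma evl_rmap:
  assumes "functional e" "f \<in> linear_map K T T" "u \<in> carrier E"
  shows "evl e (rmap f u) = f (evl e u)"
  using assms(3) by (induction u rule: TT.tensor_induct)
    (simp_all add: assms(1,2) rmap_tensor rmap_add rmap_closed evl_tensor evl_add evl_closed
      linear_closed[OF assms(2)] linear_smult[OF assms(2)] linear_add[OF assms(2)] functional_closed)

lemma smult_mult_smult:
  assumes "c \<in> carrier K" "d \<in> carrier K" "a \<in> carrier T" "b \<in> carrier T"
  shows "(c \<odot> a) \<otimes> (d \<odot> b) = (c \<otimes>\<^bsub>K\<^esub> d) \<odot> (a \<otimes> b)"
  using assms by (simp add: T.smult_mult_left T.smult_mult_right T.smult_assoc1[symmetric] T.m_comm)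

lemma evr_mult:
  assumes "u \<in> carrier E" "v \<in> carrier E"
  shows "evr eps (u \<otimes>\<^sub>E v) = evr eps u \<otimes> evr eps v"
  using assms
proof (induction u rule: TT.tensor_induct)
  case (pure a b)
  from pure(3,1,2) show ?case
    by (induction v rule: TT.tensor_induct)
      (simp_all add: eps_functional evr_tensor evr_add evr_closed E_simps E.r_distr T.A.r_distr
        eps_mult functional_closed smult_mult_smult)
qed (simp_all add: eps_functional evr_add evr_closed E.l_distr T.A.l_distr)

lemma evl_mult:
  assumes "u \<in> carrier E" "v \<in> carrier E"
  shows "evl eps (u \<otimes>\<^sub>E v) = evl eps u \<otimes> evl eps v"
  using assms
proof (induction u rule: TT.tensor_induct)
  case (pure a b)
  from pure(3,1,2) show ?case
    by (induction v rule: TT.tensor_induct)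
      (simp_all add: eps_functional evl_tensor evl_add evl_closed E_simps E.r_distr T.A.r_distr
        eps_mult functional_closed smult_mult_smult)
qed (simp_all add: eps_functional evl_add evl_closed E.l_distr T.A.l_distr)

text \<open>These are the two hit actions of the linear dual of T on T, with e placed in the last
  and in the first factor of the coproduct respectively.\<close>

definition "rho e t = evr e (\<Delta> t)"
definition "lam e t = evl e (\<Delta> t)"

lemma rho_linear: "functional e \<Longrightarrow> rho e \<in> linear_map K T T"
  unfolding rho_def[abs_def] by (rule linear_comp[OF Delta_linear evr_linear])

lemma lam_linear: "functional e \<Longrightarrow> lam e \<in> linear_map K T T"
  unfolding lam_def[abs_def] by (rule linear_comp[OF Delta_linear evl_linear])

lemma tens_additive_r: "a \<in> carrier T \<Longrightarrow> additive T E (\<lambda>b. a \<otimes>\<^sub>t b)"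
  and tens_additive_l: "a \<in> carrier T \<Longrightarrow> additive T E (\<lambda>b. b \<otimes>\<^sub>t a)"
  by (rule additiveI; simp add: E_simps)+

text \<open>Contract the third factor of coassociativity with e. In other words,
  \<open>rho e\<close> is a morphism of left comodules; \<open>Delta_lam\<close> is the mirror
  image, with the first factor contracted.\<close>

lemma Delta_rho:
  assumes e: "functional e" and t: "t \<in> carrier T"
  shows "\<Delta> (rho e t) = rmap (rho e) (\<Delta> t)"
  unfolding rho_def
proof (rule coassoc_apply[where P = "\<lambda>s w. e s \<odot>\<^bsub>E\<^esub> w" and Q = "\<lambda>u w. u \<otimes>\<^sub>t evr e w"
      and L = "\<lambda>w. \<Delta> (evr e w)" and M = "rmap (\<lambda>t. evr e (\<Delta> t))", OF TT.abelian_group_E _ _ _ _ _ _ _ t])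
  show "additive E E (\<lambda>w. \<Delta> (evr e w))" by (rule additive_comp[OF evr_additive[OF e] Delta_additive])
  show "additive E E (rmap (\<lambda>t. evr e (\<Delta> t)))"
    using rmap_additive[OF rho_linear[OF e]] unfolding rho_def[abs_def] .
  show "additive E E (\<lambda>w. e s \<odot>\<^bsub>E\<^esub> w)" if "s \<in> carrier T" for s
    using that e functional_closed TT.smult_additive by blast
  show "additive E E (\<lambda>w. u \<otimes>\<^sub>t evr e w)" if "u \<in> carrier T" for u
    by (rule additive_comp[OF evr_additive[OF e] tens_additive_r[OF that]])
qed (use e rmap_tensor[OF rho_linear[OF e], unfolded rho_def[abs_def]] in
    \<open>simp_all add: evr_tensor functional_closed TT.smult_tensor TT.tensor_smult Delta_smult\<close>)

lemma Delta_lam: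
  assumes e: "functional e" and t: "t \<in> carrier T"
  shows "\<Delta> (lam e t) = lmap (lam e) (\<Delta> t)"
  unfolding lam_def
proof (rule coassoc_apply[where P = "\<lambda>s w. evl e w \<otimes>\<^sub>t s" and Q = "\<lambda>u w. e u \<odot>\<^bsub>E\<^esub> w"
      and M = "\<lambda>w. \<Delta> (evl e w)" and L = "lmap (\<lambda>t. evl e (\<Delta> t))",
      OF TT.abelian_group_E _ _ _ _ _ _ _ t, symmetric])
  show "additive E E (\<lambda>w. \<Delta> (evl e w))" by (rule additive_comp[OF evl_additive[OF e] Delta_additive])
  show "additive E E (lmap (\<lambda>t. evl e (\<Delta> t)))"
    using lmap_additive[OF lam_linear[OF e]] unfolding lam_def[abs_def] .
  show "additive E E (\<lambda>w. e s \<odot>\<^bsub>E\<^esub> w)" if "s \<in> carrier T" for s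
    using that e functional_closed TT.smult_additive by blast
  show "additive E E (\<lambda>w. evl e w \<otimes>\<^sub>t u)" if "u \<in> carrier T" for u
    by (rule additive_comp[OF evl_additive[OF e] tens_additive_l[OF that]])
qed (use e lmap_tensor[OF lam_linear[OF e], unfolded lam_def[abs_def]] in
    \<open>simp_all add: evl_tensor functional_closed TT.smult_tensor Delta_smult\<close>)

text \<open>Contract the middle factor of coassociativity with e.\<close>

lemma rho_lam:
  assumes e: "functional e" and t: "t \<in> carrier T"
  shows "lmap (rho e) (\<Delta> t) = rmap (lam e) (\<Delta> t)"
proof (rule coassoc_apply[where P = "\<lambda>s w. evr e w \<otimes>\<^sub>t s" and Q = "\<lambda>u w. u \<otimes>\<^sub>t evl e w"
      and L = "lmap (rho e)" and M = "rmap (lam e)", OF TT.abelian_group_E _ _ _ _ _ _ _ t])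
  show "additive E E (lmap (rho e))" by (rule lmap_additive[OF rho_linear[OF e]])
  show "additive E E (rmap (lam e))" by (rule rmap_additive[OF lam_linear[OF e]])
  show "additive E E (\<lambda>w. evr e w \<otimes>\<^sub>t u)" if "u \<in> carrier T" for u
    by (rule additive_comp[OF evr_additive[OF e] tens_additive_l[OF that]])
  show "additive E E (\<lambda>w. u \<otimes>\<^sub>t evl e w)" if "u \<in> carrier T" for u
    by (rule additive_comp[OF evl_additive[OF e] tens_additive_r[OF that]])
qed (use e in \<open>simp_all add: evl_tensor evr_tensor functional_closed TT.tensor_smult
    lmap_tensor[OF rho_linear[OF e]] rmap_tensor[OF lam_linear[OF e]] rho_def lam_def\<close>)

section \<open>The antipode and the Galois map\<close>

definition "antipode_mult = tensor_lift (add_monoid T) (\<lambda>y z. S y \<otimes> z)"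

lemma balanced_antipode_mult: "balanced K T T (add_monoid T) (\<lambda>y z. S y \<otimes> z)"
  by (rule balanced_addI[OF T.M.abelian_group_axioms])
    (simp_all add: linear_closed[OF antipode_linear] linear_add[OF antipode_linear]
      linear_smult[OF antipode_linear] T.A.l_distr T.A.r_distr T.smult_mult_left T.smult_mult_right)

lemma antipode_mult_tensor: "a \<in> carrier T \<Longrightarrow> b \<in> carrier T \<Longrightarrow> antipode_mult (a \<otimes>\<^sub>t b) = S a \<otimes> b"
  unfolding antipode_mult_def by (rule TT.lift_tensor[OF balanced_antipode_mult])

lemma antipode_mult_additive: "additive E T antipode_mult"
  unfolding antipode_mult_def by (rule TT.lift_additive[OF balanced_antipode_mult])

lemma antipode_mult_Delta: "t \<in> carrier T \<Longrightarrow> antipode_mult (\<Delta> t) = eps t \<odot> \<one>"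
  unfolding antipode_mult_def by (rule hopf_algebra.antipode_left[OF hopf_T])

lemma antipode_mult_rmult:
  assumes "u \<in> carrier E" "b \<in> carrier T"
  shows "antipode_mult (u \<otimes>\<^sub>E (\<one> \<otimes>\<^sub>t b)) = antipode_mult u \<otimes> b"
  using assms(1) by (induction u rule: TT.tensor_induct)
    (use assms(2) in \<open>simp_all add: antipode_mult_tensor E_simps linear_closed[OF antipode_linear] T.A.m_assoc
      E.l_distr T.A.l_distr additive_add[OF antipode_mult_additive] additive_closed[OF antipode_mult_additive]\<close>)

text \<open>This is the canonical Galois map, which multiplies \<Delta>(s) from the left by u
  \<otimes> 1, precomposed with S \<otimes> id. It is what connects 1 \<otimes> x with the powers of
  \<Delta>(x).\<close>

definition "galois = tensor_lift (add_monoid E) (\<lambda>u s. (S u \<otimes>\<^sub>t \<one>) \<otimes>\<^sub>E \<Delta> s)"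

lemma balanced_galois: "balanced K T T (add_monoid E) (\<lambda>u s. (S u \<otimes>\<^sub>t \<one>) \<otimes>\<^sub>E \<Delta> s)"
proof (rule balanced_addI[OF TT.abelian_group_E])
  interpret EA: assoc_algebra K E by (rule TT.assoc_algebra_E)
  fix c a b assume "c \<in> carrier K" "a \<in> carrier T" "b \<in> carrier T"
  then show "(S (c \<odot> a) \<otimes>\<^sub>t \<one>) \<otimes>\<^sub>E \<Delta> b = (S a \<otimes>\<^sub>t \<one>) \<otimes>\<^sub>E \<Delta> (c \<odot> b)"
    by (simp add: linear_closed[OF antipode_linear] linear_smult[OF antipode_linear] Delta_smult Delta_closed
        TT.smult_tensor[symmetric] EA.smult_mult_left EA.smult_mult_right TT.tensor_closed)
qed (simp_all add: linear_closed[OF antipode_linear] linear_add[OF antipode_linear] Delta_closed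
    Delta_add E_simps E.l_distr E.r_distr)

lemma galois_tensor: "a \<in> carrier T \<Longrightarrow> b \<in> carrier T \<Longrightarrow> galois (a \<otimes>\<^sub>t b) = (S a \<otimes>\<^sub>t \<one>) \<otimes>\<^sub>E \<Delta> b"
  unfolding galois_def by (rule TT.lift_tensor[OF balanced_galois])

lemma galois_additive: "additive E E galois"
  unfolding galois_def by (rule TT.lift_additive[OF balanced_galois])

lemma galois_Delta: assumes t: "t \<in> carrier T" shows "galois (\<Delta> t) = \<one> \<otimes>\<^sub>t t"
proof -
  \<comment> \<open>The map on the threefold tensor product multiplies S of the first factor with
    the second and keeps the third. One bracketing collapses by the antipode law to the counit, the
    other is the Galois map.\<close>
  have "(\<lambda>w. \<one> \<otimes>\<^sub>t evl eps w) (\<Delta> t) = galois (\<Delta> t)"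
  proof (rule coassoc_apply[where P = "\<lambda>s w. antipode_mult w \<otimes>\<^sub>t s" and Q = "\<lambda>u w. (S u \<otimes>\<^sub>t \<one>) \<otimes>\<^sub>E w",
        OF TT.abelian_group_E _ _ _ _ _ galois_additive galois_tensor t])
    show "additive E E (\<lambda>w. \<one> \<otimes>\<^sub>t evl eps w)"
      by (rule additive_comp[OF evl_additive[OF eps_functional] tens_additive_r]) simp
    show "additive E E (\<lambda>w. antipode_mult w \<otimes>\<^sub>t u)" if "u \<in> carrier T" for u
      by (rule additive_comp[OF antipode_mult_additive tens_additive_l[OF that]])
    show "additive E E (\<lambda>w. (S u \<otimes>\<^sub>t \<one>) \<otimes>\<^sub>E w)" if "u \<in> carrier T" for u
      by (rule additiveI)
        (use that in \<open>simp_all add: linear_closed[OF antipode_linear] E_simps E.r_distr\<close>)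
  qed (simp_all add: linear_closed[OF antipode_linear] E_simps antipode_mult_tensor antipode_mult_Delta evl_tensor
      eps_functional functional_closed TT.tensor_smult)
  then show ?thesis using counit_l[OF t] by simp
qed

end

context hopf_skew
begin

lemma one_neq_zero_T: "\<one> \<noteq> \<zero>"
  using one_neq_zero_E TT.one_E TT.tensor_zero_left[of \<one>] by auto

lemma pi_x: "\<pi> j x = (if j = 1 then \<one> else \<zero>)"
  using p_Y[of \<one> j] x_closed by (cases j) (simp_all add: p_A R_one)

lemma x_notin_R: "x \<notin> carrier R"
  using pi_x[of 1] p_A[of x 1] one_neq_zero_T by auto

lemma evr_RT: "functional e \<Longrightarrow> u \<in> RT \<Longrightarrow> evr e u \<in> carrier R"
  unfolding RT_iff using evr_lmap[OF _ pi_linear, of e u 0] p_closed[OF evr_closed, of e u 0] by simp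

lemma evl_TR: "functional e \<Longrightarrow> u \<in> TR \<Longrightarrow> evl e u \<in> carrier R"
  unfolding TR_iff using evl_rmap[OF _ pi_linear, of e u 0] p_closed[OF evl_closed, of e u 0] by simp

text \<open>R embeds into R \<otimes> R by r \<otimes> 1, and id \<otimes> eps recovers r.\<close>

lemma R_domain:
  assumes "r \<in> carrier R" "s \<in> carrier R" "r \<otimes> s = \<zero>"
  shows "r = \<zero> \<or> s = \<zero>"
proof -
  have c: "r \<in> carrier T" "s \<in> carrier T" using assms sub_carrier by auto
  have e: "evr eps (t \<otimes>\<^sub>t \<one>) = t" if "t \<in> carrier T" for t
    using that by (simp add: evr_tensor[OF eps_functional] eps_one)
  have "(r \<otimes>\<^sub>t \<one>) \<otimes>\<^sub>E (s \<otimes>\<^sub>t \<one>) = \<zero>\<^sub>E"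
    using c assms(3) by (simp add: E_simps TT.tensor_zero_left)
  then have "r \<otimes>\<^sub>t \<one> = \<zero>\<^sub>E \<or> s \<otimes>\<^sub>t \<one> = \<zero>\<^sub>E"
    using RR_domain[of "r \<otimes>\<^sub>t \<one>" "s \<otimes>\<^sub>t \<one>"] tensor_TR tensor_RT assms(1,2) c R_one by blast
  then show ?thesis using e[OF c(1)] e[OF c(2)] evr_zero[OF eps_functional] by auto
qed

abbreviation "coef_counit j t \<equiv> eps (\<pi> j t)"

lemma rho_coef: "t \<in> carrier T \<Longrightarrow> rho (coef_counit j) t = evr eps (rmap (\<pi> j) (\<Delta> t))"
  unfolding rho_def
  using evr_rmap[OF eps_functional pi_linear functional_pi, of "\<Delta> t" j j] Delta_closed by simp

lemma lam_coef: "t \<in> carrier T \<Longrightarrow> lam (coef_counit j) t = evl eps (lmap (\<pi> j) (\<Delta> t))"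
  unfolding lam_def
  using evl_lmap[OF eps_functional pi_linear functional_pi, of "\<Delta> t" j j] Delta_closed by simp

text \<open>This depends on the form of the functional: \<Delta>(r) lies in T \<otimes> R and so can
  be pulled out of id \<otimes> \<pi> j; then id \<otimes> eps is multiplicative and sends
  \<Delta>(r) back to r.\<close>

lemma rho_R_linear: "R_linear (rho (coef_counit j))"
  unfolding R_linear_def
proof (intro conjI ballI rho_linear functional_pi)
  fix r t assume r: "r \<in> carrier R" and t: "t \<in> carrier T"
  then have "rho (coef_counit j) (r \<otimes> t) = evr eps (\<Delta> r \<otimes>\<^sub>E rmap (\<pi> j) (\<Delta> t))"
    by (simp add: rho_coef sub_carrier Delta_mult right.p_lmult Delta_R_TR Delta_closed)
  then show "rho (coef_counit j) (r \<otimes> t) = r \<otimes> rho (coef_counit j) t"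
    using r t by (simp add: rho_coef sub_carrier evr_mult counit_r Delta_closed right.p_car)
qed

lemma lam_R_linear: "R_linear (lam (coef_counit j))"
  unfolding R_linear_def
proof (intro conjI ballI lam_linear functional_pi)
  fix r t assume r: "r \<in> carrier R" and t: "t \<in> carrier T"
  then have "lam (coef_counit j) (r \<otimes> t) = evl eps (\<Delta> r \<otimes>\<^sub>E lmap (\<pi> j) (\<Delta> t))"
    by (simp add: lam_coef sub_carrier Delta_mult left.p_lmult Delta_R_RT Delta_closed)
  then show "lam (coef_counit j) (r \<otimes> t) = r \<otimes> lam (coef_counit j) t"
    using r t by (simp add: lam_coef sub_carrier evl_mult counit_l Delta_closed left.p_car)
qed

lemma eps_smult_one: "c \<in> carrier K \<Longrightarrow> eps (c \<odot> \<one>) = c"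
  by (simp add: functional_smult[OF eps_functional] eps_one)

subsection \<open>The degree of the comultiplication in the second factor\<close>

text \<open>If b is the sum of the b_j x^j, then a \<otimes> b goes to the sum of the (S(a)
  \<otimes> 1) \<Delta>(b_j) \<Delta>(x)^j, and the coefficients are in T \<otimes> R because R is a
  Hopf subalgebra.\<close>

lemma galois_expansion:
  assumes "w \<in> carrier E"
  shows "\<exists>V. expansion E TR (\<lambda>j. \<Delta> x [^]\<^bsub>E\<^esub> (j::nat)) (galois w) V"
  using assms
proof (induction w rule: TT.tensor_induct)
  case (pure a b)
  have pow: "\<Delta> x [^]\<^bsub>E\<^esub> (j::nat) \<in> carrier E" for j using x_closed Delta_closed by simp
  obtain N where N: "deg_le N b" using p_bounded[OF pure(2)] pure(2) unfolding deg_le_def by blast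
  have "b = (\<Oplus>j\<in>{..N}. \<pi> j b \<otimes> x [^] j)" by (rule eq_sum[OF N])
  then have "\<Delta> b = \<Delta> (\<Oplus>j\<in>{..N}. \<pi> j b \<otimes> x [^] j)" by (rule arg_cong)
  also have "\<dots> = (\<Oplus>\<^bsub>E\<^esub>j\<in>{..N}. \<Delta> (\<pi> j b \<otimes> x [^] j))"
    by (rule E.additive_finsum[OF T.A.ring_axioms Delta_additive]) (simp_all add: pure p_car x_closed)
  also have "\<dots> = (\<Oplus>\<^bsub>E\<^esub>j\<in>{..N}. \<Delta> (\<pi> j b) \<otimes>\<^sub>E \<Delta> x [^]\<^bsub>E\<^esub> j)"
    by (rule TT.E.finsum_cong') (simp_all add: pure p_car x_closed Delta_mult Delta_pow Delta_closed)
  finally have ex: "expansion E TR (\<lambda>j. \<Delta> x [^]\<^bsub>E\<^esub> (j::nat)) (\<Delta> b) (\<lambda>j. \<Delta> (\<pi> j b))"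
    unfolding expansion_def using N Delta_R_TR[OF p_closed[OF pure(2)]] Delta_zero
    by (auto simp: deg_le_def intro!: exI[of _ N])
  have Sa: "S a \<otimes>\<^sub>t \<one> \<in> TR"
    by (rule tensor_TR) (simp_all add: linear_closed[OF antipode_linear] pure R_one)
  have "expansion E TR (\<lambda>j. \<Delta> x [^]\<^bsub>E\<^esub> (j::nat)) ((S a \<otimes>\<^sub>t \<one>) \<otimes>\<^sub>E \<Delta> b)
      (\<lambda>j. (S a \<otimes>\<^sub>t \<one>) \<otimes>\<^sub>E \<Delta> (\<pi> j b))"
    by (rule E.expansion_lmult[where b = "\<lambda>j. \<Delta> x [^]\<^bsub>E\<^esub> (j::nat)", OF right.A_sub pow _ ex Sa])
      (rule right.A_mult)
  then show ?case unfolding galois_tensor[OF pure] by blast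
next
  case (add s t)
  have pow: "\<Delta> x [^]\<^bsub>E\<^esub> (j::nat) \<in> carrier E" for j using x_closed Delta_closed by simp
  obtain V W where VW: "expansion E TR (\<lambda>j. \<Delta> x [^]\<^bsub>E\<^esub> (j::nat)) (galois s) V"
    "expansion E TR (\<lambda>j. \<Delta> x [^]\<^bsub>E\<^esub> (j::nat)) (galois t) W" using add by blast
  have "expansion E TR (\<lambda>j. \<Delta> x [^]\<^bsub>E\<^esub> (j::nat)) (galois s \<oplus>\<^sub>E galois t) (\<lambda>i. V i \<oplus>\<^sub>E W i)"
    by (rule E.expansion_add[where b = "\<lambda>j. \<Delta> x [^]\<^bsub>E\<^esub> (j::nat)", OF right.A_sub pow _ VW])
      (rule right.A_add)
  then show ?case unfolding additive_add[OF galois_additive add(1,2)] by blast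
qed

lemma Delta_x_nonzero: "\<Delta> x \<noteq> \<zero>\<^sub>E"
proof
  assume "\<Delta> x = \<zero>\<^sub>E"
  then have "x = \<zero>" using counit_r[OF x_closed] evr_zero[OF eps_functional] by simp
  then show False using x_notin_R R_zero by simp
qed

text \<open>By the antipode, \<open>1 \<otimes> x\<close> lies in the sum of the \<open>(T \<otimes> R) \<Delta>(x)\<^sup>j\<close>, all of whose elements
  have degree a multiple of the degree of \<open>\<Delta>(x)\<close>.\<close>

lemma Delta_x_degree: "right.deg_le 1 (\<Delta> x)"
proof -
  let ?D = "\<lambda>j::nat. \<Delta> x [^]\<^bsub>E\<^esub> j"
  have pow: "?D j \<in> carrier E" for j using x_closed Delta_closed by simp
  obtain n where n: "right.deg_le n (\<Delta> x)" "rmap (\<pi> n) (\<Delta> x) \<noteq> \<zero>\<^sub>E"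
    using right.degree_exists[OF Delta_closed[OF x_closed] Delta_x_nonzero] by blast
  \<comment> \<open>In degree 0, \<Delta>(x) would lie in T \<otimes> R, and eps \<otimes> id would
    show that x is in R.\<close>
  have n0: "n \<noteq> 0"
  proof
    assume "n = 0"
    then have "\<Delta> x \<in> TR" using n(1) right.deg_le_zero right.p_closed Delta_closed[OF x_closed] by metis
    then show False using evl_TR[OF eps_functional] counit_l[OF x_closed] x_notin_R by metis
  qed
  have tau: "(rmap sig ^^ k) v \<in> TR \<and> (rmap sig ^^ k) v \<noteq> \<zero>\<^sub>E" if "v \<in> TR" "v \<noteq> \<zero>\<^sub>E" for k v
  proof (induction k)
    case (Suc k)
    then show ?case using right.\<tau>_closed[of "(rmap sig ^^ k) v"] rmap_sig_inj[of "(rmap sig ^^ k) v"] by auto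
  qed (use that in simp)
  \<comment> \<open>The degree of the power is exactly n * j: leading coefficients are multiplied in
    the domain T \<otimes> R, after twists by the injective id \<otimes> \<sigma>.\<close>
  have powdeg: "right.deg_le (n * j) (?D j) \<and> rmap (\<pi> (n * j)) (?D j) \<noteq> \<zero>\<^sub>E" for j
  proof (induction j)
    case 0
    then show ?case using right.deg_le_A[OF right.A_one] right.p_A[OF right.A_one] one_neq_zero_E by simp
  next
    case (Suc j)
    have d: "right.deg_le (n * j + n) (?D j \<otimes>\<^sub>E \<Delta> x)"
      "rmap (\<pi> (n * j + n)) (?D j \<otimes>\<^sub>E \<Delta> x) =
        rmap (\<pi> (n * j)) (?D j) \<otimes>\<^sub>E (rmap sig ^^ (n * j)) (rmap (\<pi> n) (\<Delta> x))"
      using right.deg_mult[OF n(1)] Suc by blast+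
    have "rmap (\<pi> (n * j)) (?D j) \<in> TR" "rmap (\<pi> n) (\<Delta> x) \<in> TR"
      using right.p_closed pow Delta_closed x_closed by blast+
    then have "rmap (\<pi> (n * j + n)) (?D j \<otimes>\<^sub>E \<Delta> x) \<noteq> \<zero>\<^sub>E"
      unfolding d(2) using TR_domain tau[of "rmap (\<pi> n) (\<Delta> x)" "n * j"] n(2) Suc by blast
    then show ?case using d(1) by (simp add: add.commute)
  qed
  obtain V where "expansion E TR ?D (\<one> \<otimes>\<^sub>t x) V"
    using galois_expansion[OF Delta_closed[OF x_closed]] unfolding galois_Delta[OF x_closed] by blast
  then obtain N where V: "\<And>i. V i \<in> TR" "\<forall>i>N. V i = \<zero>\<^sub>E"
    "\<one> \<otimes>\<^sub>t x = (\<Oplus>\<^bsub>E\<^esub>i\<in>{..N}. V i \<otimes>\<^sub>E ?D i)"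
    using E.expansionE by blast
  have Vc: "V i \<in> carrier E" for i using V(1) right.A_car by blast
  have p1x: "rmap (\<pi> j) (\<one> \<otimes>\<^sub>t x) = (if j = 1 then \<one>\<^sub>E else \<zero>\<^sub>E)" for j
    using x_closed by (simp add: rmap_tensor pi_linear pi_x TT.one_E TT.tensor_zero_right)
  have "\<exists>j. V j \<noteq> \<zero>\<^sub>E"
  proof (rule ccontr)
    assume "\<not> ?thesis"
    then have "(\<Oplus>\<^bsub>E\<^esub>i\<in>{..N}. V i \<otimes>\<^sub>E ?D i) = \<zero>\<^sub>E"
      by (intro TT.E.add.finprod_one_eqI) (use pow in simp)
    then have "\<one>\<^sub>E = \<zero>\<^sub>E" using p1x[of 1] V(3) right.p_zero by simp
    then show False using one_neq_zero_E by blast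
  qed
  then obtain j0 where j0: "V j0 \<noteq> \<zero>\<^sub>E" by blast
  have bnd: "\<And>i. V i \<noteq> \<zero>\<^sub>E \<Longrightarrow> i \<le> N" using V(2) not_less by blast
  define d where "d = (GREATEST i. V i \<noteq> \<zero>\<^sub>E)"
  have d: "V d \<noteq> \<zero>\<^sub>E" unfolding d_def by (rule GreatestI_nat[of _ j0 N]) (use j0 bnd in auto)
  have dmax: "\<forall>i>d. V i = \<zero>\<^sub>E"
  proof (intro allI impI, rule ccontr)
    fix i assume "d < i" "V i \<noteq> \<zero>\<^sub>E"
    moreover have "i \<le> d" unfolding d_def by (rule Greatest_le_nat[of _ i N]) (use calculation bnd in auto)
    ultimately show False by simp
  qed
  have dN: "d \<le> N" using d bnd by blast
  have sum: "\<one> \<otimes>\<^sub>t x = (\<Oplus>\<^bsub>E\<^esub>i\<in>{..d}. V i \<otimes>\<^sub>E ?D i)"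
    unfolding V(3) by (rule E.finsum_extend[OF dmax dN Vc pow])
  \<comment> \<open>As n is positive, the summands have bounds n * i that strictly increase with i,
    so nothing can cancel the coefficient contributed by the last one.\<close>
  have lead: "right.deg_le (n * k) (\<Oplus>\<^bsub>E\<^esub>i\<in>{..k}. V i \<otimes>\<^sub>E ?D i) \<and>
      rmap (\<pi> (n * k)) (\<Oplus>\<^bsub>E\<^esub>i\<in>{..k}. V i \<otimes>\<^sub>E ?D i) = V k \<otimes>\<^sub>E rmap (\<pi> (n * k)) (?D k)" for k
  proof (induction k)
    case 0
    have "(\<Oplus>\<^bsub>E\<^esub>i\<in>{..(0::nat)}. V i \<otimes>\<^sub>E ?D i) = V 0 \<otimes>\<^sub>E ?D 0"
      by (rule TT.E.finsum_0) (use Vc pow in auto)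
    moreover have "V 0 \<otimes>\<^sub>E ?D 0 = V 0" using Vc by simp
    moreover have "rmap (\<pi> 0) \<one>\<^sub>E = \<one>\<^sub>E" using right.p_A[OF right.A_one] by simp
    ultimately show ?case using right.deg_le_A[OF V(1)] right.p_A[OF V(1)] Vc by simp
  next
    case (Suc k)
    have s: "(\<Oplus>\<^bsub>E\<^esub>i\<in>{..Suc k}. V i \<otimes>\<^sub>E ?D i) = V (Suc k) \<otimes>\<^sub>E ?D (Suc k) \<oplus>\<^sub>E (\<Oplus>\<^bsub>E\<^esub>i\<in>{..k}. V i \<otimes>\<^sub>E ?D i)"
      by (rule TT.E.finsum_Suc) (use Vc pow in auto)
    let ?w = "\<Oplus>\<^bsub>E\<^esub>i\<in>{..k}. V i \<otimes>\<^sub>E ?D i"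
    have a: "right.deg_le (n * Suc k) (V (Suc k) \<otimes>\<^sub>E ?D (Suc k))"
      using right.deg_le_lmult[OF V(1)] powdeg by blast
    have b: "right.deg_le (n * Suc k) ?w" using right.deg_le_mono[of "n * k" ?w "n * Suc k"] Suc by simp
    have c: "rmap (\<pi> (n * Suc k)) ?w = \<zero>\<^sub>E"
      using Suc n0 unfolding right.deg_le_def by simp
    have e: "rmap (\<pi> (n * Suc k)) (V (Suc k) \<otimes>\<^sub>E ?D (Suc k)) = V (Suc k) \<otimes>\<^sub>E rmap (\<pi> (n * Suc k)) (?D (Suc k))"
      by (rule right.p_lmult[OF V(1) pow])
    have "rmap (\<pi> (n * Suc k)) (V (Suc k) \<otimes>\<^sub>E ?D (Suc k) \<oplus>\<^sub>E ?w) =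
      V (Suc k) \<otimes>\<^sub>E rmap (\<pi> (n * Suc k)) (?D (Suc k))"
      unfolding right.p_add[OF right.deg_le_closed[OF a] right.deg_le_closed[OF b]] c e
      using Vc[of "Suc k"] right.p_car[OF pow[of "Suc k"]] by (simp del: E.nat_pow_Suc mult_Suc_right)
    then show ?case unfolding s using right.deg_le_add[OF a b] by blast
  qed
  have "rmap (\<pi> (n * d)) (\<one> \<otimes>\<^sub>t x) = V d \<otimes>\<^sub>E rmap (\<pi> (n * d)) (?D d)"
    using lead[of d] unfolding sum by blast
  moreover have "V d \<otimes>\<^sub>E rmap (\<pi> (n * d)) (?D d) \<noteq> \<zero>\<^sub>E"
    using TR_domain[OF V(1) right.p_closed[OF pow]] d powdeg by blast
  \<comment> \<open>The element 1 \<otimes> x has its only nonzero coefficient at index 1.\<close>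
  ultimately have "n * d = 1" using p1x[of "n * d"] by metis
  then show ?thesis using n(1) by simp
qed

subsection \<open>Normalising the coefficient of \<open>1 \<otimes> x\<close>\<close>

text \<open>Write \<open>\<Delta>(x) = P + Q (1 \<otimes> x)\<close> and \<open>y = (id \<otimes> \<epsilon>\<pi>\<^sub>1) \<Delta>(x)\<close>. Coassociativity gives
  \<open>\<Delta>(y) = Q (1 \<otimes> y)\<close>, and then the antipode makes \<open>y\<close> invertible in \<open>T\<close>, hence a unit of \<open>R\<close> for
  degree reasons. So \<open>Q = \<Delta>(y) (1 \<otimes> y\<^sup>-\<^sup>1)\<close>, and \<open>y\<^sup>-\<^sup>1 x\<close> is the new variable.\<close>

lemma normalise_second:
  "\<exists>u v. u \<in> carrier R \<and> v \<in> carrier R \<and> u \<otimes> v = \<one> \<and> v \<otimes> u = \<one> \<and>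
    (\<exists>P\<in>TR. \<Delta> (u \<otimes> x) = P \<oplus>\<^sub>E \<one> \<otimes>\<^sub>t (u \<otimes> x))"
proof -
  let ?P = "rmap (\<pi> 0) (\<Delta> x)" and ?Q = "rmap (\<pi> 1) (\<Delta> x)"
  have Dx: "\<Delta> x \<in> carrier E" using Delta_closed x_closed by blast
  have PQ: "?P \<in> TR" "?Q \<in> TR" using right.p_closed[OF Dx] by blast+
  have PQc: "?P \<in> carrier E" "?Q \<in> carrier E" using right.p_car[OF Dx] by blast+
  have X: "\<one> \<otimes>\<^sub>t x \<in> carrier E" using x_closed TT.tensor_closed by simp
  have split: "\<Delta> x = ?P \<oplus>\<^sub>E ?Q \<otimes>\<^sub>E (\<one> \<otimes>\<^sub>t x)"
  proof -
    have "\<Delta> x = (\<Oplus>\<^bsub>E\<^esub>j\<in>{..1}. rmap (\<pi> j) (\<Delta> x) \<otimes>\<^sub>E (\<one> \<otimes>\<^sub>t x) [^]\<^bsub>E\<^esub> j)"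
      by (rule right.eq_sum[OF Delta_x_degree])
    also have "\<dots> = ?Q \<otimes>\<^sub>E (\<one> \<otimes>\<^sub>t x) [^]\<^bsub>E\<^esub> Suc 0 \<oplus>\<^sub>E
        (\<Oplus>\<^bsub>E\<^esub>j\<in>{..0}. rmap (\<pi> j) (\<Delta> x) \<otimes>\<^sub>E (\<one> \<otimes>\<^sub>t x) [^]\<^bsub>E\<^esub> j)"
      unfolding One_nat_def by (rule TT.E.finsum_Suc) (use right.p_car[OF Dx] X in auto)
    also have "(\<Oplus>\<^bsub>E\<^esub>j\<in>{..(0::nat)}. rmap (\<pi> j) (\<Delta> x) \<otimes>\<^sub>E (\<one> \<otimes>\<^sub>t x) [^]\<^bsub>E\<^esub> j) = ?P \<otimes>\<^sub>E (\<one> \<otimes>\<^sub>t x) [^]\<^bsub>E\<^esub> (0::nat)"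
      by (rule TT.E.finsum_0) (use right.p_car[OF Dx] X in auto)
    also have "?Q \<otimes>\<^sub>E (\<one> \<otimes>\<^sub>t x) [^]\<^bsub>E\<^esub> Suc 0 \<oplus>\<^sub>E \<dots> = ?P \<oplus>\<^sub>E ?Q \<otimes>\<^sub>E (\<one> \<otimes>\<^sub>t x)"
      using PQc X by (simp add: TT.E.a_comm)
    finally show ?thesis .
  qed
  define f where "f = rho (coef_counit 1)"
  let ?y = "f x"
  have fl: "f \<in> linear_map K T T" unfolding f_def by (rule rho_linear[OF functional_pi])
  have fR: "R_linear f" unfolding f_def by (rule rho_R_linear)
  have y: "?y \<in> carrier T" using linear_closed[OF fl x_closed] .
  have f1: "f \<one> = \<zero>"
    by (simp add: f_def rho_coef Delta_one right.p_A[OF right.A_one] evr_zero[OF eps_functional])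
  \<comment> \<open>All second components of the first summand are in R, and f vanishes on R: it is
    R-linear with f(1) = 0.\<close>
  have "rmap f ?P = \<zero>\<^sub>E"
  proof -
    have "rmap f (?P \<otimes>\<^sub>E \<one>\<^sub>E) = ?P \<otimes>\<^sub>E rmap f \<one>\<^sub>E"
      by (rule rmap_lmult[OF fR PQ(1)]) simp
    moreover have "rmap f \<one>\<^sub>E = \<zero>\<^sub>E"
      unfolding TT.one_E by (simp add: rmap_tensor fl f1 TT.tensor_zero_right)
    ultimately show ?thesis using PQc by simp
  qed
  moreover have "rmap f (?Q \<otimes>\<^sub>E (\<one> \<otimes>\<^sub>t x)) = ?Q \<otimes>\<^sub>E (\<one> \<otimes>\<^sub>t ?y)"
    using rmap_lmult[OF fR PQ(2) X] x_closed by (simp add: rmap_tensor fl)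
  ultimately have "rmap f (\<Delta> x) = ?Q \<otimes>\<^sub>E (\<one> \<otimes>\<^sub>t ?y)"
    by (subst split) (use PQc X y in \<open>simp add: rmap_add fl TT.tensor_closed\<close>)
  then have Dy: "\<Delta> ?y = ?Q \<otimes>\<^sub>E (\<one> \<otimes>\<^sub>t ?y)"
    using Delta_rho[OF functional_pi x_closed, of 1] unfolding f_def by simp
  \<comment> \<open>Both sides are eps \<otimes> eps \<open>\<pi> 1\<close>, contracted in different
    orders. The second order shows that y has the counit of the coefficient of x in x, which is
    1.\<close>
  have ee: "eps (evr (coef_counit 1) w) = coef_counit 1 (evl eps w)" if "w \<in> carrier E" for w
  proof -
    have "additive E (ground_algebra K) (\<lambda>w. eps (evr (coef_counit 1) w))"
      by (rule additive_comp[OF evr_additive[OF functional_pi] linear_additive[OF eps_functional]])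
    moreover have "additive E (ground_algebra K) (\<lambda>w. coef_counit 1 (evl eps w))"
      by (rule additive_comp[OF evl_additive[OF eps_functional] linear_additive[OF functional_pi]])
    ultimately show ?thesis
      by (rule TT.additive_eqI[OF _ _ that])
        (simp add: evr_tensor evl_tensor functional_pi eps_functional pi_smult functional_smult
          functional_closed p_car T.m_comm)
  qed
  have "eps ?y = coef_counit 1 (evl eps (\<Delta> x))" unfolding f_def rho_def using ee Dx by blast
  also have "\<dots> = \<one>\<^bsub>K\<^esub>" by (simp add: counit_l x_closed pi_x eps_one)
  finally have "eps ?y = \<one>\<^bsub>K\<^esub>" .
  then have "antipode_mult (\<Delta> ?y) = \<one>" using antipode_mult_Delta[OF y] by simp
  then have vy: "antipode_mult ?Q \<otimes> ?y = \<one>" unfolding Dy using antipode_mult_rmult[OF PQc(2) y] by simp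
  have mc: "antipode_mult ?Q \<in> carrier T" using additive_closed[OF antipode_mult_additive PQc(2)] .
  have R: "antipode_mult ?Q \<in> carrier R" "?y \<in> carrier R"
    using invertible_in_A[OF R_domain sigma_inj mc y vy one_neq_zero_T] by blast+
  let ?v = "antipode_mult ?Q"
  \<comment> \<open>In a domain a left inverse is also a right inverse: (y v - 1) y = y (v y) - y =
    0 and y is nonzero.\<close>
  have "(?y \<otimes> ?v \<ominus> \<one>) \<otimes> ?y = ?y \<otimes> (?v \<otimes> ?y) \<ominus> ?y"
    using mc y by (simp add: a_minus_def T.A.l_distr T.A.l_minus T.A.m_assoc)
  then have z: "(?y \<otimes> ?v \<ominus> \<one>) \<otimes> ?y = \<zero>" using vy y by simp
  have "?y \<noteq> \<zero>" using vy mc one_neq_zero_T by auto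
  moreover have "?y \<otimes> ?v \<ominus> \<one> \<in> carrier R"
  proof -
    have "\<ominus> \<one> = \<ominus>\<^bsub>R\<^esub> \<one>\<^bsub>R\<^esub>"
    proof (rule T.M.minus_equality)
      show "\<ominus>\<^bsub>R\<^esub> \<one>\<^bsub>R\<^esub> \<oplus> \<one> = \<zero>"
        using R.M.l_neg[OF R.A.one_closed] sub_add[of "\<ominus>\<^bsub>R\<^esub> \<one>\<^bsub>R\<^esub>" "\<one>\<^bsub>R\<^esub>"]
        by (simp add: sub_one sub_zero R_one)
    qed (use sub_carrier R.M.a_inv_closed[OF R.A.one_closed] in auto)
    then have "\<ominus> \<one> \<in> carrier R" using R.M.a_inv_closed[OF R.A.one_closed] by simp
    then show ?thesis unfolding a_minus_def using R R_mult R_add by blast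
  qed
  ultimately have "?y \<otimes> ?v \<ominus> \<one> = \<zero>" using R_domain[OF _ R(2) z] by blast
  then have yv: "?y \<otimes> ?v = \<one>" using mc y by simp
  have c1: "\<one> \<otimes>\<^sub>t ?y \<in> carrier E" "\<one> \<otimes>\<^sub>t ?v \<in> carrier E" "\<Delta> ?v \<in> carrier E" "\<Delta> ?y \<in> carrier E"
    using y mc TT.tensor_closed Delta_closed by auto
  have one1: "(\<one> \<otimes>\<^sub>t ?y) \<otimes>\<^sub>E (\<one> \<otimes>\<^sub>t ?v) = \<one>\<^sub>E" using y mc yv by (simp add: E_simps TT.one_E)
  have "?Q = ?Q \<otimes>\<^sub>E ((\<one> \<otimes>\<^sub>t ?y) \<otimes>\<^sub>E (\<one> \<otimes>\<^sub>t ?v))" using one1 PQc by simp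
  also have "\<dots> = \<Delta> ?y \<otimes>\<^sub>E (\<one> \<otimes>\<^sub>t ?v)" unfolding Dy using c1 PQc by (simp add: E.m_assoc)
  finally have Q: "?Q = \<Delta> ?y \<otimes>\<^sub>E (\<one> \<otimes>\<^sub>t ?v)" .
  have "\<Delta> ?v \<otimes>\<^sub>E ?Q = (\<Delta> ?v \<otimes>\<^sub>E \<Delta> ?y) \<otimes>\<^sub>E (\<one> \<otimes>\<^sub>t ?v)"
    by (subst Q) (use c1 in \<open>simp add: E.m_assoc\<close>)
  also have "\<Delta> ?v \<otimes>\<^sub>E \<Delta> ?y = \<one>\<^sub>E" using Delta_mult[OF mc y] vy Delta_one by simp
  finally have DvQ: "\<Delta> ?v \<otimes>\<^sub>E ?Q = \<one> \<otimes>\<^sub>t ?v" using c1 by simp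
  have "\<Delta> (?v \<otimes> x) = \<Delta> ?v \<otimes>\<^sub>E (?P \<oplus>\<^sub>E ?Q \<otimes>\<^sub>E (\<one> \<otimes>\<^sub>t x))"
    unfolding Delta_mult[OF mc x_closed] split[symmetric] ..
  also have "\<dots> = \<Delta> ?v \<otimes>\<^sub>E ?P \<oplus>\<^sub>E (\<Delta> ?v \<otimes>\<^sub>E ?Q) \<otimes>\<^sub>E (\<one> \<otimes>\<^sub>t x)"
    using c1 PQc X by (simp add: E.r_distr E.m_assoc)
  also have "\<dots> = \<Delta> ?v \<otimes>\<^sub>E ?P \<oplus>\<^sub>E \<one> \<otimes>\<^sub>t (?v \<otimes> x)"
    unfolding DvQ using mc x_closed by (simp add: E_simps)
  finally show ?thesis
    using R yv vy right.A_mult[OF Delta_R_TR[OF R(1)] PQ(1)] by blast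
qed

end

subsection \<open>The leading term in the first factor\<close>

locale hopf_skew_normal = hopf_skew +
  fixes P
  assumes P_TR: "P \<in> TR" and Delta_x: "comult T x = P \<oplus>\<^bsub>tensor_algebra K T T\<^esub> \<one> \<otimes>\<^sub>t x"
begin

lemma P_closed: "P \<in> carrier E"
  using P_TR right.A_car by blast

text \<open>Otherwise id \<otimes> eps applied to \<Delta>(x) would exhibit x as an element of R. So
  the degree in the first factor is positive.\<close>

lemma P_notin_RT: "P \<notin> RT"
proof
  assume P: "P \<in> RT"
  have "x = evr eps P \<oplus> eps x \<odot> \<one>"
    using counit_r[OF x_closed] x_closed P_closed unfolding Delta_x
    by (simp add: evr_add eps_functional TT.tensor_closed evr_tensor)
  moreover have "evr eps P \<in> carrier R" using evr_RT[OF eps_functional P] .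
  moreover have "eps x \<odot> \<one> \<in> carrier R"
    using R_smult[OF _ R_one] functional_closed[OF eps_functional x_closed] by blast
  ultimately show False using x_notin_R R_add by metis
qed

lemma lmap_pi_x2: "j > 0 \<Longrightarrow> lmap (\<pi> j) (\<one> \<otimes>\<^sub>t x) = \<zero>\<^sub>E"
  using x_closed by (simp add: lmap_tensor pi_linear p_A R_one TT.tensor_zero_left)

text \<open>The summand 1 \<otimes> x has degree 0 in x \<otimes> 1.\<close>

lemma lmap_pi_Delta: "j > 0 \<Longrightarrow> lmap (\<pi> j) (\<Delta> x) = lmap (\<pi> j) P"
  unfolding Delta_x using x_closed P_closed lmap_pi_x2
  by (simp add: lmap_add pi_linear TT.tensor_closed lmap_closed)

lemma sig_one: "sig \<one> = \<one>"
  by (simp add: sig_def p_A R_one sigma_one)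

text \<open>After the normalisation \<Delta>(x) is monic of degree 1 in 1 \<otimes> x, and id
  \<otimes> \<sigma> fixes the unit, so the powers stay monic.\<close>

lemma Delta_pow_right:
  "right.deg_le j (\<Delta> x [^]\<^bsub>E\<^esub> j) \<and> rmap (\<pi> j) (\<Delta> x [^]\<^bsub>E\<^esub> j) = \<one>\<^sub>E"
proof (induction j)
  case 0
  then show ?case using right.deg_le_A[OF right.A_one] right.p_A[OF right.A_one] by simp
next
  case (Suc j)
  have X: "\<one> \<otimes>\<^sub>t x \<in> carrier E" using x_closed by (simp add: TT.tensor_closed)
  have "rmap (\<pi> 1) (\<Delta> x) = \<one>\<^sub>E"
    unfolding Delta_x using right.p_add[OF P_closed X, of 1] right.p_A[OF P_TR, of 1] x_closed
    by (simp add: rmap_tensor pi_linear pi_x TT.one_E TT.tensor_closed)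
  moreover have "(rmap sig ^^ j) \<one>\<^sub>E = \<one>\<^sub>E"
    by (induction j) (simp_all add: TT.one_E rmap_tensor sig_linear sig_one)
  ultimately show ?case using right.deg_mult[OF Delta_x_degree, of j "\<Delta> x [^]\<^bsub>E\<^esub> j"] Suc by simp
qed

text \<open>Both sides of \<open>rho_lam\<close> are evaluated at x. By
  \<open>Delta_pow_right\<close> the map \<open>rho\<close> kills x^j for j < m and sends x^m to 1,
  so on the left only the leading coefficient of P is left over. The map \<open>lam\<close> kills R
  because m > 0, so on the right P disappears and only the contribution of 1 \<otimes> x
  remains.\<close>

lemma coefficient:
  assumes m: "left.deg_le m P" "m > 0"
  shows "lmap (\<pi> m) P = \<one> \<otimes>\<^sub>t lam (coef_counit m) x" and "lam (coef_counit m) x \<in> carrier R"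
proof -
  let ?r = "rho (coef_counit m)" and ?l = "lam (coef_counit m)"
  have rl: "?r \<in> linear_map K T T" "?l \<in> linear_map K T T"
    by (rule rho_linear[OF functional_pi] lam_linear[OF functional_pi])+
  have Dx: "\<Delta> x \<in> carrier E" using Delta_closed x_closed by blast
  have X: "\<one> \<otimes>\<^sub>t x \<in> carrier E" using x_closed by (simp add: TT.tensor_closed)
  have dm: "left.deg_le m (\<Delta> x)"
    using lmap_pi_Delta m Dx unfolding left.deg_le_def by simp
  have pw: "?r (x [^] j) = evr eps (rmap (\<pi> m) (\<Delta> x [^]\<^bsub>E\<^esub> j))" for j :: nat
    using x_closed by (simp add: rho_coef Delta_pow)
  have "?r (x [^] j) = \<zero>" if "j < m" for j
    unfolding pw using that Delta_pow_right[of j] evr_zero[OF eps_functional]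
    unfolding right.deg_le_def by simp
  then have "lmap ?r (\<Delta> x) = lmap (\<pi> m) (\<Delta> x) \<otimes>\<^sub>E (?r (x [^] m) \<otimes>\<^sub>t \<one>)"
    by (intro lmap_lead[OF rho_R_linear dm])
  also have "?r (x [^] m) = \<one>"
    unfolding pw using Delta_pow_right[of m]
    by (simp add: TT.one_E evr_tensor[OF eps_functional] eps_one)
  finally have L: "lmap ?r (\<Delta> x) = lmap (\<pi> m) P"
    using m lmap_pi_Delta left.p_car[OF P_closed] by (simp add: TT.one_E[symmetric])
  have l1: "?l \<one> = \<zero>"
    using m by (simp add: lam_coef Delta_one left.p_A[OF left.A_one] evl_zero[OF eps_functional])
  have "rmap ?l (P \<otimes>\<^sub>E \<one>\<^sub>E) = P \<otimes>\<^sub>E rmap ?l \<one>\<^sub>E"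
    by (rule rmap_lmult[OF lam_R_linear P_TR]) simp
  moreover have "rmap ?l \<one>\<^sub>E = \<zero>\<^sub>E"
    unfolding TT.one_E by (simp add: rmap_tensor rl l1 TT.tensor_zero_right)
  ultimately have "rmap ?l P = \<zero>\<^sub>E" using P_closed by simp
  then have "rmap ?l (\<Delta> x) = \<one> \<otimes>\<^sub>t ?l x"
    unfolding Delta_x using P_closed X x_closed rl
    by (simp add: rmap_add rmap_tensor linear_closed[OF rl(2)] TT.tensor_closed)
  then show e: "lmap (\<pi> m) P = \<one> \<otimes>\<^sub>t ?l x"
    using rho_lam[OF functional_pi x_closed, of m] L by simp
  have "?l x = evl eps (lmap (\<pi> m) P)" using m lmap_pi_Delta x_closed by (simp add: lam_coef)
  then show "?l x \<in> carrier R"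
    using evl_TR[OF eps_functional lmap_TR[OF pi_linear P_TR]] by simp
qed

text \<open>The leading coefficient 1 \<otimes> q has the unit in its first factor, so \<sigma>
  \<otimes> id leaves it fixed and the leading coefficients simply multiply.\<close>

lemma Delta_pow_left:
  assumes m: "left.deg_le m (\<Delta> x)" and q: "lmap (\<pi> m) (\<Delta> x) = \<one> \<otimes>\<^sub>t q" "q \<in> carrier T"
  shows "left.deg_le (m * j) (\<Delta> x [^]\<^bsub>E\<^esub> j) \<and> lmap (\<pi> (m * j)) (\<Delta> x [^]\<^bsub>E\<^esub> j) = \<one> \<otimes>\<^sub>t (q [^] j)"
proof (induction j)
  case 0
  then show ?case using left.deg_le_A[OF left.A_one] left.p_A[OF left.A_one, of 0] TT.one_E by simp
next
  case (Suc j)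
  have "(lmap sig ^^ k) (\<one> \<otimes>\<^sub>t q) = \<one> \<otimes>\<^sub>t q" for k
    by (induction k) (simp_all add: q(2) lmap_tensor sig_linear sig_one)
  then show ?case
    using left.deg_mult[OF m, of "m * j" "\<Delta> x [^]\<^bsub>E\<^esub> j"] Suc q by (simp add: E_simps add.commute)
qed

text \<open>If \<open>\<Delta>(x)\<close> has leading term \<open>x\<^sup>m \<otimes> q\<close> in the first factor, then comparing the two sides of
  coassociativity at degree \<open>m\<^sup>2\<close> in the first factor gives \<open>\<Delta>(l) = q\<^sup>m \<otimes> q\<close>, where
  \<open>l = (\<epsilon>\<pi>\<^sub>m\<^sub>m \<otimes> id) \<Delta>(x)\<close> vanishes unless \<open>m = 1\<close>.\<close>

lemma Delta_x_form:
  "\<exists>q\<in>carrier R. \<exists>w\<in>carrier RR.E.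
    \<Delta> q = q \<otimes>\<^sub>t q \<and> eps q = \<one>\<^bsub>K\<^esub> \<and> \<Delta> x = incl w \<oplus>\<^sub>E x \<otimes>\<^sub>t q \<oplus>\<^sub>E \<one> \<otimes>\<^sub>t x"
proof -
  have Dx: "\<Delta> x \<in> carrier E" using Delta_closed x_closed by blast
  have X: "\<one> \<otimes>\<^sub>t x \<in> carrier E" using x_closed by (simp add: TT.tensor_closed)
  have "P \<noteq> \<zero>\<^sub>E" using P_notin_RT left.A_zero by auto
  then obtain m where m: "left.deg_le m P" "lmap (\<pi> m) P \<noteq> \<zero>\<^sub>E"
    using left.degree_exists[OF P_closed] by blast
  have m0: "m > 0"
  proof (rule ccontr)
    assume "\<not> m > 0"
    then have "P \<in> RT" using m(1) left.deg_le_zero left.p_closed[OF P_closed, of 0] by simp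
    then show False using P_notin_RT by blast
  qed
  define q where "q = lam (coef_counit m) x"
  have q: "lmap (\<pi> m) P = \<one> \<otimes>\<^sub>t q" "q \<in> carrier R"
    using coefficient[OF m(1) m0] unfolding q_def by auto
  have qT: "q \<in> carrier T" using q(2) sub_carrier by blast
  have q0: "q \<noteq> \<zero>"
  proof
    assume "q = \<zero>"
    then have "\<one> \<otimes>\<^sub>t q = \<zero>\<^sub>E" by (simp add: TT.tensor_zero_right)
    with m(2) q(1) show False by (simp only:)
  qed
  have dm: "left.deg_le m (\<Delta> x)" using lmap_pi_Delta m(1) Dx m0 unfolding left.deg_le_def by simp
  have qx: "lmap (\<pi> m) (\<Delta> x) = \<one> \<otimes>\<^sub>t q" using lmap_pi_Delta[OF m0] q(1) by simp
  \<comment> \<open>The index m * m is the degree in x \<otimes> 1 at which \<Delta>(x)^m has its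
    leading term, while lower powers of \<Delta>(x) do not reach it. Hence this map kills x^j for j
    < m and sends x^m to q^m.\<close>
  let ?l = "lam (coef_counit (m * m))"
  have pw: "?l (x [^] j) = evl eps (lmap (\<pi> (m * m)) (\<Delta> x [^]\<^bsub>E\<^esub> j))" for j :: nat
    using x_closed by (simp add: lam_coef Delta_pow)
  have low: "?l (x [^] j) = \<zero>" if "j < m" for j
    unfolding pw using that Delta_pow_left[OF dm qx qT, of j] evl_zero[OF eps_functional] m0
    unfolding left.deg_le_def by simp
  have top: "?l (x [^] m) = q [^] m"
    unfolding pw using Delta_pow_left[OF dm qx qT, of m] qT
    by (simp add: evl_tensor[OF eps_functional] eps_one)
  have "\<Delta> (?l x) = lmap (\<pi> m) (\<Delta> x) \<otimes>\<^sub>E (?l (x [^] m) \<otimes>\<^sub>t \<one>)"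
    unfolding Delta_lam[OF functional_pi x_closed] by (rule lmap_lead[OF lam_R_linear dm low])
  then have Dl: "\<Delta> (?l x) = (q [^] m) \<otimes>\<^sub>t q" unfolding qx top using qT by (simp add: E_simps)
  have qmR: "q [^] k \<in> carrier R \<and> q [^] k \<noteq> \<zero>" for k :: nat
  proof (induction k)
    case (Suc k)
    then show ?case using R_mult[of "q [^] k" q] R_domain[of "q [^] k" q] q(2) q0 by auto
  qed (use R_one one_neq_zero_T in simp)
  \<comment> \<open>In R \<otimes> R the element factors as q^m \<otimes> 1 times 1 \<otimes> q, and
    contraction with eps shows that both factors are nonzero.\<close>
  have "(q [^] m) \<otimes>\<^sub>t q \<noteq> \<zero>\<^sub>E"
  proof
    assume "(q [^] m) \<otimes>\<^sub>t q = \<zero>\<^sub>E"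
    then have "((q [^] m) \<otimes>\<^sub>t \<one>) \<otimes>\<^sub>E (\<one> \<otimes>\<^sub>t q) = \<zero>\<^sub>E" using qT by (simp add: E_simps)
    then have "(q [^] m) \<otimes>\<^sub>t \<one> = \<zero>\<^sub>E \<or> \<one> \<otimes>\<^sub>t q = \<zero>\<^sub>E"
      by (intro RR_domain IntI tensor_TR tensor_RT)
        (use qmR[of m] q(2) qT R_one in simp_all)
    moreover have "evr eps ((q [^] m) \<otimes>\<^sub>t \<one>) = q [^] m" "evl eps (\<one> \<otimes>\<^sub>t q) = q"
      using qT by (simp_all add: evr_tensor evl_tensor eps_functional eps_one)
    ultimately show False
      using qmR[of m] q0 evr_zero[OF eps_functional] evl_zero[OF eps_functional] by auto
  qed
  then have lx: "?l x \<noteq> \<zero>" using Dl Delta_zero by auto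
  \<comment> \<open>For m > 1 the exponent 1 is one of those below m, so the map would kill x,
    contrary to \<open>lx\<close>.\<close>
  have m1: "m = 1"
  proof (rule ccontr)
    assume "m \<noteq> 1"
    then have "?l (x [^] (1::nat)) = \<zero>" using low[of 1] m0 by linarith
    then show False using lx x_closed by simp
  qed
  have Dq: "\<Delta> q = q \<otimes>\<^sub>t q" using Dl qT unfolding q_def m1 by simp
  have "P = lmap (\<pi> 0) P \<oplus>\<^sub>E x \<otimes>\<^sub>t q"
  proof -
    obtain u' where u': "left.deg_le 0 u'" "P = u' \<oplus>\<^sub>E lmap (\<pi> (Suc 0)) P \<otimes>\<^sub>E (x \<otimes>\<^sub>t \<one>) [^]\<^bsub>E\<^esub> Suc 0"
      using left.deg_le_Suc[of 0 P] m(1) unfolding m1 One_nat_def by blast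
    have uc: "u' \<in> carrier E" "u' \<in> RT" "lmap (\<pi> 0) u' = u'"
      using left.deg_le_closed[OF u'(1)] left.deg_le_zero[OF u'(1)] left.p_closed[of u' 0] by auto
    have "lmap (\<pi> (Suc 0)) P \<otimes>\<^sub>E (x \<otimes>\<^sub>t \<one>) [^]\<^bsub>E\<^esub> Suc 0 = x \<otimes>\<^sub>t q"
      using q(1) x_closed qT unfolding m1 by (simp add: E_simps)
    then have Pu: "P = u' \<oplus>\<^sub>E x \<otimes>\<^sub>t q" using u'(2) by simp
    have "lmap (\<pi> 0) (u' \<oplus>\<^sub>E x \<otimes>\<^sub>t q) = u'"
      using uc x_closed qT by (simp add: lmap_add pi_linear TT.tensor_closed lmap_tensor pi_x TT.tensor_zero_left)
    then show ?thesis using Pu by simp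
  qed
  moreover define w where "w = to_RR (lmap (\<pi> 0) P)"
  have "lmap (\<pi> 0) P \<in> TR" "lmap (\<pi> 0) P \<in> RT"
    using lmap_TR[OF pi_linear P_TR] left.p_closed[OF P_closed] by blast+
  then have w: "w \<in> carrier RR.E" "incl w = lmap (\<pi> 0) P"
    unfolding w_def using to_RR_closed incl_to_RR' right.A_car by blast+
  ultimately have Pw: "P = incl w \<oplus>\<^sub>E x \<otimes>\<^sub>t q" by simp
  then have Dxw: "\<Delta> x = incl w \<oplus>\<^sub>E x \<otimes>\<^sub>t q \<oplus>\<^sub>E \<one> \<otimes>\<^sub>t x" using Delta_x by simp
  have iw: "incl w \<in> RT" "incl w \<in> carrier E" using incl_RR[OF w(1)] left.A_car by blast+
  have ev: "evr eps (incl w) \<in> carrier R" using evr_RT[OF eps_functional iw(1)] .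
  have K: "eps q \<in> carrier K" "eps x \<in> carrier K" using functional_closed[OF eps_functional] qT x_closed by auto
  \<comment> \<open>Comparing the coefficients of x in this consequence of the counit law gives the
    counit of q.\<close>
  have "x = evr eps (incl w) \<oplus> eps q \<odot> x \<oplus> eps x \<odot> \<one>"
    using counit_r[OF x_closed] x_closed qT iw unfolding Dxw
    by (simp add: evr_add eps_functional TT.tensor_closed evr_tensor)
  then have "\<pi> 1 x = \<pi> 1 (evr eps (incl w) \<oplus> eps q \<odot> x \<oplus> eps x \<odot> \<one>)" by (rule arg_cong)
  also have "\<dots> = eps q \<odot> \<one>"
    using ev sub_carrier[OF ev] K x_closed R_one
    by (simp add: p_add p_A pi_smult pi_x)
  finally have "eps q \<odot> \<one> = \<one>" using pi_x[of 1] by simp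
  then have "eps q = \<one>\<^bsub>K\<^esub>" using eps_smult_one[OF K(1)] eps_one by simp
  then show ?thesis using q(2) w(1) Dq Dxw by blast
qed

end

context hopf_skew_normal
begin

text \<open>The new variable is S(q) x, where S(q) is inverse to the grouplike q. Multiplying by
  \<Delta>(S(q)) = S(q) \<otimes> S(q) turns x \<otimes> q into S(q) x \<otimes> 1 and 1 \<otimes> x
  into S(q) \<otimes> S(q) x, so q itself serves as \<beta>. That the inverse belongs to R is
  recorded for the Hopf Ore condition.\<close>

lemma hopf_ore_variable:
  "\<exists>x' \<sigma>' \<delta>'. skew_polynomial_ext K R T x' \<sigma>' \<delta>' \<and>
    (\<exists>\<beta> w. grouplike K R \<beta> \<and> inv\<^bsub>R\<^esub> \<beta> \<in> carrier R \<and> w \<in> carrier RR.E \<and>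
      comult T x' = tensor K T T (inv\<^bsub>R\<^esub> \<beta>) x' \<oplus>\<^sub>E tensor K T T x' \<one>\<^bsub>T\<^esub> \<oplus>\<^sub>E tensor_incl K T w)"
proof -
  obtain q w where q: "q \<in> carrier R" "\<Delta> q = q \<otimes>\<^sub>t q" "eps q = \<one>\<^bsub>K\<^esub>"
    and w: "w \<in> carrier RR.E" and Dx: "\<Delta> x = incl w \<oplus>\<^sub>E x \<otimes>\<^sub>t q \<oplus>\<^sub>E \<one> \<otimes>\<^sub>t x"
    using Delta_x_form by blast
  let ?s = "S q"
  have qT: "q \<in> carrier T" using q(1) sub_carrier by blast
  have sR: "?s \<in> carrier R"
  proof -
    have "?s = antipode R q" using sub q(1) unfolding hopf_subalgebra_def by blast
    then show ?thesis using linear_closed[OF hopf_algebra.antipode_linear[OF hopf_R] q(1)] by simp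
  qed
  have sT: "?s \<in> carrier T" using sR sub_carrier by blast
  have sq: "?s \<otimes> q = \<one>"
    using antipode_mult_Delta[OF qT] unfolding q(2,3) antipode_mult_tensor[OF qT qT] by simp
  have qs: "q \<otimes> ?s = \<one>"
  proof -
    have b: "balanced K T T (add_monoid T) (\<lambda>y z. y \<otimes> S z)"
      by (rule balanced_addI[OF T.M.abelian_group_axioms])
        (simp_all add: linear_closed[OF antipode_linear] linear_add[OF antipode_linear]
          linear_smult[OF antipode_linear] T.A.l_distr T.A.r_distr T.smult_mult_left T.smult_mult_right)
    show ?thesis
      using hopf_algebra.antipode_right[OF hopf_T qT] unfolding q(2,3) TT.lift_tensor[OF b qT qT] by simp
  qed
  have "comult R q = to_RR (\<Delta> q)" using to_RR_incl[OF comult_R_closed[OF q(1)]] Delta_R[OF q(1)] by simp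
  then have "comult R q = tensor K R R q q" using qT q(1,2) by (simp add: to_RR_tensor p_A)
  moreover have "counit R q = \<one>\<^bsub>K\<^esub>" using sub q(1,3) unfolding hopf_subalgebra_def by auto
  ultimately have g: "grouplike K R q" using q(1) unfolding grouplike_def by blast
  have inv: "inv\<^bsub>R\<^esub> q = ?s"
    using R.A.inv_unique'[OF q(1) sR] qs sq q(1) sR by (simp add: sub_mult sub_one)
  \<comment> \<open>\<Delta>(S(q)) is a left inverse of \<Delta>(q) = q \<otimes> q, and S(q)
    \<otimes> S(q) is a right inverse.\<close>
  have D: "\<Delta> ?s = ?s \<otimes>\<^sub>t ?s"
  proof -
    have "\<Delta> ?s = \<Delta> ?s \<otimes>\<^sub>E ((q \<otimes>\<^sub>t q) \<otimes>\<^sub>E (?s \<otimes>\<^sub>t ?s))"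
      using qT sT qs Delta_closed[OF sT] by (simp add: TT.tensor_mult TT.one_E[symmetric])
    also have "\<dots> = (\<Delta> ?s \<otimes>\<^sub>E \<Delta> q) \<otimes>\<^sub>E (?s \<otimes>\<^sub>t ?s)"
      unfolding q(2) using qT sT Delta_closed[OF sT] by (simp add: E.m_assoc TT.tensor_closed)
    also have "\<Delta> ?s \<otimes>\<^sub>E \<Delta> q = \<one>\<^sub>E" using Delta_mult[OF sT qT] sq Delta_one by simp
    finally show ?thesis using sT by (simp add: TT.tensor_closed)
  qed
  let ?ss = "tensor K R R ?s ?s"
  have ss: "?ss \<in> carrier RR.E" using sR by (simp add: RR.tensor_closed)
  have iw: "incl w \<in> carrier E" using incl_closed[OF w] .
  have "\<Delta> (?s \<otimes> x) = (?s \<otimes>\<^sub>t ?s) \<otimes>\<^sub>E (incl w \<oplus>\<^sub>E x \<otimes>\<^sub>t q \<oplus>\<^sub>E \<one> \<otimes>\<^sub>t x)"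
    unfolding Delta_mult[OF sT x_closed] D Dx ..
  also have "\<dots> = (?s \<otimes>\<^sub>t ?s) \<otimes>\<^sub>E incl w \<oplus>\<^sub>E (?s \<otimes> x) \<otimes>\<^sub>t \<one> \<oplus>\<^sub>E ?s \<otimes>\<^sub>t (?s \<otimes> x)"
    using sT qT x_closed iw sq by (simp add: E.r_distr E_simps)
  also have "(?s \<otimes>\<^sub>t ?s) \<otimes>\<^sub>E incl w = incl (?ss \<otimes>\<^bsub>RR.E\<^esub> w)"
    using incl_mult[OF ss w] sR by (simp add: incl_tensor)
  also have "incl (?ss \<otimes>\<^bsub>RR.E\<^esub> w) \<oplus>\<^sub>E (?s \<otimes> x) \<otimes>\<^sub>t \<one> \<oplus>\<^sub>E ?s \<otimes>\<^sub>t (?s \<otimes> x) =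
      ?s \<otimes>\<^sub>t (?s \<otimes> x) \<oplus>\<^sub>E (?s \<otimes> x) \<otimes>\<^sub>t \<one> \<oplus>\<^sub>E incl (?ss \<otimes>\<^bsub>RR.E\<^esub> w)"
    using sT x_closed incl_closed[OF RR.mult_closed'[OF w ss]] by (simp add: TT.tensor_closed TT.E.a_ac)
  finally have Ds: "\<Delta> (?s \<otimes> x) = inv\<^bsub>R\<^esub> q \<otimes>\<^sub>t (?s \<otimes> x) \<oplus>\<^sub>E (?s \<otimes> x) \<otimes>\<^sub>t \<one> \<oplus>\<^sub>E
      incl (?ss \<otimes>\<^bsub>RR.E\<^esub> w)"
    unfolding inv .
  have "inv\<^bsub>R\<^esub> q \<in> carrier R" using sR unfolding inv .
  with g RR.mult_closed'[OF w ss] Ds change_of_variable[OF sR q(1) sq qs]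
  show ?thesis unfolding incl_def by blast
qed

end

text \<open>\<open>TR\<close> is defined through the coefficient map of a chosen variable, but
  additively it is generated by the tensors of elements of T with elements of R. This carries the
  remainder P over to the new variable.\<close>

lemma (in skew_ext) TR_independent:
  assumes "skew_ext K R T y \<sigma>' \<delta>'" "u \<in> TR"
  shows "u \<in> skew_ext.TR K R T y"
proof -
  interpret y: skew_ext K R T y \<sigma>' \<delta>' by fact
  show ?thesis
    using assms(2) by (induction u rule: TR_induct) (simp_all add: y.tensor_TR y.right.A_add)
qed

theorem corollary2p3:
  fixes K :: "('k, 'n) ring_scheme"
    and R :: "('k, 'a, 'm) hopf_scheme"
    and T :: "('k, 'a, 'l) hopf_scheme"
    and x :: 'a and \<sigma> \<delta> :: "'a \<Rightarrow> 'a"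
  assumes "field K"
    and "hopf_algebra K R"
    and "nc_noetherian_ring R"
    and "skew_polynomial_ext K R T x \<sigma> \<delta>"
    and "hopf_algebra K T"
    and "hopf_subalgebra K R T"
    and "nc_domain (tensor_algebra K R R)"
  shows "(\<exists>x' \<sigma>' \<delta>'. skew_polynomial_ext K R T x' \<sigma>' \<delta>' \<and>
            (\<exists>\<beta> w. grouplike K R \<beta> \<and> w \<in> carrier (tensor_algebra K R R) \<and>
              comult T x' =
                tensor K T T (inv\<^bsub>R\<^esub> \<beta>) x' \<oplus>\<^bsub>tensor_algebra K T T\<^esub>
                tensor K T T x' \<one>\<^bsub>T\<^esub> \<oplus>\<^bsub>tensor_algebra K T T\<^esub>
                tensor_incl K T w)) \<and>
         hopf_ore_extension K R T"
proof -
  interpret o: hopf_skew K R T x \<sigma> \<delta>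
    by (intro hopf_skew.intro skew_domain.intro skew_ext.intro skew_domain_axioms.intro
        hopf_skew_axioms.intro assms)
  obtain u v P where uv: "u \<in> carrier R" "v \<in> carrier R" "u \<otimes>\<^bsub>T\<^esub> v = \<one>\<^bsub>T\<^esub>" "v \<otimes>\<^bsub>T\<^esub> u = \<one>\<^bsub>T\<^esub>"
    and P: "P \<in> o.TR" "comult T (u \<otimes>\<^bsub>T\<^esub> x) = P \<oplus>\<^bsub>tensor_algebra K T T\<^esub> tensor K T T \<one>\<^bsub>T\<^esub> (u \<otimes>\<^bsub>T\<^esub> x)"
    using o.normalise_second by blast
  note y = skew_ext.intro[OF o.change_of_variable[OF uv]]
  interpret n: hopf_skew_normal K R T "u \<otimes>\<^bsub>T\<^esub> x" "\<lambda>r. u \<otimes>\<^bsub>T\<^esub> \<sigma> r \<otimes>\<^bsub>T\<^esub> v" "\<lambda>r. u \<otimes>\<^bsub>T\<^esub> \<delta> r" P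
    by (intro hopf_skew_normal.intro hopf_skew.intro skew_domain.intro skew_domain_axioms.intro
        hopf_skew_axioms.intro hopf_skew_normal_axioms.intro y assms o.TR_independent[OF y P(1)] P(2))
  obtain x' \<sigma>' \<delta>' \<beta> w where x': "skew_polynomial_ext K R T x' \<sigma>' \<delta>'" and \<beta>: "grouplike K R \<beta>" "inv\<^bsub>R\<^esub> \<beta> \<in> carrier R"
    and w: "w \<in> carrier (tensor_algebra K R R)"
    and D: "comult T x' = tensor K T T (inv\<^bsub>R\<^esub> \<beta>) x' \<oplus>\<^bsub>tensor_algebra K T T\<^esub>
        tensor K T T x' \<one>\<^bsub>T\<^esub> \<oplus>\<^bsub>tensor_algebra K T T\<^esub> tensor_incl K T w"
    using n.hopf_ore_variable by blast
  interpret x': skew_ext K R T x' \<sigma>' \<delta>' by (rule skew_ext.intro[OF x'])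
  \<comment> \<open>The Hopf Ore condition is met with b = 1 and v = 0; the term with v vanishes and
    is inserted to match its shape.\<close>
  let ?E = "tensor_algebra K T T" and ?v = "\<zero>\<^bsub>tensor_algebra K R R\<^esub>"
  have "tensor_incl K T ?v = \<zero>\<^bsub>?E\<^esub>"
    using additive_zero[OF o.RR.abelian_group_E o.TT.abelian_group_E x'.incl_additive]
    unfolding x'.incl_def .
  then have "tensor_incl K T ?v \<otimes>\<^bsub>?E\<^esub> tensor K T T x' x' = \<zero>\<^bsub>?E\<^esub>"
    using x'.x_closed by (simp add: o.TT.tensor_closed)
  then have "comult T x' = tensor K T T (inv\<^bsub>R\<^esub> \<beta>) x' \<oplus>\<^bsub>?E\<^esub> tensor K T T x' \<one>\<^bsub>T\<^esub> \<oplus>\<^bsub>?E\<^esub>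
      tensor_incl K T ?v \<otimes>\<^bsub>?E\<^esub> tensor K T T x' x' \<oplus>\<^bsub>?E\<^esub> tensor_incl K T w"
    unfolding D using \<beta>(2) x'.x_closed by (simp add: o.TT.tensor_closed x'.sub_carrier)
  then have "hopf_ore_extension K R T"
    unfolding hopf_ore_extension_def
    using assms(6) x' \<beta>(2) x'.R_one o.RR.E.zero_closed w by blast
  then show ?thesis using x' \<beta>(1) w D by blast
qed

end
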